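(* For every fixed integer $k\ge 1$ there is an algorithm that, given a finite simple graph $G$ with $n$ vertices, decides in time $f(k)\cdot n^{O(k^2)}$ whether $\mathrm{cpw}(G)\le k-1$, where $f$ is some function depending on $k$ only. In particular, for every fixed $k$ the running time is polynomial in $n$.
   Context: A path decomposition of a finite simple graph $G=(V(G),E(G))$ is a sequence $\mathcal{P}=(X_1,\dots,X_l)$ of subsets of $V(G)$ (called bags) such that (i) $\bigcup_{i=1}^l X_i=V(G)$; (ii) for each edge $\{u,v\}\in E(G)$ there is $i$ with $u,v\in X_i$; (iii) for all $1\le i\le j\le m\le l$, $X_i\cap X_m\subseteq X_j$. Its width is $\max_i |X_i|-1$. It is connected if the induced subgraph $G[X_1\cup\dots\cup X_i]$ is connected for every $i\in\{1,\dots,l\}$. The connected pathwidth $\mathrm{cpw}(G)$ is the minimum width over all connected path decompositions of $G$; thus $\mathrm{cpw}(G)\le k-1$ means that $G$ has a connected path decomposition all of whose bags have size at most $k$. *)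

theory Defs
  imports
    "Graph_Theory.Digraph_Component"
    "HOL-Library.Extended_Nat"
    "HOL-Library.Landau_Symbols"
    "HOL-Computational_Algebra.Polynomial"
begin

section \<open>Connected pathwidth\<close>

text \<open>
  A finite simple graph is a \<open>pair_graph\<close>: finitely many vertices, no loops, and a symmetric arc
  relation, the edge \<open>{u, v}\<close> being the pair of arcs \<open>(u, v)\<close>, \<open>(v, u)\<close>.  The bags
  \<open>X\<^sub>1, \<dots>, X\<^sub>l\<close> are \<open>Xs ! 0, \<dots>, Xs ! (l - 1)\<close>, with \<open>l \<ge> 1\<close>.
\<close>

definition path_decomposition :: "'a pair_pre_digraph \<Rightarrow> 'a set list \<Rightarrow> bool" where
  "path_decomposition G Xs \<longleftrightarrow>
     Xs \<noteq> [] \<and>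
     (\<Union>X\<in>set Xs. X) = pverts G \<and>
     (\<forall>u v. (u, v) \<in> parcs G \<longrightarrow> (\<exists>X\<in>set Xs. u \<in> X \<and> v \<in> X)) \<and>
     (\<forall>i j m. i \<le> j \<and> j \<le> m \<and> m < length Xs \<longrightarrow> Xs ! i \<inter> Xs ! m \<subseteq> Xs ! j)"

text \<open>
  The truncated subtraction only matters if all bags are empty, i.e. for the graph without vertices,
  which has no connected path decomposition (the library's \<open>connected\<close> excludes the empty graph).
\<close>

definition pd_width :: "'a set list \<Rightarrow> nat" where
  "pd_width Xs = Max (card ` set Xs) - 1"

definition connected_path_decomposition :: "'a pair_pre_digraph \<Rightarrow> 'a set list \<Rightarrow> bool" where
  "connected_path_decomposition G Xs \<longleftrightarrow>
     path_decomposition G Xs \<and>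
     (\<forall>i\<in>{1..length Xs}.
        Digraph_Component.connected (with_proj G \<restriction> (\<Union>X\<in>set (take i Xs). X)))"

text \<open>
  A disconnected graph has no connected path decomposition; its value is \<open>Inf {} = \<infinity>\<close>.
  Otherwise the infimum is attained, so it is the minimum.
\<close>

definition cpw :: "'a pair_pre_digraph \<Rightarrow> enat" where
  "cpw G = (INF Xs\<in>{Xs. connected_path_decomposition G Xs}. enat (pd_width Xs))"

lemma cpw_le_iff:
  fixes G :: "'a pair_pre_digraph"
  assumes "k \<ge> 1"
  shows "cpw G \<le> enat (k - 1) \<longleftrightarrow>
    (\<exists>Xs. connected_path_decomposition G Xs \<and> (\<forall>X\<in>set Xs. card X \<le> k))"
proof -
  let ?S = "(\<lambda>Xs. enat (pd_width Xs)) ` {Xs. connected_path_decomposition G Xs}"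
  have w: "pd_width Xs \<le> k - 1 \<longleftrightarrow> (\<forall>X\<in>set Xs. card X \<le> k)"
    if "connected_path_decomposition G Xs" for Xs :: "'a set list"
  proof -
    have "Xs \<noteq> []"
      using that by (simp add: connected_path_decomposition_def path_decomposition_def)
    have "pd_width Xs \<le> k - 1 \<longleftrightarrow> Max (card ` set Xs) \<le> k"
      using assms by (auto simp: pd_width_def)
    then show ?thesis using \<open>Xs \<noteq> []\<close> by simp
  qed
  show ?thesis
  proof
    assume le: "cpw G \<le> enat (k - 1)"
    have "?S \<noteq> {}"
    proof
      assume "?S = {}"
      then have "cpw G = \<infinity>"
        unfolding cpw_def by (simp only: Inf_empty top_enat_def)
      with le show False by simp
    qed
    then obtain w where "w \<in> ?S"
      by blast
    then have "Inf ?S \<in> ?S"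
      by (rule wellorder_InfI)
    then obtain Xs where "connected_path_decomposition G Xs" "cpw G = enat (pd_width Xs)"
      by (auto simp: cpw_def)
    with le w show "\<exists>Xs. connected_path_decomposition G Xs \<and> (\<forall>X\<in>set Xs. card X \<le> k)"
      by auto
  next
    assume "\<exists>Xs. connected_path_decomposition G Xs \<and> (\<forall>X\<in>set Xs. card X \<le> k)"
    then obtain Xs where Xs: "connected_path_decomposition G Xs" "\<forall>X\<in>set Xs. card X \<le> k"
      by blast
    have "cpw G \<le> enat (pd_width Xs)"
      unfolding cpw_def using Xs(1) by (intro INF_lower) simp
    also have "\<dots> \<le> enat (k - 1)" using w[OF Xs(1)] Xs(2) by simp
    finally show "cpw G \<le> enat (k - 1)" .
  qed
qed


section \<open>Model of computation\<close>

text \<open>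
  A random access machine with unit costs, in structured form.  The store consists of unbounded
  arrays of natural numbers; a program mentions finitely many of them, and scalar variables are
  the cells with index 0.  Indirect addressing is \<open>Cell x e\<close> with a computed index \<open>e\<close>.
  The only arithmetic is addition and truncated subtraction.  There is deliberately no
  multiplication: the length of the numbers grows by \<open>O(t)\<close> bits in \<open>t\<close> steps, so the model is polynomially
  equivalent to Turing machines although the cost of an operation ignores the size of its operands.
\<close>

type_synonym vname = string
type_synonym store = "vname \<Rightarrow> nat \<Rightarrow> nat"

datatype aexp =
    Const nat
  | Cell vname aexp
  | Plus aexp aexp
  | Minus aexp aexp

fun aval :: "aexp \<Rightarrow> store \<Rightarrow> nat" where
  "aval (Const a) s = a"
| "aval (Cell x e) s = s x (aval e s)"
| "aval (Plus e1 e2) s = aval e1 s + aval e2 s"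
| "aval (Minus e1 e2) s = aval e1 s - aval e2 s"

fun acost :: "aexp \<Rightarrow> nat" where
  "acost (Const a) = 1"
| "acost (Cell x e) = 1 + acost e"
| "acost (Plus e1 e2) = 1 + acost e1 + acost e2"
| "acost (Minus e1 e2) = 1 + acost e1 + acost e2"

datatype com =
    Skip
  | Assign vname aexp aexp  \<comment> \<open>\<open>x[e\<^sub>1] := e\<^sub>2\<close>\<close>
  | Seq com com
  | If aexp com com         \<comment> \<open>a test succeeds if its value is not 0\<close>
  | While aexp com

text \<open>\<open>exec c s t s'\<close>: started in \<open>s\<close>, the program \<open>c\<close> halts after \<open>t\<close> steps in \<open>s'\<close>.\<close>

inductive exec :: "com \<Rightarrow> store \<Rightarrow> nat \<Rightarrow> store \<Rightarrow> bool" where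
  Skip: "exec Skip s 1 s"
| Assign: "exec (Assign x e1 e2) s (1 + acost e1 + acost e2)
     (s(x := (s x)(aval e1 s := aval e2 s)))"
| Seq: "exec c1 s1 t1 s2 \<Longrightarrow> exec c2 s2 t2 s3 \<Longrightarrow> exec (Seq c1 c2) s1 (t1 + t2) s3"
| IfTrue: "aval b s \<noteq> 0 \<Longrightarrow> exec c1 s t s' \<Longrightarrow> exec (If b c1 c2) s (1 + acost b + t) s'"
| IfFalse: "aval b s = 0 \<Longrightarrow> exec c2 s t s' \<Longrightarrow> exec (If b c1 c2) s (1 + acost b + t) s'"
| WhileFalse: "aval b s = 0 \<Longrightarrow> exec (While b c) s (1 + acost b) s"
| WhileTrue: "aval b s1 \<noteq> 0 \<Longrightarrow> exec c s1 t1 s2 \<Longrightarrow> exec (While b c) s2 t2 s3 \<Longrightarrow>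
     exec (While b c) s1 (1 + acost b + t1 + t2) s3"

inductive_cases exec_SkipE: "exec Skip s t s'"
inductive_cases exec_AssignE: "exec (Assign x e1 e2) s t s'"
inductive_cases exec_SeqE: "exec (Seq c1 c2) s t s'"
inductive_cases exec_IfE: "exec (If b c1 c2) s t s'"
inductive_cases exec_WhileE: "exec (While b c) s t s'"

lemma exec_deterministic:
  "exec c s t s' \<Longrightarrow> exec c s u s'' \<Longrightarrow> u = t \<and> s'' = s'"
proof (induction arbitrary: u s'' rule: exec.induct)
  case (Skip s)
  then show ?case by (auto elim: exec_SkipE)
next
  case (Assign x e1 e2 s)
  then show ?case by (auto elim: exec_AssignE)
next
  case (Seq c1 s1 t1 s2 c2 t2 s3)
  from Seq.prems show ?case
    by (rule exec_SeqE) (metis Seq.IH)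
next
  case (IfTrue b s c1 t s' c2)
  from IfTrue.prems show ?case
    by (rule exec_IfE) (use IfTrue.hyps(1) IfTrue.IH in force)+
next
  case (IfFalse b s c2 t s' c1)
  from IfFalse.prems show ?case
    by (rule exec_IfE) (use IfFalse.hyps(1) IfFalse.IH in force)+
next
  case (WhileFalse b s c)
  from WhileFalse.prems show ?case
    by (rule exec_WhileE) (use WhileFalse.hyps in simp_all)
next
  case (WhileTrue b s1 c t1 s2 t2 s3)
  from WhileTrue.prems obtain u1 r u2
    where u: "u = 1 + acost b + u1 + u2" "exec c s1 u1 r" "exec (While b c) r u2 s''"
    by (rule exec.cases) (use WhileTrue.hyps(1) in auto)
  have "u1 = t1 \<and> r = s2"
    using WhileTrue.IH(1)[OF u(2)] .
  moreover from this u(3) have "u2 = t2 \<and> s'' = s3"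
    using WhileTrue.IH(2) by simp
  ultimately show ?case using u(1) by simp
qed


section \<open>Deciding graph properties\<close>

text \<open>
  The vertices of an input graph are numbered \<open>0, \<dots>, n - 1\<close>.  The program receives \<open>n\<close> and the
  adjacency matrix, stored row by row; all other cells are initially 0.
\<close>

definition graph_input :: "nat \<Rightarrow> nat pair_pre_digraph \<Rightarrow> store" where
  "graph_input n G = (\<lambda>x i.
     if x = ''n'' \<and> i = 0 then n
     else if x = ''adj'' \<and> (\<exists>(u, v)\<in>parcs G. i = u * n + v) then 1
     else 0)"

definition decides_in_time ::
    "com \<Rightarrow> (nat pair_pre_digraph \<Rightarrow> bool) \<Rightarrow> (nat \<Rightarrow> nat) \<Rightarrow> bool" where
  "decides_in_time A Q T \<longleftrightarrow>
     (\<forall>n G. pair_graph G \<and> pverts G = {..<n} \<longrightarrow>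
        (\<exists>t s. exec A (graph_input n G) t s \<and> t \<le> T n \<and> (s ''answer'' 0 \<noteq> 0 \<longleftrightarrow> Q G)))"

end

theory Submission
  imports Defs
begin

text \<open>
  Connectivity of all prefixes is a local condition.  Give every vertex \<open>v\<close> the interval \<open>[s v, e v)\<close> of the
  bags that contain it.  All prefixes are connected if every vertex except a root \<open>r\<close> has a neighbour that
  enters strictly earlier, and every connected path decomposition can be refined to one with this property,
  by ordering the new vertices of a bag by their distance from the previous prefix.

  Consider a set \<open>C\<close> of vertices that is attached to the rest of the graph only through at most \<open>k\<close> boundary
  slots.  What it can contribute to an interval model is the set of all words that record, bag by bag, the
  slots present and a capacity for the vertices of \<open>C\<close>, together with the slots that find an earlier neighbour
  in \<open>C\<close>.  Such sets of words are closed under raising capacities and under repeating or merging equal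
  letters.  By the typical sequences of Bodlaender and Kloks, a set with these closure properties is determined
  by its members of bounded length, so for fixed \<open>k\<close> there are only finitely many of them (types).  The type
  of a disjoint union is a function of the types of the parts, and so is the type after turning a slot into an
  interior vertex.

  If \<open>G\<close> has an interval model, then every component \<open>C\<close> of \<open>G\<close> minus a boundary tuple that arises from the
  root by repeatedly moving the earliest vertex \<open>x\<close> of \<open>C\<close> to the boundary has at most \<open>k - 1\<close> neighbours, since
  these share a bag with \<open>x\<close>; so some slot is free for \<open>x\<close>.  Hence the types of all pairs of a \<open>k\<close>-tuple and a
  component that are needed can be computed by a fixed-point iteration, in time \<open>n^(k + O(1))\<close>.  The finite
  tables of the program depend on \<open>k\<close> only and are obtained non-constructively.
\<close>

section \<open>Words and their stretchings\<close>

text \<open>The type of a tuple and a component is a property of the graph alone, not of the way in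
  which it was obtained. Hence every table entry that is ever written is correct, whichever vertex
  and slot led to it, and competing choices never conflict. A model is needed only to show that
  entries exist: a missing entry at a root refutes every model with this root, and if none is
  missing, the answer is read off an exact type.

  Two obstacles shape the definitions. A piece cannot remember how its parts are joined in each
  prefix; asking for one strictly earlier neighbour replaces this by one bit per slot, and
  strictness excludes circular justifications. Moreover, the words of different pieces must be
  aligned bag by bag, although each piece needs its own number of bags; stretchings, with closure in
  both directions, absorb the difference.\<close>

definition stretches :: "'a list \<Rightarrow> 'a list \<Rightarrow> (nat \<Rightarrow> nat) \<Rightarrow> bool" where
  "stretches w w' f \<longleftrightarrow>
     (\<forall>i i'. i \<le> i' \<longrightarrow> i' < length w' \<longrightarrow> f i \<le> f i') \<and>
     f ` {..<length w'} = {..<length w} \<and>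
     (\<forall>i<length w'. w' ! i = w ! f i)"

definition stretch :: "'a list \<Rightarrow> 'a list \<Rightarrow> bool" where
  "stretch w w' \<longleftrightarrow> (\<exists>f. stretches w w' f)"

lemma stretches_image: "stretches w w' f \<Longrightarrow> f ` {..<length w'} = {..<length w}"
  by (simp only: stretches_def)

lemma stretches_less: "stretches w w' f \<Longrightarrow> i < length w' \<Longrightarrow> f i < length w"
  using stretches_image[of w w' f] by blast

lemma stretches_surj:
  assumes "stretches w w' f" "p < length w"
  obtains i where "i < length w'" "f i = p"
proof -
  have "p \<in> f ` {..<length w'}" using assms stretches_image[OF assms(1)] by simp
  then show ?thesis using that by auto
qed

lemma stretches_mono: "stretches w w' f \<Longrightarrow> i \<le> i' \<Longrightarrow> i' < length w' \<Longrightarrow> f i \<le> f i'"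
  by (simp add: stretches_def)

lemma stretches_nth: "stretches w w' f \<Longrightarrow> i < length w' \<Longrightarrow> w' ! i = w ! f i"
  by (simp add: stretches_def)

lemma stretches_set:
  assumes "stretches w w' f"
  shows "set w' = set w"
proof -
  have "set w' = (!) w ` f ` {..<length w'}"
    using stretches_nth[OF assms] by (force simp: in_set_conv_nth image_iff)
  also have "\<dots> = set w"
    using assms by (auto simp: stretches_def in_set_conv_nth)
  finally show ?thesis .
qed

lemma stretch_refl: "stretch w w"
  unfolding stretch_def stretches_def by (rule exI[of _ id]) auto

lemma stretch_trans:
  assumes "stretch u v" "stretch v w"
  shows "stretch u w"
proof -
  obtain f g where fg: "stretches u v f" "stretches v w g"
    using assms by (auto simp: stretch_def)
  have "g ` {..<length w} = {..<length v}" "f ` {..<length v} = {..<length u}"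
    using fg by (simp_all add: stretches_def)
  then have "(f \<circ> g) ` {..<length w} = {..<length u}"
    by (simp only: image_comp[symmetric])
  moreover have "(f \<circ> g) i \<le> (f \<circ> g) i'" if "i \<le> i'" "i' < length w" for i i'
    using stretches_mono[OF fg(1) stretches_mono[OF fg(2) that] stretches_less[OF fg(2) that(2)]] by simp
  moreover have "w ! i = u ! (f \<circ> g) i" if "i < length w" for i
    using stretches_nth[OF fg(2) that] stretches_nth[OF fg(1) stretches_less[OF fg(2) that]] by simp
  ultimately have "stretches u w (f \<circ> g)"
    unfolding stretches_def by blast
  then show ?thesis by (auto simp: stretch_def)
qed

lemma stretches_remap:
  assumes "stretches w w' f" "length u = length w"
  shows "stretches u (map (\<lambda>i. u ! f i) [0..<length w']) f"
  using assms unfolding stretches_def by simp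

text \<open>Uniform stretchings are cofinal, hence any two stretchings have a common refinement.\<close>

lemma stretches_uniform:
  assumes f: "stretches w w' f" and D: "length w' \<le> D" "0 < D"
  shows "stretch w' (map (\<lambda>i. w ! (i div D)) [0..<D * length w])"
proof -
  let ?n = "length w'" and ?l = "length w"
  define lo where "lo q = (LEAST i. i < ?n \<and> f i = q)" for q
  define hi where "hi q = (GREATEST i. i < ?n \<and> f i = q)" for q
  have lo: "lo q < ?n \<and> f (lo q) = q" if "q < ?l" for q
    unfolding lo_def by (rule LeastI_ex) (use stretches_surj[OF f that] in blast)
  have hi: "hi q < ?n \<and> f (hi q) = q" if "q < ?l" for q
    unfolding hi_def by (rule GreatestI_ex_nat[where b="?n"]) (use stretches_surj[OF f that] in auto)
  have lo_le: "lo q \<le> i" if "i < ?n" "f i = q" for q i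
    unfolding lo_def by (rule Least_le) (use that in auto)
  have hi_ge: "i \<le> hi q" if "i < ?n" "f i = q" for q i
    unfolding hi_def by (rule Greatest_le_nat[where b="?n"]) (use that in auto)
  have lohi: "hi q < lo q'" if "q < q'" "q' < ?l" for q q'
  proof (rule ccontr)
    assume "\<not> hi q < lo q'"
    then have "f (lo q') \<le> f (hi q)"
      using hi[of q] that by (intro stretches_mono[OF f]) auto
    then show False using lo[of q'] hi[of q] that by auto
  qed
  \<comment> \<open>Inside the block of \<open>D\<close> copies of one letter the map walks through
    the preimage of its position and then stays at the last element; \<open>length w' <= D\<close>
    leaves room to reach that element.\<close>
  define g where "g i = min (lo (i div D) + i mod D) (hi (i div D))" for i
  have g_bounds: "lo (i div D) \<le> g i" "g i \<le> hi (i div D)" if "i div D < ?l" for i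
    using lo_le[of "hi (i div D)" "i div D"] hi[OF that] by (auto simp: g_def)
  have fg: "f (g i) = i div D" "g i < ?n" if "i div D < ?l" for i
  proof -
    show "g i < ?n" using g_bounds[OF that] hi[OF that] by linarith
    have "f (lo (i div D)) \<le> f (g i)" "f (g i) \<le> f (hi (i div D))"
      using g_bounds[OF that] hi[OF that] by (intro stretches_mono[OF f]; linarith)+
    then show "f (g i) = i div D" using lo[OF that] hi[OF that] by auto
  qed
  have dv: "i div D < ?l" if "i < D * ?l" for i
    using that D by (simp add: less_mult_imp_div_less mult.commute)
  have "stretches w' (map (\<lambda>i. w ! (i div D)) [0..<D * ?l]) g"
    unfolding stretches_def
  proof (intro conjI allI impI)
    fix i i' assume ii: "i \<le> i'" "i' < length (map (\<lambda>i. w ! (i div D)) [0..<D * ?l])"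
    then have l: "i div D < ?l" "i' div D < ?l" using dv by auto
    show "g i \<le> g i'"
    proof (cases "i div D = i' div D")
      case True
      have "i mod D \<le> i' mod D"
        using ii True by (metis add_le_cancel_left div_mult_mod_eq)
      then show ?thesis by (auto simp: g_def True)
    next
      case False
      then have "i div D < i' div D" using ii div_le_mono[of i i' D] by linarith
      then show ?thesis using lohi[of "i div D" "i' div D"] g_bounds l by (meson le_trans less_imp_le)
    qed
  next
    show "g ` {..<length (map (\<lambda>i. w ! (i div D)) [0..<D * ?l])} = {..<?n}"
    proof (intro equalityI subsetI)
      fix x assume "x \<in> g ` {..<length (map (\<lambda>i. w ! (i div D)) [0..<D * ?l])}"
      then show "x \<in> {..<?n}" using dv fg by auto
    next
      fix x assume "x \<in> {..<?n}"
      then have x: "x < ?n" by simp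
      let ?q = "f x"
      have q: "?q < ?l" using stretches_less[OF f x] .
      have b: "lo ?q \<le> x" "x \<le> hi ?q" using lo_le hi_ge x by auto
      have r: "x - lo ?q < D" using x D by linarith
      let ?i = "?q * D + (x - lo ?q)"
      have "?i div D = ?q" "?i mod D = x - lo ?q" using r by auto
      then have "g ?i = x" using b by (simp add: g_def)
      moreover have "?i < D * ?l"
      proof -
        have "?i < ?q * D + D" using r by simp
        also have "\<dots> = Suc ?q * D" by simp
        also have "\<dots> \<le> ?l * D" using q by (intro mult_le_mono1) simp
        finally show ?thesis by (simp add: mult.commute)
      qed
      ultimately show "x \<in> g ` {..<length (map (\<lambda>i. w ! (i div D)) [0..<D * ?l])}"
        by (metis (no_types, lifting) diff_zero image_eqI length_map length_upt lessThan_iff)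
    qed
  next
    fix i assume "i < length (map (\<lambda>i. w ! (i div D)) [0..<D * ?l])"
    then have i: "i < D * ?l" by simp
    show "map (\<lambda>i. w ! (i div D)) [0..<D * ?l] ! i = w' ! g i"
      using fg[OF dv[OF i]] stretches_nth[OF f, of "g i"] i by simp
  qed
  then show ?thesis by (auto simp: stretch_def)
qed

lemma stretch_common:
  assumes "stretch w u" "stretch w v"
  obtains z where "stretch u z" "stretch v z"
proof -
  obtain f g where fg: "stretches w u f" "stretches w v g"
    using assms by (auto simp: stretch_def)
  let ?D = "Suc (max (length u) (length v))"
  show ?thesis
    by (rule that[OF stretches_uniform[OF fg(1), of ?D] stretches_uniform[OF fg(2), of ?D]]) simp_all
qed

text \<open>The index map \<open>i div D\<close> depends only on the length of the words. One map
  thus refines all words aligned with \<open>w1\<close> at once, which keeps them comparable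
  position by position in \<open>lang_merge\<close>.\<close>

lemma stretches_common_shape:
  assumes "stretch w1 u1" "stretch w2 u2" "length w1 = length w2"
  obtains f n where
    "\<And>w. length w = length w1 \<Longrightarrow> stretches w (map (\<lambda>i. w ! f i) [0..<n]) f"
    "stretch u1 (map (\<lambda>i. w1 ! f i) [0..<n])" "stretch u2 (map (\<lambda>i. w2 ! f i) [0..<n])"
proof -
  obtain f1 f2 where fg: "stretches w1 u1 f1" "stretches w2 u2 f2"
    using assms by (auto simp: stretch_def)
  let ?D = "Suc (max (length u1) (length u2))"
  let ?n = "?D * length w1"
  show ?thesis
  proof (rule that[of "\<lambda>i. i div ?D" ?n])
    fix w :: "'c list"
    assume w: "length w = length w1"
    have sj: "(\<lambda>i. i div ?D) ` {..<?n} = {..<length w}"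
    proof (intro equalityI subsetI)
      fix x assume "x \<in> (\<lambda>i. i div ?D) ` {..<?n}"
      then show "x \<in> {..<length w}" using w
        by (auto simp: less_mult_imp_div_less mult.commute simp del: mult_Suc mult_Suc_right)
    next
      fix x assume "x \<in> {..<length w}"
      then have "?D * x < ?n" "(?D * x) div ?D = x" using w by (simp_all del: mult_Suc mult_Suc_right)
      then show "x \<in> (\<lambda>i. i div ?D) ` {..<?n}" by (metis image_eqI lessThan_iff)
    qed
    show "stretches w (map (\<lambda>i. w ! (i div ?D)) [0..<?n]) (\<lambda>i. i div ?D)"
      unfolding stretches_def using sj by (auto simp: div_le_mono simp del: mult_Suc mult_Suc_right)
  next
    show "stretch u1 (map (\<lambda>i. w1 ! (i div ?D)) [0..<?n])"
      by (rule stretches_uniform[OF fg(1)]) auto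
    show "stretch u2 (map (\<lambda>i. w2 ! (i div ?D)) [0..<?n])"
      using stretches_uniform[OF fg(2), of ?D] assms(3) by auto
  qed
qed

lemma stretch_append:
  assumes "stretch u u'" "stretch v v'"
  shows "stretch (u @ v) (u' @ v')"
proof -
  obtain f g where f: "stretches u u' f" and g: "stretches v v' g"
    using assms by (auto simp: stretch_def)
  let ?h = "\<lambda>i. if i < length u' then f i else length u + g (i - length u')"
  have "?h ` {..<length (u' @ v')} = {..<length (u @ v)}"
  proof (intro equalityI subsetI)
    fix x assume "x \<in> ?h ` {..<length (u' @ v')}"
    then obtain i where "x = ?h i" "i \<in> {..<length (u' @ v')}" by (rule imageE)
    then show "x \<in> {..<length (u @ v)}"
      using stretches_less[OF f, of i] stretches_less[OF g, of "i - length u'"] by (auto split: if_splits)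
  next
    fix x assume x: "x \<in> {..<length (u @ v)}"
    show "x \<in> ?h ` {..<length (u' @ v')}"
    proof (cases "x < length u")
      case True
      then obtain i where "i < length u'" "f i = x" using stretches_surj[OF f] by blast
      then show ?thesis by (intro image_eqI[of _ _ i]) auto
    next
      case False
      then have "x - length u < length v" using x by auto
      then obtain i where "i < length v'" "g i = x - length u" using stretches_surj[OF g] by blast
      then show ?thesis using False by (intro image_eqI[of _ _ "length u' + i"]) auto
    qed
  qed
  moreover have "?h i \<le> ?h i'" if "i \<le> i'" "i' < length (u' @ v')" for i i'
    using that stretches_mono[OF f, of i i'] stretches_mono[OF g, of "i - length u'" "i' - length u'"]
      stretches_less[OF f, of i] by auto
  moreover have "(u' @ v') ! i = (u @ v) ! ?h i" if "i < length (u' @ v')" for i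
    using that stretches_nth[OF f, of i] stretches_nth[OF g, of "i - length u'"] stretches_less[OF f, of i]
    by (auto simp: nth_append)
  ultimately have "stretches (u @ v) (u' @ v') ?h"
    unfolding stretches_def by blast
  then show ?thesis by (auto simp: stretch_def)
qed

lemma stretch_replicate: "0 < n \<Longrightarrow> stretch [a] (replicate n a)"
  unfolding stretch_def stretches_def by (rule exI[of _ "\<lambda>_. 0"]) auto


section \<open>Nice languages\<close>

type_synonym letter = "nat set \<times> nat"

text \<open>The interval property of path decompositions, for the vertex held by slot
  \<open>j\<close>.\<close>

definition itrace :: "nat \<Rightarrow> letter list \<Rightarrow> bool" where
  "itrace j w \<longleftrightarrow> (\<forall>i1 i2 i3. i1 \<le> i2 \<longrightarrow> i2 \<le> i3 \<longrightarrow> i3 < length w \<longrightarrow>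
     j \<in> fst (w ! i1) \<longrightarrow> j \<in> fst (w ! i3) \<longrightarrow> j \<in> fst (w ! i2))"

definition adm :: "nat \<Rightarrow> nat \<Rightarrow> letter list \<Rightarrow> bool" where
  "adm m k w \<longleftrightarrow> set w \<subseteq> Pow {..<m} \<times> {..k} \<and> (\<forall>j. itrace j w)"

definition above :: "letter list \<Rightarrow> letter list \<Rightarrow> bool" where
  "above w w' \<longleftrightarrow> list_all2 (\<lambda>x y. fst x = fst y \<and> snd x \<le> snd y) w w'"

text \<open>Capacities may only be raised, whereas stretching works in both directions. Together
  this is enough for the compression of words and weak enough to hold for every
  \<open>lang\<close>.\<close>

definition nice :: "nat \<Rightarrow> nat \<Rightarrow> (nat set \<times> letter list) set \<Rightarrow> bool" where
  "nice m k M \<longleftrightarrow>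
     (\<forall>J w. (J, w) \<in> M \<longrightarrow> J \<subseteq> {..<m} \<and> adm m k w) \<and>
     (\<forall>J w w'. (J, w) \<in> M \<longrightarrow> above w w' \<longrightarrow> snd ` set w' \<subseteq> {..k} \<longrightarrow> (J, w') \<in> M) \<and>
     (\<forall>J w w'. stretch w w' \<longrightarrow> ((J, w) \<in> M \<longleftrightarrow> (J, w') \<in> M))"

lemma itrace_stretches:
  assumes f: "stretches w w' f"
  shows "itrace j w' \<longleftrightarrow> itrace j w"
proof
  assume t: "itrace j w"
  show "itrace j w'"
    unfolding itrace_def
  proof (intro allI impI)
    fix i1 i2 i3
    assume i: "i1 \<le> i2" "i2 \<le> i3" "i3 < length w'" and j: "j \<in> fst (w' ! i1)" "j \<in> fst (w' ! i3)"
    have l: "i1 < length w'" "i2 < length w'" using i by auto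
    have "f i1 \<le> f i2" "f i2 \<le> f i3" using i l by (auto intro: stretches_mono[OF f])
    then show "j \<in> fst (w' ! i2)"
      using t j stretches_less[OF f i(3)] stretches_nth[OF f] l i(3) unfolding itrace_def by metis
  qed
next
  assume t: "itrace j w'"
  show "itrace j w"
    unfolding itrace_def
  proof (intro allI impI)
    fix i1 i2 i3
    assume i: "i1 \<le> i2" "i2 \<le> i3" "i3 < length w" and j: "j \<in> fst (w ! i1)" "j \<in> fst (w ! i3)"
    obtain p1 where p1: "p1 < length w'" "f p1 = i1" using stretches_surj[OF f, of i1] i by auto
    obtain p2 where p2: "p2 < length w'" "f p2 = i2" using stretches_surj[OF f, of i2] i by auto
    obtain p3 where p3: "p3 < length w'" "f p3 = i3" using stretches_surj[OF f, of i3] i by auto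
    show "j \<in> fst (w ! i2)"
    \<comment> \<open>Preimages are ordered like their images only where the images differ, so
      coinciding indices are treated apart.\<close>
    proof (cases "i1 = i2 \<or> i2 = i3")
      case True then show ?thesis using j by auto
    next
      case False
      then have "p1 \<le> p2" "p2 \<le> p3"
        using i p1 p2 p3 stretches_mono[OF f, of p2 p1] stretches_mono[OF f, of p3 p2] by force+
      then show ?thesis
        using t j p1 p2 p3 stretches_nth[OF f] unfolding itrace_def by metis
    qed
  qed
qed

lemma adm_stretches: "stretches w w' f \<Longrightarrow> adm m k w' \<longleftrightarrow> adm m k w"
  by (simp add: adm_def itrace_stretches stretches_set)

lemma adm_stretch: "stretch w w' \<Longrightarrow> adm m k w' \<longleftrightarrow> adm m k w"
  by (auto simp: stretch_def adm_stretches)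

lemma above_nth:
  "above w w' \<longleftrightarrow> length w = length w' \<and> (\<forall>i<length w. fst (w ! i) = fst (w' ! i) \<and> snd (w ! i) \<le> snd (w' ! i))"
  by (auto simp: above_def list_all2_conv_all_nth)

lemma adm_above:
  assumes "above w w'" "adm m k w" "snd ` set w' \<subseteq> {..k}"
  shows "adm m k w'"
proof -
  have len: "length w' = length w" using assms(1) by (simp add: above_nth)
  have f: "fst (w' ! i) = fst (w ! i)" if "i < length w" for i
    using assms(1) that by (auto simp: above_nth)
  have "itrace j w'" for j
    unfolding itrace_def
  proof (intro allI impI)
    fix i1 i2 i3
    assume i: "i1 \<le> i2" "i2 \<le> i3" "i3 < length w'" and j: "j \<in> fst (w' ! i1)" "j \<in> fst (w' ! i3)"
    have "itrace j w" using assms(2) by (simp add: adm_def)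
    from this[unfolded itrace_def, rule_format, of i1 i2 i3] show "j \<in> fst (w' ! i2)"
      using i j by (simp add: f len)
  qed
  moreover have fs: "fst x \<subseteq> {..<m}" if "x \<in> set w'" for x
  proof -
    obtain i where i: "i < length w" "x = w' ! i" using \<open>x \<in> set w'\<close> len by (auto simp: in_set_conv_nth)
    then have "fst x = fst (w ! i)" using f by simp
    moreover have "w ! i \<in> set w" using i by simp
    ultimately have "x = (fst x, snd x)" "(fst x, snd (w ! i)) \<in> set w" by (metis prod.collapse)+
    then show ?thesis using assms(2) unfolding adm_def by blast
  qed
  moreover have "x \<in> Pow {..<m} \<times> {..k}" if "x \<in> set w'" for x
    using assms(3) that fs[OF that] by (simp add: mem_Times_iff) blast
  ultimately show ?thesis unfolding adm_def by blast
qed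

lemma above_refl: "above w w"
  by (simp add: above_nth)

lemma above_append: "above u u' \<Longrightarrow> above v v' \<Longrightarrow> above (u @ v) (u' @ v')"
  by (auto simp: above_def list_all2_appendI)

text \<open>A syntactic congruence for all nice languages simultaneously: factors can be replaced
  one by one, and whether a replacement is allowed does not depend on the language.\<close>

definition interch :: "nat \<Rightarrow> nat \<Rightarrow> letter list \<Rightarrow> letter list \<Rightarrow> bool" where
  "interch m k w w' \<longleftrightarrow>
     (\<forall>M J p q. nice m k M \<longrightarrow> ((J, p @ w @ q) \<in> M \<longleftrightarrow> (J, p @ w' @ q) \<in> M))"

lemma interch_refl: "interch m k w w"
  by (simp add: interch_def)

lemma interch_trans: "interch m k u v \<Longrightarrow> interch m k v w \<Longrightarrow> interch m k u w"
  by (simp add: interch_def)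

lemma interch_append:
  assumes "interch m k u u'" "interch m k v v'"
  shows "interch m k (u @ v) (u' @ v')"
  unfolding interch_def
proof (intro allI impI)
  fix M J p q assume M: "nice m k M"
  have "(J, p @ u @ (v @ q)) \<in> M \<longleftrightarrow> (J, p @ u' @ (v @ q)) \<in> M"
    using assms(1) M unfolding interch_def by blast
  also have "\<dots> \<longleftrightarrow> (J, (p @ u') @ v @ q) \<in> M" by simp
  also have "\<dots> \<longleftrightarrow> (J, (p @ u') @ v' @ q) \<in> M"
    using assms(2) M unfolding interch_def by blast
  finally show "(J, p @ (u @ v) @ q) \<in> M \<longleftrightarrow> (J, p @ (u' @ v') @ q) \<in> M" by simp
qed

lemma nice_above: "nice m k M \<Longrightarrow> (J, w) \<in> M \<Longrightarrow> above w w' \<Longrightarrow> snd ` set w' \<subseteq> {..k} \<Longrightarrow> (J, w') \<in> M"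
  unfolding nice_def by blast

lemma nice_stretch: "nice m k M \<Longrightarrow> stretch w w' \<Longrightarrow> (J, w) \<in> M \<longleftrightarrow> (J, w') \<in> M"
  unfolding nice_def by blast

lemma nice_caps: "nice m k M \<Longrightarrow> (J, w) \<in> M \<Longrightarrow> snd ` set w \<subseteq> {..k}"
  unfolding nice_def adm_def by fastforce

lemma above_replicate:
  "(\<forall>x\<in>set mid. fst x = t \<and> snd x \<le> c) \<Longrightarrow> above mid (replicate (length mid) (t, c))"
  "(\<forall>x\<in>set mid. fst x = t \<and> c \<le> snd x) \<Longrightarrow> above (replicate (length mid) (t, c)) mid"
  by (auto simp: above_nth)

text \<open>The compression step of Bodlaender and Kloks' typical sequences.\<close>

lemma interch_compress:
  assumes mid: "\<forall>x\<in>set mid. fst x = t \<and> min a b \<le> snd x \<and> snd x \<le> max a b"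
  shows "interch m k ([(t, a)] @ mid @ [(t, b)]) ([(t, a)] @ [(t, b)])"
  unfolding interch_def
proof (intro allI impI iffI)
  fix M J p q
  assume M: "nice m k M" and w: "(J, p @ ([(t, a)] @ mid @ [(t, b)]) @ q) \<in> M"
  let ?n = "length mid"
  have caps: "snd ` set (p @ ([(t, a)] @ mid @ [(t, b)]) @ q) \<subseteq> {..k}"
    by (rule nice_caps[OF M w])
  show "(J, p @ ([(t, a)] @ [(t, b)]) @ q) \<in> M"
  proof (cases "a \<le> b")
    case True
    \<comment> \<open>Deleting \<open>mid\<close>: raise it to the larger end value, then the run of
      equal letters collapses.\<close>
    have "(J, p @ [(t, a)] @ replicate ?n (t, b) @ [(t, b)] @ q) \<in> M"
      using mid True caps
      by (intro nice_above[OF M w]) (auto simp del: append.simps intro!: above_append above_refl above_replicate)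
    then have "(J, p @ [(t, a)] @ replicate (Suc ?n) (t, b) @ q) \<in> M"
      by (simp add: replicate_app_Cons_same)
    moreover have "stretch (p @ [(t, a)] @ [(t, b)] @ q) (p @ [(t, a)] @ replicate (Suc ?n) (t, b) @ q)"
      by (intro stretch_append stretch_refl stretch_replicate) simp
    ultimately show ?thesis using nice_stretch[OF M] by simp
  next
    case False
    have "(J, p @ [(t, a)] @ replicate ?n (t, a) @ [(t, b)] @ q) \<in> M"
      using mid False caps
      by (intro nice_above[OF M w]) (auto simp del: append.simps intro!: above_append above_refl above_replicate)
    then have "(J, p @ replicate (Suc ?n) (t, a) @ [(t, b)] @ q) \<in> M"
      by simp
    moreover have "stretch (p @ [(t, a)] @ [(t, b)] @ q) (p @ replicate (Suc ?n) (t, a) @ [(t, b)] @ q)"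
      by (intro stretch_append stretch_refl stretch_replicate) simp
    ultimately show ?thesis using nice_stretch[OF M] by simp
  qed
next
  fix M J p q
  assume M: "nice m k M" and w: "(J, p @ ([(t, a)] @ [(t, b)]) @ q) \<in> M"
  let ?n = "length mid"
  have caps: "snd ` set (p @ ([(t, a)] @ [(t, b)]) @ q) \<subseteq> {..k}"
    by (rule nice_caps[OF M w])
  have caps': "snd ` set (p @ [(t, a)] @ mid @ [(t, b)] @ q) \<subseteq> {..k}"
    using caps mid by fastforce
  show "(J, p @ ([(t, a)] @ mid @ [(t, b)]) @ q) \<in> M"
  proof (cases "a \<le> b")
    case True
    \<comment> \<open>Inserting \<open>mid\<close>: repeat the end letter of smaller capacity, then
      raise the copies to \<open>mid\<close>.\<close>
    have "stretch (p @ [(t, a)] @ [(t, b)] @ q) (p @ replicate (Suc ?n) (t, a) @ [(t, b)] @ q)"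
      by (intro stretch_append stretch_refl stretch_replicate) simp
    then have "(J, p @ replicate (Suc ?n) (t, a) @ [(t, b)] @ q) \<in> M"
      using nice_stretch[OF M] w by simp
    then have v: "(J, p @ [(t, a)] @ replicate ?n (t, a) @ [(t, b)] @ q) \<in> M" by simp
    have "above (replicate ?n (t, a)) mid"
      using mid True by (intro above_replicate) auto
    then have "(J, p @ [(t, a)] @ mid @ [(t, b)] @ q) \<in> M"
      using caps' by (intro nice_above[OF M v] above_append above_refl)
    then show ?thesis by simp
  next
    case False
    have "stretch (p @ [(t, a)] @ [(t, b)] @ q) (p @ [(t, a)] @ replicate (Suc ?n) (t, b) @ q)"
      by (intro stretch_append stretch_refl stretch_replicate) simp
    then have "(J, p @ [(t, a)] @ replicate (Suc ?n) (t, b) @ q) \<in> M"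
      using nice_stretch[OF M] w by simp
    then have v: "(J, p @ [(t, a)] @ replicate ?n (t, b) @ [(t, b)] @ q) \<in> M"
      by (simp add: replicate_app_Cons_same)
    have "above (replicate ?n (t, b)) mid"
      using mid False by (intro above_replicate) auto
    then have "(J, p @ [(t, a)] @ mid @ [(t, b)] @ q) \<in> M"
      using caps' by (intro nice_above[OF M v] above_append above_refl)
    then show ?thesis by simp
  qed
qed

text \<open>Between two occurrences of the maximum \<open>b\<close> only the minimum matters: the
  way down to it and the way back up are compressed separately.\<close>

lemma interch_loop:
  assumes c: "\<forall>x\<in>set c. fst x = t \<and> snd x \<le> b"
  shows "\<exists>w'. interch m k ([(t, b)] @ c @ [(t, b)]) w' \<and> length w' \<le> 3 \<and> set w' \<subseteq> insert (t, b) (set c)"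
proof (cases "c = []")
  case True
  then show ?thesis by (intro exI[of _ "[(t, b), (t, b)]"]) (auto simp: interch_refl)
next
  case False
  then have ne: "snd ` set c \<noteq> {}" by simp
  have "Min (snd ` set c) \<in> snd ` set c" using ne by (intro Min_in) auto
  then obtain y where y: "y \<in> set c" "snd y = Min (snd ` set c)" by auto
  obtain a where ya: "y = (t, a)" using y(1) c by (metis prod.collapse)
  have min: "\<forall>x\<in>set c. a \<le> snd x" using y ya ne by (auto simp: Min_le)
  obtain d1 d2 where d: "c = d1 @ y # d2" using split_list[OF y(1)] by blast
  have "a \<le> b" using c y ya by auto
  have 1: "interch m k ([(t, b)] @ d1 @ [(t, a)]) ([(t, b)] @ [(t, a)])"
    using c min \<open>a \<le> b\<close> d by (intro interch_compress) auto
  have 2: "interch m k ([(t, a)] @ d2 @ [(t, b)]) ([(t, a)] @ [(t, b)])"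
    using c min \<open>a \<le> b\<close> d by (intro interch_compress) auto
  have "interch m k (([(t, b)] @ d1 @ [(t, a)]) @ d2 @ [(t, b)]) (([(t, b)] @ [(t, a)]) @ d2 @ [(t, b)])"
    by (intro interch_append 1 interch_refl)
  moreover have "interch m k ([(t, b)] @ [(t, a)] @ d2 @ [(t, b)]) ([(t, b)] @ [(t, a)] @ [(t, b)])"
    by (rule interch_append[OF interch_refl 2])
  ultimately have "interch m k ([(t, b)] @ c @ [(t, b)]) [(t, b), (t, a), (t, b)]"
    using interch_trans d ya by fastforce
  then show ?thesis using y ya by (intro exI[of _ "[(t, b), (t, a), (t, b)]"]) auto
qed

text \<open>Induction on the bound for the capacities. Before the first and after the last
  occurrence of the top value the smaller bound applies, and the loop between the two shrinks to
  length 3, whence \<open>2 * N + 3\<close>.\<close>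

lemma interch_section:
  "\<exists>N. \<forall>t. \<forall>w :: letter list. (\<forall>x\<in>set w. fst x = t \<and> snd x < b) \<longrightarrow>
     (\<exists>w'. interch m k w w' \<and> length w' \<le> N \<and> set w' \<subseteq> set w)"
proof (induction b)
  case 0
  show ?case
  proof (intro exI[of _ 0] allI impI)
    fix t and w :: "letter list" assume "\<forall>x\<in>set w. fst x = t \<and> snd x < 0"
    then have "w = []" by (cases w) auto
    then show "\<exists>w'. interch m k w w' \<and> length w' \<le> 0 \<and> set w' \<subseteq> set w"
      by (auto simp: interch_refl)
  qed
next
  case (Suc b)
  then obtain N where N: "\<And>t w. (\<forall>x\<in>set w. fst x = t \<and> snd x < b) \<Longrightarrow>
     (\<exists>w'. interch m k w w' \<and> length w' \<le> N \<and> set w' \<subseteq> set w)" by blast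
  show ?case
  proof (intro exI[of _ "2 * N + 3"] allI impI)
    fix t and w :: "letter list" assume w: "\<forall>x\<in>set w. fst x = t \<and> snd x < Suc b"
    have small: "\<forall>x\<in>set u. fst x = t \<and> snd x < b" if u: "set u \<subseteq> set w" "(t, b) \<notin> set u" for u
    proof
      fix x assume x: "x \<in> set u"
      then have "fst x = t" "snd x < Suc b" "x \<noteq> (t, b)" using w u by auto
      then show "fst x = t \<and> snd x < b" by (cases x) (auto simp: less_Suc_eq)
    qed
    show "\<exists>w'. interch m k w w' \<and> length w' \<le> 2 * N + 3 \<and> set w' \<subseteq> set w"
    proof (cases "(t, b) \<in> set w")
      case False
      then obtain w' where "interch m k w w'" "length w' \<le> N" "set w' \<subseteq> set w"
        using N[OF small[of w]] by auto
      then show ?thesis by (intro exI[of _ w']) auto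
    next
      case True
      then obtain c0 c1 where w1: "w = c0 @ (t, b) # c1" "(t, b) \<notin> set c0"
        using split_list_first by metis
      obtain c0' where c0': "interch m k c0 c0'" "length c0' \<le> N" "set c0' \<subseteq> set c0"
        using N[OF small[of c0]] w1 by auto
      show ?thesis
      proof (cases "(t, b) \<in> set c1")
        case False
        obtain c1' where c1': "interch m k c1 c1'" "length c1' \<le> N" "set c1' \<subseteq> set c1"
          using N[OF small[of c1]] w1 False by auto
        have "interch m k (c0 @ [(t, b)] @ c1) (c0' @ [(t, b)] @ c1')"
          by (intro interch_append interch_refl c0' c1')
        then show ?thesis using w1 c0' c1' by (intro exI[of _ "c0' @ [(t, b)] @ c1'"]) auto
      next
        case True
        then obtain c2 c3 where w2: "c1 = c2 @ (t, b) # c3" "(t, b) \<notin> set c3"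
          using split_list_last by metis
        obtain c3' where c3': "interch m k c3 c3'" "length c3' \<le> N" "set c3' \<subseteq> set c3"
          using N[OF small[of c3]] w1 w2 by auto
        have "\<forall>x\<in>set c2. fst x = t \<and> snd x \<le> b"
          using w w1 w2 by (auto simp: less_Suc_eq_le)
        then obtain l where l: "interch m k ([(t, b)] @ c2 @ [(t, b)]) l" "length l \<le> 3"
            "set l \<subseteq> insert (t, b) (set c2)"
          using interch_loop by blast
        have "interch m k (c0 @ ([(t, b)] @ c2 @ [(t, b)]) @ c3) (c0' @ l @ c3')"
          by (intro interch_append c0' l c3')
        moreover have "set (c0' @ l @ c3') \<subseteq> set w" using w1 w2 c0' c3' l by auto
        ultimately show ?thesis
          using w1 w2 c0' c3' l by (intro exI[of _ "c0' @ l @ c3'"]) auto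
      qed
    qed
  qed
qed

section \<open>Cutting words along the traces of the slots\<close>

lemma itrace_append:
  assumes "itrace j (u @ v)"
  shows "itrace j u" "itrace j v"
proof -
  show "itrace j u"
    unfolding itrace_def
  proof (intro allI impI)
    fix i1 i2 i3 assume "i1 \<le> i2" "i2 \<le> i3" "i3 < length u" "j \<in> fst (u ! i1)" "j \<in> fst (u ! i3)"
    then show "j \<in> fst (u ! i2)"
      using assms[unfolded itrace_def, rule_format, of i1 i2 i3] by (auto simp: nth_append)
  qed
  show "itrace j v"
    unfolding itrace_def
  proof (intro allI impI)
    fix i1 i2 i3 assume "i1 \<le> i2" "i2 \<le> i3" "i3 < length v" "j \<in> fst (v ! i1)" "j \<in> fst (v ! i3)"
    then show "j \<in> fst (v ! i2)"
      using assms[unfolded itrace_def, rule_format, of "length u + i1" "length u + i2" "length u + i3"]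
      by (auto simp: nth_append)
  qed
qed

lemma itrace_split:
  assumes "itrace j w"
  obtains u1 u2 u3 where "w = u1 @ u2 @ u3" "\<forall>x\<in>set u1. j \<notin> fst x" "\<forall>x\<in>set u2. j \<in> fst x"
    "\<forall>x\<in>set u3. j \<notin> fst x"
proof -
  define u1 where "u1 = takeWhile (\<lambda>x. j \<notin> fst x) w"
  define r where "r = dropWhile (\<lambda>x. j \<notin> fst x) w"
  define u2 where "u2 = takeWhile (\<lambda>x. j \<in> fst x) r"
  define u3 where "u3 = dropWhile (\<lambda>x. j \<in> fst x) r"
  have w: "w = u1 @ r" "r = u2 @ u3" by (auto simp: u1_def r_def u2_def u3_def)
  have "j \<notin> fst x" if x: "x \<in> set u3" for x
  proof
    assume jx: "j \<in> fst x"
    have ne: "u3 \<noteq> []" using x by auto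
    have h3: "j \<notin> fst (hd u3)" using ne hd_dropWhile[of "\<lambda>x. j \<in> fst x" r] by (simp add: u3_def)
    have "r \<noteq> []" using ne by (auto simp: u3_def)
    then have hr: "j \<in> fst (hd r)" using hd_dropWhile[of "\<lambda>x. j \<notin> fst x" w] by (simp add: r_def)
    have "u2 \<noteq> []" using hr h3 w(2) by (cases u2) auto
    obtain i where i: "i < length u3" "x = u3 ! i" using x by (auto simp: in_set_conv_nth)
    have "itrace j r" using itrace_append(2)[of j u1 r] assms w by simp
    then have "j \<in> fst (r ! length u2)"
      using hr jx i \<open>u2 \<noteq> []\<close> w(2) \<open>r \<noteq> []\<close> unfolding itrace_def
      by (elim allE[of _ 0] allE[of _ "length u2"] allE[of _ "length u2 + i"]) (auto simp: nth_append hd_conv_nth)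
    then show False using h3 ne w(2) by (simp add: nth_append hd_conv_nth)
  qed
  moreover have "\<forall>x\<in>set u1. j \<notin> fst x" "\<forall>x\<in>set u2. j \<in> fst x"
    by (auto simp: u1_def u2_def dest: set_takeWhileD)
  ultimately show ?thesis using that w by blast
qed

text \<open>\<open>A\<close> contains the slots that may still vary within \<open>w\<close>. A slot
  is present in one consecutive block, so cutting at its two ends leaves three factors on which it
  is constant, whence \<open>3 * N\<close>. With no slot left the letters differ in capacity
  only.\<close>

lemma interch_bounded:
  assumes "finite A"
  shows "\<exists>N. \<forall>w. (\<forall>x\<in>set w. snd x \<le> k) \<longrightarrow> (\<forall>x\<in>set w. \<forall>y\<in>set w. fst x - A = fst y - A) \<longrightarrow>
     (\<forall>j\<in>A. itrace j w) \<longrightarrow> (\<exists>w'. interch m k w w' \<and> length w' \<le> N \<and> set w' \<subseteq> set w)"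
  using assms
proof (induction A)
  case empty
  obtain N where N: "\<And>t w. (\<forall>x\<in>set w. fst x = t \<and> snd x < Suc k) \<Longrightarrow>
     (\<exists>w'. interch m k w w' \<and> length w' \<le> N \<and> set w' \<subseteq> set w)"
    using interch_section[of "Suc k" m k] by blast
  show ?case
  proof (intro exI[of _ N] allI impI)
    fix w :: "letter list" assume w: "\<forall>x\<in>set w. snd x \<le> k" "\<forall>x\<in>set w. \<forall>y\<in>set w. fst x - {} = fst y - {}"
    show "\<exists>w'. interch m k w w' \<and> length w' \<le> N \<and> set w' \<subseteq> set w"
    proof (rule N[of _ "fst (hd w)"], rule ballI)
      fix x assume x: "x \<in> set w"
      then have "hd w \<in> set w" by (cases w) auto
      then have "fst x - {} = fst (hd w) - {}" using w(2) x by blast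
      then show "fst x = fst (hd w) \<and> snd x < Suc k" using w(1) x by (simp add: less_Suc_eq_le)
    qed
  qed
next
  case (insert j A)
  then obtain N where N: "\<And>w. (\<forall>x\<in>set w. snd x \<le> k) \<Longrightarrow>
     (\<forall>x\<in>set w. \<forall>y\<in>set w. fst x - A = fst y - A) \<Longrightarrow>
     (\<forall>j\<in>A. itrace j w) \<Longrightarrow> (\<exists>w'. interch m k w w' \<and> length w' \<le> N \<and> set w' \<subseteq> set w)" by blast
  show ?case
  proof (intro exI[of _ "3 * N"] allI impI)
    fix w :: "letter list"
    assume w: "\<forall>x\<in>set w. snd x \<le> k" "\<forall>x\<in>set w. \<forall>y\<in>set w. fst x - insert j A = fst y - insert j A"
      "\<forall>j\<in>insert j A. itrace j w"
    obtain u1 u2 u3 where u: "w = u1 @ u2 @ u3" "\<forall>x\<in>set u1. j \<notin> fst x" "\<forall>x\<in>set u2. j \<in> fst x"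
        "\<forall>x\<in>set u3. j \<notin> fst x"
      using itrace_split w(3) by blast
    have eq: "fst x - A = fst y - A"
      if "x \<in> set w" "y \<in> set w" "j \<in> fst x \<longleftrightarrow> j \<in> fst y" for x y
    proof -
      have "fst x - insert j A = fst y - insert j A" using w(2) that by blast
      then show ?thesis using that(3) by blast
    qed
    have it: "itrace i u1" "itrace i u2" "itrace i u3" if "i \<in> A" for i
      using w(3) that u(1) itrace_append by (metis insertI2)+
    obtain v1 where v1: "interch m k u1 v1" "length v1 \<le> N" "set v1 \<subseteq> set u1"
      using N[of u1] w(1) u eq it by auto
    obtain v2 where v2: "interch m k u2 v2" "length v2 \<le> N" "set v2 \<subseteq> set u2"
      using N[of u2] w(1) u eq it by auto
    obtain v3 where v3: "interch m k u3 v3" "length v3 \<le> N" "set v3 \<subseteq> set u3"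
      using N[of u3] w(1) u eq it by auto
    have "interch m k (u1 @ u2 @ u3) (v1 @ v2 @ v3)"
      by (intro interch_append v1 v2 v3)
    then show "\<exists>w'. interch m k w w' \<and> length w' \<le> 3 * N \<and> set w' \<subseteq> set w"
      using u v1 v2 v3 by (intro exI[of _ "v1 @ v2 @ v3"]) auto
  qed
qed

text \<open>Every admissible word is interchangeable with a word of length at most \<open>N\<close>,
  so a nice language is determined by its trace on the finite set \<open>?W\<close>.\<close>

theorem finite_nice: "finite {M. nice m k M}"
proof -
  obtain N where N: "\<And>w. (\<forall>x\<in>set w. snd x \<le> k) \<Longrightarrow>
     (\<forall>x\<in>set w. \<forall>y\<in>set w. fst x - {..<m} = fst y - {..<m}) \<Longrightarrow>
     (\<forall>j\<in>{..<m}. itrace j w) \<Longrightarrow> (\<exists>w'. interch m k w w' \<and> length w' \<le> N \<and> set w' \<subseteq> set w)"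
    using interch_bounded[of "{..<m}" k m] by auto
  let ?W = "Pow {..<m} \<times> {w. set w \<subseteq> Pow {..<m} \<times> {..k} \<and> length w \<le> N}"
  have fin: "finite ?W" by (intro finite_SigmaI finite_lists_length_le) auto
  have sub: "M1 \<subseteq> M2" if M: "nice m k M1" "nice m k M2" and eq: "M1 \<inter> ?W = M2 \<inter> ?W" for M1 M2
  proof
    fix z assume z: "z \<in> M1"
    obtain J w where zw: "z = (J, w)" by (cases z)
    have J: "J \<subseteq> {..<m}" and w: "adm m k w" using M(1) z zw unfolding nice_def by auto
    have sw: "\<forall>x\<in>set w. fst x - {..<m} = {}" "\<forall>x\<in>set w. snd x \<le> k"
      using w unfolding adm_def by fastforce+
    obtain w' where w': "interch m k w w'" "length w' \<le> N" "set w' \<subseteq> set w"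
      using N[of w] w sw by (auto simp: adm_def)
    have ch: "(J, w) \<in> M \<longleftrightarrow> (J, w') \<in> M" if "nice m k M" for M
      using w'(1)[unfolded interch_def, rule_format, OF that, of J "[]" "[]"] by simp
    have "(J, w') \<in> ?W" using w' w J by (auto simp: adm_def)
    moreover have "(J, w') \<in> M1" using ch[OF M(1)] z zw by simp
    ultimately have "(J, w') \<in> M2" using eq by blast
    then show "z \<in> M2" using ch[OF M(2)] zw by simp
  qed
  have "inj_on (\<lambda>M. M \<inter> ?W) {M. nice m k M}"
  proof (rule inj_onI)
    fix M1 M2 assume "M1 \<in> {M. nice m k M}" "M2 \<in> {M. nice m k M}" "M1 \<inter> ?W = M2 \<inter> ?W"
    then show "M1 = M2" using sub[of M1 M2] sub[of M2 M1] by (simp only: mem_Collect_eq subset_antisym)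
  qed
  moreover have "(\<lambda>M. M \<inter> ?W) ` {M. nice m k M} \<subseteq> Pow ?W" by blast
  then have "finite ((\<lambda>M. M \<inter> ?W) ` {M. nice m k M})"
    using fin by (meson finite_Pow_iff finite_subset)
  ultimately show ?thesis by (rule finite_imageD[rotated])
qed


section \<open>Realisations of pieces\<close>

text \<open>
  A piece is a vertex set \<open>C\<close> together with the adjacency \<open>a j v\<close> of its vertices to boundary slots \<open>j\<close>.
  The vertex \<open>v\<close> lives in the bags \<open>s v, \<dots>, e v - 1\<close>; a letter \<open>(\<tau>, c)\<close> describes a bag that contains
  the slots in \<open>\<tau>\<close> and has room for \<open>c\<close> vertices of the piece.  Connectivity of prefixes is local:
  every vertex has a neighbour that appears strictly earlier.  \<open>J\<close> collects the slots that find such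
  a neighbour inside the piece.
\<close>

definition realz ::
    "('v \<Rightarrow> 'v \<Rightarrow> bool) \<Rightarrow> 'v set \<Rightarrow> (nat \<Rightarrow> 'v \<Rightarrow> bool) \<Rightarrow> nat set \<Rightarrow> letter list \<Rightarrow>
     ('v \<Rightarrow> nat) \<Rightarrow> ('v \<Rightarrow> nat) \<Rightarrow> bool" where
  "realz adj C a J w s e \<longleftrightarrow>
     (\<forall>v\<in>C. s v < e v \<and> e v \<le> length w) \<and>
     (\<forall>i<length w. card {v\<in>C. s v \<le> i \<and> i < e v} \<le> snd (w ! i)) \<and>
     (\<forall>u\<in>C. \<forall>v\<in>C. adj u v \<longrightarrow> s u < e v) \<and>
     (\<forall>v\<in>C. \<forall>j. a j v \<longrightarrow> (\<exists>i. s v \<le> i \<and> i < e v \<and> j \<in> fst (w ! i))) \<and>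
     (\<forall>v\<in>C. (\<exists>u\<in>C. adj u v \<and> s u < s v) \<or> (\<exists>j i. a j v \<and> i < s v \<and> j \<in> fst (w ! i))) \<and>
     (\<forall>j\<in>J. \<exists>u\<in>C. a j u \<and> (\<forall>i\<le>s u. j \<notin> fst (w ! i)))"

text \<open>The existential stretching lets a word describe realisations that need more bags than it
  has letters; one direction of the closure under stretching then holds by construction.\<close>

definition lang ::
    "('v \<Rightarrow> 'v \<Rightarrow> bool) \<Rightarrow> 'v set \<Rightarrow> (nat \<Rightarrow> 'v \<Rightarrow> bool) \<Rightarrow> nat \<Rightarrow> nat \<Rightarrow> (nat set \<times> letter list) set" where
  "lang adj C a m k = {(J, w). J \<subseteq> {..<m} \<and> adm m k w \<and> (\<exists>u s e. stretch w u \<and> realz adj C a J u s e)}"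

text \<open>An endpoint \<open>t\<close> is pulled back to the number \<open>\<phi> t\<close> of
  positions mapped below it. Since \<open>\<phi> t <= i\<close> iff \<open>t <= f i\<close>, the new
  interval of a vertex is exactly the preimage of the old one.\<close>

lemma realz_stretches:
  assumes r: "realz adj C a J w s e" and f: "stretches w w' f"
  shows "\<exists>s' e'. realz adj C a J w' s' e'"
proof -
  let ?n = "length w'" and ?l = "length w"
  define \<phi> where "\<phi> t = card {i. i < ?n \<and> f i < t}" for t
  have gal: "\<phi> t \<le> i \<longleftrightarrow> t \<le> f i" if "i < ?n" for t i
  proof
    assume "t \<le> f i"
    then have "{i'. i' < ?n \<and> f i' < t} \<subseteq> {..<i}"
      using stretches_mono[OF f, of i] by (auto simp: not_le[symmetric]) (meson le_trans)
    then have "card {i'. i' < ?n \<and> f i' < t} \<le> card {..<i}" by (intro card_mono) auto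
    then show "\<phi> t \<le> i" by (simp add: \<phi>_def)
  next
    assume le: "\<phi> t \<le> i"
    show "t \<le> f i"
    proof (rule ccontr)
      assume "\<not> t \<le> f i"
      then have "{..i} \<subseteq> {i'. i' < ?n \<and> f i' < t}"
        using stretches_mono[OF f _ that] that by (auto) (meson le_less_trans not_le)
      then have "card {..i} \<le> card {i'. i' < ?n \<and> f i' < t}" by (intro card_mono) auto
      then show False using le by (simp add: \<phi>_def)
    qed
  qed
  have gal': "i < \<phi> t \<longleftrightarrow> f i < t" if "i < ?n" for t i
    using gal[OF that, of t] by (simp add: not_le[symmetric])
  have le_n: "\<phi> t \<le> ?n" for t
  proof -
    have "card {i. i < ?n \<and> f i < t} \<le> card {..<?n}" by (intro card_mono) auto
    then show ?thesis by (simp add: \<phi>_def)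
  qed
  have mono: "\<phi> t < \<phi> t'" if "t < t'" "t < ?l" for t t'
  proof -
    obtain i where i: "i < ?n" "f i = t" using stretches_surj[OF f \<open>t < ?l\<close>] by blast
    then show ?thesis using gal[OF i(1), of t] gal'[OF i(1), of t'] that by auto
  qed
  have inC: "s v < e v" "e v \<le> ?l" "s v < ?l" if "v \<in> C" for v
    using r that unfolding realz_def by force+
  have "realz adj C a J w' (\<phi> \<circ> s) (\<phi> \<circ> e)"
    unfolding realz_def
  proof (intro conjI ballI allI impI)
    fix v assume v: "v \<in> C"
    show "(\<phi> \<circ> s) v < (\<phi> \<circ> e) v" "(\<phi> \<circ> e) v \<le> ?n" using mono inC[OF v] le_n by auto
  next
    fix i assume i: "i < ?n"
    have "{v\<in>C. (\<phi> \<circ> s) v \<le> i \<and> i < (\<phi> \<circ> e) v} = {v\<in>C. s v \<le> f i \<and> f i < e v}"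
      using gal[OF i] gal'[OF i] by auto
    moreover have "f i < ?l" by (rule stretches_less[OF f i])
    ultimately show "card {v\<in>C. (\<phi> \<circ> s) v \<le> i \<and> i < (\<phi> \<circ> e) v} \<le> snd (w' ! i)"
      using r stretches_nth[OF f i] unfolding realz_def by simp
  next
    fix u v assume "u \<in> C" "v \<in> C" "adj u v"
    then show "(\<phi> \<circ> s) u < (\<phi> \<circ> e) v" using mono inC r unfolding realz_def by simp
  next
    fix v j assume v: "v \<in> C" "a j v"
    then obtain i where i: "s v \<le> i" "i < e v" "j \<in> fst (w ! i)" using r unfolding realz_def by blast
    obtain i' where i': "i' < ?n" "f i' = i" using stretches_surj[OF f, of i] inC[OF v(1)] i by auto
    show "\<exists>i. (\<phi> \<circ> s) v \<le> i \<and> i < (\<phi> \<circ> e) v \<and> j \<in> fst (w' ! i)"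
      using i i' gal[OF i'(1)] gal'[OF i'(1)] stretches_nth[OF f i'(1)] by (intro exI[of _ i']) auto
  next
    fix v assume v: "v \<in> C"
    consider u where "u \<in> C" "adj u v" "s u < s v" | j i where "a j v" "i < s v" "j \<in> fst (w ! i)"
      using r v unfolding realz_def by blast
    then show "(\<exists>u\<in>C. adj u v \<and> (\<phi> \<circ> s) u < (\<phi> \<circ> s) v) \<or> (\<exists>j i. a j v \<and> i < (\<phi> \<circ> s) v \<and> j \<in> fst (w' ! i))"
    proof cases
      case 1
      then show ?thesis using mono inC by auto
    next
      case (2 j i)
      obtain i' where i': "i' < ?n" "f i' = i" using stretches_surj[OF f, of i] inC[OF v] 2 by auto
      then show ?thesis using 2 gal'[OF i'(1)] stretches_nth[OF f i'(1)] by fastforce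
    qed
  next
    fix j assume "j \<in> J"
    then obtain u where u: "u \<in> C" "a j u" "\<forall>i\<le>s u. j \<notin> fst (w ! i)" using r unfolding realz_def by blast
    obtain i0 where i0: "i0 < ?n" "f i0 = s u" using stretches_surj[OF f, of "s u"] inC[OF u(1)] by auto
    have "j \<notin> fst (w' ! i)" if "i \<le> \<phi> (s u)" for i
    proof -
      have "\<phi> (s u) \<le> i0" using gal[OF i0(1)] i0(2) by simp
      then have "i \<le> i0" using that by simp
      then have "f i \<le> s u" "i < ?n" using stretches_mono[OF f, of i i0] i0 by auto
      then show ?thesis using u(3) stretches_nth[OF f] by simp
    qed
    then show "\<exists>u\<in>C. a j u \<and> (\<forall>i\<le>(\<phi> \<circ> s) u. j \<notin> fst (w' ! i))" using u by auto
  qed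
  then show ?thesis by blast
qed

lemma realz_above:
  assumes r: "realz adj C a J w s e" and "length w' = length w"
    and "\<And>i. i < length w \<Longrightarrow> fst (w' ! i) = fst (w ! i) \<and> snd (w ! i) \<le> snd (w' ! i)"
  shows "realz adj C a J w' s e"
proof -
  have inC: "s v < e v" "e v \<le> length w" if "v \<in> C" for v
    using r that unfolding realz_def by blast+
  have fs: "fst (w' ! i) = fst (w ! i)" if "v \<in> C" "i < e v" for v i
    using assms(3)[of i] inC(2)[OF that(1)] that(2) by simp
  show ?thesis
    unfolding realz_def
  proof (intro conjI ballI allI impI)
    fix v assume "v \<in> C" then show "s v < e v" "e v \<le> length w'" using inC assms(2) by auto
  next
    fix i assume i: "i < length w'"
    then have "card {v\<in>C. s v \<le> i \<and> i < e v} \<le> snd (w ! i)" using r assms(2) unfolding realz_def by simp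
    then show "card {v\<in>C. s v \<le> i \<and> i < e v} \<le> snd (w' ! i)" using assms(2) assms(3)[of i] i by simp
  next
    fix u v assume "u \<in> C" "v \<in> C" "adj u v" then show "s u < e v" using r unfolding realz_def by blast
  next
    fix v j assume v: "v \<in> C" "a j v"
    then obtain i where "s v \<le> i" "i < e v" "j \<in> fst (w ! i)" using r unfolding realz_def by blast
    then show "\<exists>i. s v \<le> i \<and> i < e v \<and> j \<in> fst (w' ! i)" using fs[OF v(1)] by auto
  next
    fix v assume v: "v \<in> C"
    consider u where "u \<in> C" "adj u v" "s u < s v" | j i where "a j v" "i < s v" "j \<in> fst (w ! i)"
      using r v unfolding realz_def by blast
    then show "(\<exists>u\<in>C. adj u v \<and> s u < s v) \<or> (\<exists>j i. a j v \<and> i < s v \<and> j \<in> fst (w' ! i))"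
    proof cases
      case 1 then show ?thesis by blast
    next
      case (2 j i)
      then have "fst (w' ! i) = fst (w ! i)" using fs[OF v] inC(1)[OF v] by simp
      then show ?thesis using 2 by auto
    qed
  next
    fix j assume "j \<in> J"
    then obtain u where u: "u \<in> C" "a j u" "\<forall>i\<le>s u. j \<notin> fst (w ! i)" using r unfolding realz_def by blast
    then have "\<forall>i\<le>s u. j \<notin> fst (w' ! i)" using fs[OF u(1)] inC(1)[OF u(1)] by simp
    then show "\<exists>u\<in>C. a j u \<and> (\<forall>i\<le>s u. j \<notin> fst (w' ! i))" using u by auto
  qed
qed

lemma nice_lang: "nice m k (lang adj C a m k)"
  unfolding nice_def
proof (intro conjI allI impI)
  fix J w assume "(J, w) \<in> lang adj C a m k"
  then show "J \<subseteq> {..<m}" "adm m k w" by (auto simp: lang_def)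
next
  fix J w w'
  assume w: "(J, w) \<in> lang adj C a m k" and ab: "above w w'" and caps: "snd ` set w' \<subseteq> {..k}"
  obtain u s e where u: "stretch w u" "realz adj C a J u s e" using w by (auto simp: lang_def)
  then obtain f where f: "stretches w u f" by (auto simp: stretch_def)
  let ?v = "map (\<lambda>i. w' ! f i) [0..<length u]"
  have len: "length w' = length w" using ab by (simp add: above_nth)
  have "stretch w' ?v" using stretches_remap[OF f len] by (auto simp: stretch_def)
  moreover have "realz adj C a J ?v s e"
    by (rule realz_above[OF u(2)])
       (use ab stretches_nth[OF f] stretches_less[OF f] in \<open>auto simp: above_nth\<close>)
  ultimately show "(J, w') \<in> lang adj C a m k"
    using w adm_above[OF ab _ caps] unfolding lang_def by blast
next
  fix J and w w' :: "letter list" assume st: "stretch w w'"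
  show "(J, w) \<in> lang adj C a m k \<longleftrightarrow> (J, w') \<in> lang adj C a m k"
  proof
    assume w: "(J, w) \<in> lang adj C a m k"
    then obtain u s e where u: "stretch w u" "realz adj C a J u s e" by (auto simp: lang_def)
    \<comment> \<open>Both \<open>u\<close> and \<open>w'\<close> refine \<open>w\<close>; once the
      realisation on \<open>u\<close> is carried over to a common refinement, it serves
      \<open>w'\<close>.\<close>
    obtain z where z: "stretch u z" "stretch w' z" using stretch_common[OF u(1) st] by blast
    obtain f where "stretches u z f" using z(1) by (auto simp: stretch_def)
    from realz_stretches[OF u(2) this] show "(J, w') \<in> lang adj C a m k"
      using z(2) w adm_stretch[OF st] unfolding lang_def by blast
  next
    assume w: "(J, w') \<in> lang adj C a m k"
    then show "(J, w) \<in> lang adj C a m k"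
      using stretch_trans[OF st] adm_stretch[OF st] unfolding lang_def by blast
  qed
qed

text \<open>An empty piece cannot serve a slot, so \<open>J\<close> is empty. The right side
  mentions neither \<open>adj\<close> nor \<open>a\<close>, which allows \<open>empty_code\<close>
  to be defined with dummies.\<close>

lemma lang_empty: "lang adj {} a m k = {({}, w) | w. adm m k w}"
  unfolding lang_def realz_def using stretch_refl by fastforce


section \<open>Composing pieces\<close>

text \<open>An inclusion for \<open>J\<close>, because the \<open>J\<close> of a realisation is a
  lower bound: smaller sets are realised as well.\<close>

definition mergec :: "nat set \<Rightarrow> nat set \<Rightarrow> nat set \<Rightarrow> letter list \<Rightarrow> letter list \<Rightarrow> letter list \<Rightarrow> bool" where
  "mergec J J1 J2 w w1 w2 \<longleftrightarrow>
     J \<subseteq> J1 \<union> J2 \<and> length w1 = length w \<and> length w2 = length w \<and>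
     (\<forall>i<length w. fst (w1 ! i) = fst (w ! i) \<and> fst (w2 ! i) = fst (w ! i) \<and>
        snd (w1 ! i) + snd (w2 ! i) \<le> snd (w ! i))"

definition mergeop :: "nat \<Rightarrow> nat \<Rightarrow> (nat set \<times> letter list) set \<Rightarrow> (nat set \<times> letter list) set \<Rightarrow>
    (nat set \<times> letter list) set" where
  "mergeop m k M1 M2 = {(J, w). J \<subseteq> {..<m} \<and> adm m k w \<and>
     (\<exists>u J1 w1 J2 w2. stretch w u \<and> (J1, w1) \<in> M1 \<and> (J2, w2) \<in> M2 \<and> mergec J J1 J2 u w1 w2)}"

lemma realz_merge:
  assumes r1: "realz adj C1 a J1 w1 s1 e1" and r2: "realz adj C2 a J2 w2 s2 e2"
    and c: "mergec J J1 J2 w w1 w2"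
    and C: "finite C1" "finite C2" "C1 \<inter> C2 = {}" "\<And>u v. u \<in> C1 \<Longrightarrow> v \<in> C2 \<Longrightarrow> \<not> adj u v \<and> \<not> adj v u"
  shows "\<exists>s e. realz adj (C1 \<union> C2) a J w s e"
proof -
  have len: "length w1 = length w" "length w2 = length w" using c by (auto simp: mergec_def)
  let ?c = "\<lambda>i w1. (fst (w ! i), snd (w1 ! i))"
  let ?u1 = "map (\<lambda>i. ?c i w1) [0..<length w]" and ?u2 = "map (\<lambda>i. ?c i w2) [0..<length w]"
  have r1: "realz adj C1 a J1 ?u1 s1 e1"
    by (rule realz_above[OF r1]) (use c in \<open>auto simp: mergec_def\<close>)
  have r2: "realz adj C2 a J2 ?u2 s2 e2"
    by (rule realz_above[OF r2]) (use c in \<open>auto simp: mergec_def\<close>)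
  define s where "s v = (if v \<in> C1 then s1 v else s2 v)" for v
  define e where "e v = (if v \<in> C1 then e1 v else e2 v)" for v
  have se1: "s v = s1 v" "e v = e1 v" if "v \<in> C1" for v using that by (auto simp: s_def e_def)
  have se2: "s v = s2 v" "e v = e2 v" if "v \<in> C2" for v using that C by (auto simp: s_def e_def)
  have b1: "s1 v < e1 v" "e1 v \<le> length w" if "v \<in> C1" for v using r1 that unfolding realz_def by auto
  have b2: "s2 v < e2 v" "e2 v \<le> length w" if "v \<in> C2" for v using r2 that unfolding realz_def by auto
  have "realz adj (C1 \<union> C2) a J w s e"
    unfolding realz_def
  proof (intro conjI ballI allI impI)
    fix v assume "v \<in> C1 \<union> C2"
    then show "s v < e v" "e v \<le> length w" using b1 b2 se1 se2 by auto
  next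
    fix i assume i: "i < length w"
    have "{v \<in> C1 \<union> C2. s v \<le> i \<and> i < e v} = {v \<in> C1. s1 v \<le> i \<and> i < e1 v} \<union> {v \<in> C2. s2 v \<le> i \<and> i < e2 v}"
      using se1 se2 by auto
    then have "card {v \<in> C1 \<union> C2. s v \<le> i \<and> i < e v} \<le>
        card {v \<in> C1. s1 v \<le> i \<and> i < e1 v} + card {v \<in> C2. s2 v \<le> i \<and> i < e2 v}"
      by (simp add: card_Un_le)
    also have "\<dots> \<le> snd (w1 ! i) + snd (w2 ! i)"
      using r1 r2 i unfolding realz_def by (intro add_mono) auto
    also have "\<dots> \<le> snd (w ! i)" using c i by (auto simp: mergec_def)
    finally show "card {v \<in> C1 \<union> C2. s v \<le> i \<and> i < e v} \<le> snd (w ! i)" .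
  next
    fix u v assume uv: "u \<in> C1 \<union> C2" "v \<in> C1 \<union> C2" "adj u v"
    then consider "u \<in> C1" "v \<in> C1" | "u \<in> C2" "v \<in> C2" using C(4) by blast
    then show "s u < e v" using r1 r2 uv(3) unfolding realz_def by cases (auto simp: se1 se2)
  next
    fix v j assume v: "v \<in> C1 \<union> C2" "a j v"
    from v(1) show "\<exists>i. s v \<le> i \<and> i < e v \<and> j \<in> fst (w ! i)"
    proof
      assume vC: "v \<in> C1"
      then obtain i where i: "s1 v \<le> i" "i < e1 v" "j \<in> fst (?u1 ! i)" using r1 v(2) unfolding realz_def by blast
      then have "j \<in> fst (w ! i)" using b1[OF vC] by simp
      then show ?thesis using i se1[OF vC] by auto
    next
      assume vC: "v \<in> C2"
      then obtain i where i: "s2 v \<le> i" "i < e2 v" "j \<in> fst (?u2 ! i)" using r2 v(2) unfolding realz_def by blast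
      then have "j \<in> fst (w ! i)" using b2[OF vC] by simp
      then show ?thesis using i se2[OF vC] by auto
    qed
  next
    fix v assume "v \<in> C1 \<union> C2"
    then show "(\<exists>u\<in>C1 \<union> C2. adj u v \<and> s u < s v) \<or> (\<exists>j i. a j v \<and> i < s v \<and> j \<in> fst (w ! i))"
    proof
      assume vC: "v \<in> C1"
      consider u where "u \<in> C1" "adj u v" "s1 u < s1 v" | j i where "a j v" "i < s1 v" "j \<in> fst (?u1 ! i)"
        using r1 vC unfolding realz_def by blast
      then show ?thesis
      proof cases
        case 1 then show ?thesis using se1 vC by auto
      next
        case (2 j i)
        then have "j \<in> fst (w ! i)" using b1[OF vC] by simp
        then show ?thesis using 2 se1[OF vC] by auto
      qed
    next
      assume vC: "v \<in> C2"
      consider u where "u \<in> C2" "adj u v" "s2 u < s2 v" | j i where "a j v" "i < s2 v" "j \<in> fst (?u2 ! i)"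
        using r2 vC unfolding realz_def by blast
      then show ?thesis
      proof cases
        case 1 then show ?thesis using se2 vC by auto
      next
        case (2 j i)
        then have "j \<in> fst (w ! i)" using b2[OF vC] by simp
        then show ?thesis using 2 se2[OF vC] by auto
      qed
    qed
  next
    fix j assume "j \<in> J"
    then have "j \<in> J1 \<union> J2" using c by (auto simp: mergec_def)
    then show "\<exists>u\<in>C1 \<union> C2. a j u \<and> (\<forall>i\<le>s u. j \<notin> fst (w ! i))"
    proof
      assume "j \<in> J1"
      then obtain u where u: "u \<in> C1" "a j u" "\<forall>i\<le>s1 u. j \<notin> fst (?u1 ! i)" using r1 unfolding realz_def by blast
      then have "\<forall>i\<le>s1 u. j \<notin> fst (w ! i)" using b1[OF u(1)] by auto
      then show ?thesis using u se1[OF u(1)] by (intro bexI[of _ u]) auto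
    next
      assume "j \<in> J2"
      then obtain u where u: "u \<in> C2" "a j u" "\<forall>i\<le>s2 u. j \<notin> fst (?u2 ! i)" using r2 unfolding realz_def by blast
      then have "\<forall>i\<le>s2 u. j \<notin> fst (w ! i)" using b2[OF u(1)] by auto
      then show ?thesis using u se2[OF u(1)] by (intro bexI[of _ u]) auto
    qed
  qed
  then show ?thesis by blast
qed

text \<open>The capacities are cut down to what \<open>C1\<close> really occupies, so that the
  demands of two disjoint parts add up to at most the capacity of the whole.\<close>

lemma realz_restrict:
  assumes r: "realz adj C a J w s e" and C: "C = C1 \<union> C2" "\<And>u v. u \<in> C1 \<Longrightarrow> v \<in> C2 \<Longrightarrow> \<not> adj u v \<and> \<not> adj v u"
  shows "realz adj C1 a {j\<in>J. \<exists>u\<in>C1. a j u \<and> (\<forall>i\<le>s u. j \<notin> fst (w ! i))}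
    (map (\<lambda>i. (fst (w ! i), card {v\<in>C1. s v \<le> i \<and> i < e v})) [0..<length w]) s e"
proof -
  have b: "s v < e v" "e v \<le> length w" if "v \<in> C1" for v using r that C(1) unfolding realz_def by auto
  show ?thesis
    unfolding realz_def
  proof (intro conjI ballI allI impI)
    fix v assume "v \<in> C1"
    then show "s v < e v" "e v \<le> length (map (\<lambda>i. (fst (w ! i), card {v\<in>C1. s v \<le> i \<and> i < e v})) [0..<length w])"
      using b by auto
  next
    fix u v assume "u \<in> C1" "v \<in> C1" "adj u v" then show "s u < e v" using r C(1) unfolding realz_def by blast
  next
    fix v j assume v: "v \<in> C1" "a j v"
    then obtain i where "s v \<le> i" "i < e v" "j \<in> fst (w ! i)" using r C(1) unfolding realz_def by blast
    then show "\<exists>i. s v \<le> i \<and> i < e v \<and>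
        j \<in> fst (map (\<lambda>i. (fst (w ! i), card {v\<in>C1. s v \<le> i \<and> i < e v})) [0..<length w] ! i)"
      using b[OF v(1)] by (intro exI[of _ i]) auto
  next
    fix v assume v: "v \<in> C1"
    consider u where "u \<in> C1" "adj u v" "s u < s v" | j i where "a j v" "i < s v" "j \<in> fst (w ! i)"
      using r v C unfolding realz_def by blast
    then show "(\<exists>u\<in>C1. adj u v \<and> s u < s v) \<or> (\<exists>j i. a j v \<and> i < s v \<and>
        j \<in> fst (map (\<lambda>i. (fst (w ! i), card {v\<in>C1. s v \<le> i \<and> i < e v})) [0..<length w] ! i))"
    proof cases
      case 1 then show ?thesis by blast
    next
      case (2 j i)
      then show ?thesis using b[OF v] by (intro disjI2 exI[of _ j] exI[of _ i]) auto
    qed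
  next
    fix j assume "j \<in> {j\<in>J. \<exists>u\<in>C1. a j u \<and> (\<forall>i\<le>s u. j \<notin> fst (w ! i))}"
    then obtain u where u: "u \<in> C1" "a j u" "\<forall>i\<le>s u. j \<notin> fst (w ! i)" by blast
    then show "\<exists>u\<in>C1. a j u \<and> (\<forall>i\<le>s u.
        j \<notin> fst (map (\<lambda>i. (fst (w ! i), card {v\<in>C1. s v \<le> i \<and> i < e v})) [0..<length w] ! i))"
      using b[OF u(1)] by (intro bexI[of _ u]) auto
  qed auto
qed

lemma adm_remap:
  assumes "adm m k w" "length w' = length w" "\<And>i. i < length w \<Longrightarrow> fst (w' ! i) = fst (w ! i) \<and> snd (w' ! i) \<le> k"
  shows "adm m k w'"
proof -
  have "itrace j w'" for j
  proof -
    have "itrace j w" using assms(1) by (simp add: adm_def)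
    then show ?thesis unfolding itrace_def using assms(2,3) by simp
  qed
  moreover have "x \<in> Pow {..<m} \<times> {..k}" if x: "x \<in> set w'" for x
  proof -
    obtain i where i: "i < length w" "x = w' ! i" using x assms(2) by (auto simp: in_set_conv_nth)
    have "w ! i \<in> Pow {..<m} \<times> {..k}" using assms(1) i unfolding adm_def by (meson nth_mem subsetD)
    then show ?thesis using assms(3)[OF i(1)] i(2) by (simp add: mem_Times_iff)
  qed
  ultimately show ?thesis unfolding adm_def by blast
qed

lemma adm_caps: "adm m k w \<Longrightarrow> i < length w \<Longrightarrow> snd (w ! i) \<le> k"
  unfolding adm_def by (metis atMost_iff mem_Times_iff nth_mem subsetD)

text \<open>Without edges between the parts, an earlier neighbour of a vertex is a slot or lies in
  its own part. Splitting takes the exact occupancies as capacities. Joining first brings both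
  realisations to equal length by one index map, which is applied to \<open>u\<close> as
  well.\<close>

lemma lang_merge:
  assumes C: "finite C1" "finite C2" "C1 \<inter> C2 = {}" "\<And>u v. u \<in> C1 \<Longrightarrow> v \<in> C2 \<Longrightarrow> \<not> adj u v \<and> \<not> adj v u"
  shows "lang adj (C1 \<union> C2) a m k = mergeop m k (lang adj C1 a m k) (lang adj C2 a m k)"
proof (intro subset_antisym subsetI)
  fix z assume "z \<in> lang adj (C1 \<union> C2) a m k"
  then obtain J w u s e where z: "z = (J, w)" and J: "J \<subseteq> {..<m}" and w: "adm m k w"
    and u: "stretch w u" "realz adj (C1 \<union> C2) a J u s e" unfolding lang_def by blast
  have admu: "adm m k u" using adm_stretch[OF u(1)] w by simp
  let ?w = "\<lambda>D. map (\<lambda>i. (fst (u ! i), card {v\<in>D. s v \<le> i \<and> i < e v})) [0..<length u]"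
  let ?J = "\<lambda>D. {j\<in>J. \<exists>x\<in>D. a j x \<and> (\<forall>i\<le>s x. j \<notin> fst (u ! i))}"
  have cc: "card {v\<in>C1. s v \<le> i \<and> i < e v} + card {v\<in>C2. s v \<le> i \<and> i < e v} \<le> snd (u ! i)"
    if "i < length u" for i
  proof -
    have "card {v\<in>C1. s v \<le> i \<and> i < e v} + card {v\<in>C2. s v \<le> i \<and> i < e v} =
        card ({v\<in>C1. s v \<le> i \<and> i < e v} \<union> {v\<in>C2. s v \<le> i \<and> i < e v})"
      using C(1-3) by (intro card_Un_disjoint[symmetric]) auto
    also have "{v\<in>C1. s v \<le> i \<and> i < e v} \<union> {v\<in>C2. s v \<le> i \<and> i < e v} = {v\<in>C1\<union>C2. s v \<le> i \<and> i < e v}"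
      by blast
    finally show ?thesis using u(2) that unfolding realz_def by simp
  qed
  have adm: "adm m k (?w C1)" "adm m k (?w C2)"
    by (rule adm_remap[OF admu]; use cc adm_caps[OF admu] in fastforce)+
  have "realz adj C1 a (?J C1) (?w C1) s e"
    by (rule realz_restrict[OF u(2) refl]) (use C(4) in blast)
  then have 1: "(?J C1, ?w C1) \<in> lang adj C1 a m k"
    using J adm(1) stretch_refl unfolding lang_def by blast
  have "realz adj C2 a (?J C2) (?w C2) s e"
    by (rule realz_restrict[OF u(2) Un_commute]) (use C(4) in blast)
  then have 2: "(?J C2, ?w C2) \<in> lang adj C2 a m k"
    using J adm(2) stretch_refl unfolding lang_def by blast
  have "J \<subseteq> ?J C1 \<union> ?J C2" using u(2) unfolding realz_def by blast
  then have "mergec J (?J C1) (?J C2) u (?w C1) (?w C2)"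
    using cc unfolding mergec_def by simp
  then show "z \<in> mergeop m k (lang adj C1 a m k) (lang adj C2 a m k)"
    using z J w u(1) 1 2 unfolding mergeop_def by blast
next
  fix z assume "z \<in> mergeop m k (lang adj C1 a m k) (lang adj C2 a m k)"
  then obtain J w u J1 w1 J2 w2 where z: "z = (J, w)" and J: "J \<subseteq> {..<m}" and w: "adm m k w"
    and u: "stretch w u" and l1: "(J1, w1) \<in> lang adj C1 a m k" and l2: "(J2, w2) \<in> lang adj C2 a m k"
    and c: "mergec J J1 J2 u w1 w2" unfolding mergeop_def by blast
  obtain u1 s1 e1 where u1: "stretch w1 u1" "realz adj C1 a J1 u1 s1 e1" using l1 unfolding lang_def by blast
  obtain u2 s2 e2 where u2: "stretch w2 u2" "realz adj C2 a J2 u2 s2 e2" using l2 unfolding lang_def by blast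
  have len: "length w1 = length w2" "length u = length w1" using c by (auto simp: mergec_def)
  obtain f n where f: "\<And>w :: letter list. length w = length w1 \<Longrightarrow> stretches w (map (\<lambda>i. w ! f i) [0..<n]) f"
    and st: "stretch u1 (map (\<lambda>i. w1 ! f i) [0..<n])" "stretch u2 (map (\<lambda>i. w2 ! f i) [0..<n])"
    using stretches_common_shape[OF u1(1) u2(1) len(1)] by metis
  obtain s1' e1' where r1: "realz adj C1 a J1 (map (\<lambda>i. w1 ! f i) [0..<n]) s1' e1'"
    using realz_stretches[OF u1(2)] st(1) unfolding stretch_def by blast
  obtain s2' e2' where r2: "realz adj C2 a J2 (map (\<lambda>i. w2 ! f i) [0..<n]) s2' e2'"
    using realz_stretches[OF u2(2)] st(2) unfolding stretch_def by blast
  have less: "f i < length u" if "i < n" for i using stretches_less[OF f[OF len(2)], of i] that by simp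
  have "mergec J J1 J2 (map (\<lambda>i. u ! f i) [0..<n]) (map (\<lambda>i. w1 ! f i) [0..<n]) (map (\<lambda>i. w2 ! f i) [0..<n])"
    using c less unfolding mergec_def by auto
  from realz_merge[OF r1 r2 this C]
  obtain s e where "realz adj (C1 \<union> C2) a J (map (\<lambda>i. u ! f i) [0..<n]) s e" by blast
  moreover have "stretch w (map (\<lambda>i. u ! f i) [0..<n])"
    using stretch_trans[OF u] f[OF len(2)] unfolding stretch_def by blast
  ultimately show "z \<in> lang adj (C1 \<union> C2) a m k" using z J w unfolding lang_def by blast
qed


text \<open>
  \<open>stepc j N J J' w w'\<close>: if \<open>(J', w')\<close> describes a piece whose slot \<open>j\<close> holds the vertex \<open>x\<close>, and \<open>N\<close> are
  the other slots adjacent to \<open>x\<close>, then \<open>(J, w)\<close> describes the piece enlarged by \<open>x\<close>, whose slot \<open>j\<close> holds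
  an isolated vertex.
\<close>

definition stepc :: "nat \<Rightarrow> nat set \<Rightarrow> nat set \<Rightarrow> nat set \<Rightarrow> letter list \<Rightarrow> letter list \<Rightarrow> bool" where
  "stepc j N J J' w w' \<longleftrightarrow>
     length w' = length w \<and>
     (\<forall>i<length w. fst (w' ! i) - {j} = fst (w ! i) - {j} \<and>
        snd (w' ! i) + of_bool (j \<in> fst (w' ! i)) \<le> snd (w ! i)) \<and>
     (\<exists>i<length w. j \<in> fst (w' ! i)) \<and>
     (\<forall>l\<in>N. \<exists>i<length w. j \<in> fst (w' ! i) \<and> l \<in> fst (w' ! i)) \<and>
     (j \<in> J' \<or> (\<exists>l\<in>N. \<exists>i<length w. l \<in> fst (w' ! i) \<and> (\<forall>q\<le>i. j \<notin> fst (w' ! q)))) \<and>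
     j \<notin> J \<and>
     (\<forall>l\<in>J. l \<in> J' \<or> (l \<in> N \<and> (\<exists>i<length w. j \<in> fst (w' ! i) \<and> (\<forall>q\<le>i. l \<notin> fst (w' ! q)))))"

definition stepop :: "nat \<Rightarrow> nat set \<Rightarrow> nat \<Rightarrow> nat \<Rightarrow> (nat set \<times> letter list) set \<Rightarrow>
    (nat set \<times> letter list) set" where
  "stepop j N m k M = {(J, w). J \<subseteq> {..<m} \<and> adm m k w \<and>
     (\<exists>u J' u'. stretch w u \<and> (J', u') \<in> M \<and> stepc j N J J' u u')}"

text \<open>The existential clauses of \<open>stepc\<close> all have this shape, some with trivial
  \<open>Q\<close>. Any preimage of the old position works, since positions up to it are mapped to
  positions up to the old one.\<close>

lemma first_later:
  assumes f: "stretches w w' f" and "\<exists>i<length w. P (w ! i) \<and> (\<forall>q\<le>i. Q (w ! q))"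
  shows "\<exists>i<length w'. P (w' ! i) \<and> (\<forall>q\<le>i. Q (w' ! q))"
proof -
  obtain i where i: "i < length w" "P (w ! i)" "\<forall>q\<le>i. Q (w ! q)" using assms(2) by blast
  obtain i' where i': "i' < length w'" "f i' = i" using stretches_surj[OF f i(1)] by blast
  have "Q (w' ! q)" if "q \<le> i'" for q
    using i(3) stretches_mono[OF f that i'(1)] stretches_nth[OF f, of q] that i' by simp
  then show ?thesis using i i' stretches_nth[OF f i'(1)] by (intro exI[of _ i']) auto
qed

lemma stepc_stretches:
  assumes c: "stepc j N J J' w w'" and f: "stretches w' v' f" and v: "v = map (\<lambda>i. w ! f i) [0..<length v']"
  shows "stepc j N J J' v v'"
proof -
  have len: "length w' = length w" "length v = length v'" using c v by (auto simp: stepc_def)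
  have less: "f i < length w" if "i < length v'" for i using stretches_less[OF f that] len by simp
  have a: "\<forall>i<length v. fst (v' ! i) - {j} = fst (v ! i) - {j} \<and>
        snd (v' ! i) + of_bool (j \<in> fst (v' ! i)) \<le> snd (v ! i)"
    using c less stretches_nth[OF f] unfolding stepc_def v by simp
  have b: "\<exists>i<length v. P (v' ! i)" if "\<exists>i<length w. P (w' ! i)" for P
    using first_later[OF f, of P "\<lambda>_. True"] that len by simp
  have d: "\<exists>i<length v. P (v' ! i) \<and> (\<forall>q\<le>i. Q (v' ! q))"
    if "\<exists>i<length w. P (w' ! i) \<and> (\<forall>q\<le>i. Q (w' ! q))" for P Q
    using first_later[OF f, of P Q] that len by simp
  show ?thesis
    unfolding stepc_def
  proof (intro conjI a)
    show "length v' = length v" using len by simp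
    show "\<exists>i<length v. j \<in> fst (v' ! i)"
      by (rule b) (use c in \<open>simp add: stepc_def\<close>)
    show "\<forall>l\<in>N. \<exists>i<length v. j \<in> fst (v' ! i) \<and> l \<in> fst (v' ! i)"
      by (intro ballI b) (use c in \<open>simp add: stepc_def\<close>)
    show "j \<in> J' \<or> (\<exists>l\<in>N. \<exists>i<length v. l \<in> fst (v' ! i) \<and> (\<forall>q\<le>i. j \<notin> fst (v' ! q)))"
    proof (cases "j \<in> J'")
      case False
      then obtain l where l: "l \<in> N" "\<exists>i<length w. l \<in> fst (w' ! i) \<and> (\<forall>q\<le>i. j \<notin> fst (w' ! q))"
        using c unfolding stepc_def by blast
      then show ?thesis using d[of "\<lambda>x. l \<in> fst x" "\<lambda>x. j \<notin> fst x"] by blast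
    qed simp
    show "j \<notin> J" using c by (simp add: stepc_def)
    show "\<forall>l\<in>J. l \<in> J' \<or> (l \<in> N \<and> (\<exists>i<length v. j \<in> fst (v' ! i) \<and> (\<forall>q\<le>i. l \<notin> fst (v' ! q))))"
    proof
      fix l assume "l \<in> J"
      then show "l \<in> J' \<or> (l \<in> N \<and> (\<exists>i<length v. j \<in> fst (v' ! i) \<and> (\<forall>q\<le>i. l \<notin> fst (v' ! q))))"
        using c d[of "\<lambda>x. j \<in> fst x" "\<lambda>x. l \<notin> fst x"] unfolding stepc_def by blast
    qed
  qed
qed

lemma itrace_interval:
  assumes "itrace j w" "\<exists>i<length w. j \<in> fst (w ! i)"
  obtains p q where "p < q" "q \<le> length w" "\<And>i. i < length w \<Longrightarrow> j \<in> fst (w ! i) \<longleftrightarrow> p \<le> i \<and> i < q"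
proof -
  let ?S = "{i. i < length w \<and> j \<in> fst (w ! i)}"
  have S: "finite ?S" "?S \<noteq> {}" using assms(2) by auto
  have mx: "Max ?S \<in> ?S" and mn: "Min ?S \<in> ?S" using Max_in[OF S] Min_in[OF S] by auto
  have "j \<in> fst (w ! i) \<longleftrightarrow> Min ?S \<le> i \<and> i < Suc (Max ?S)" if i: "i < length w" for i
  proof
    assume "j \<in> fst (w ! i)"
    then have "i \<in> ?S" using i by simp
    then show "Min ?S \<le> i \<and> i < Suc (Max ?S)" using Min_le[OF S(1)] Max_ge[OF S(1)] by (simp add: less_Suc_eq_le)
  next
    assume "Min ?S \<le> i \<and> i < Suc (Max ?S)"
    then show "j \<in> fst (w ! i)"
      using assms(1)[unfolded itrace_def, rule_format, of "Min ?S" i "Max ?S"] mx mn by simp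
  qed
  moreover have "Min ?S < Suc (Max ?S)" using Min_le[OF S(1) mx] by (simp only: less_Suc_eq_le)
  moreover have "Suc (Max ?S) \<le> length w" using mx by (simp only: mem_Collect_eq Suc_le_eq)
  ultimately show ?thesis by (intro that[of "Min ?S" "Suc (Max ?S)"])
qed

text \<open>The trace of slot \<open>j\<close> in \<open>w'\<close> becomes the interval of
  \<open>x\<close>. The unit of capacity that \<open>stepc\<close> withholds where the slot is
  present pays for \<open>x\<close>, and the edges at \<open>x\<close> are what \<open>a'\<close>
  records as adjacency to slot \<open>j\<close>.\<close>

lemma realz_insert:
  assumes r: "realz adj (C - {x}) a' J' w' s e" and adm: "itrace j w'" and c: "stepc j N J J' w w'"
    and C: "finite C" "x \<in> C" and sym: "\<And>u v. adj u v \<Longrightarrow> adj v u"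
    and aj: "\<And>u. u \<in> C \<Longrightarrow> \<not> a j u"
    and a': "\<And>u i. u \<in> C - {x} \<Longrightarrow> a' i u = (if i = j then adj x u else a i u)"
    and N: "N = {l. a l x}"
  shows "\<exists>s e. realz adj C a J w s e"
proof -
  have len: "length w' = length w" using c by (simp add: stepc_def)
  have "\<exists>i<length w'. j \<in> fst (w' ! i)" using c by (simp add: stepc_def)
  then obtain p q where pq: "p < q" "q \<le> length w'" and jt: "\<And>i. i < length w' \<Longrightarrow> j \<in> fst (w' ! i) \<longleftrightarrow> p \<le> i \<and> i < q"
    using itrace_interval[OF adm] by metis
  have sl: "l \<in> fst (w ! i) \<longleftrightarrow> l \<in> fst (w' ! i)" if "l \<noteq> j" "i < length w" for l i
  proof -
    have "fst (w' ! i) - {j} = fst (w ! i) - {j}" using c that(2) by (simp add: stepc_def)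
    then show ?thesis using that(1) by blast
  qed
  have jp: "j \<in> fst (w' ! p)" using jt[of p] pq by simp
  let ?C = "C - {x}"
  define s' where "s' = s(x := p)"
  define e' where "e' = e(x := q)"
  have se: "s' v = s v" "e' v = e v" if "v \<in> ?C" for v using that by (auto simp: s'_def e'_def)
  have sx: "s' x = p" "e' x = q" by (auto simp: s'_def e'_def)
  have b: "s v < e v" "e v \<le> length w" if "v \<in> ?C" for v using r that len unfolding realz_def by auto
  have nj: "l \<noteq> j" if "a l u" "u \<in> C" for l u using aj that by blast
  have "realz adj C a J w s' e'"
    unfolding realz_def
  proof (intro conjI ballI allI impI)
    fix v assume "v \<in> C"
    then show "s' v < e' v" "e' v \<le> length w" using b[of v] se[of v] sx pq len by (cases "v = x"; auto)+
  next
    fix i assume i: "i < length w"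
    have "{v \<in> C. s' v \<le> i \<and> i < e' v} \<subseteq> {v \<in> ?C. s v \<le> i \<and> i < e v} \<union> (if p \<le> i \<and> i < q then {x} else {})"
      by (auto simp: s'_def e'_def split: if_splits)
    then have "card {v \<in> C. s' v \<le> i \<and> i < e' v} \<le>
        card ({v \<in> ?C. s v \<le> i \<and> i < e v} \<union> (if p \<le> i \<and> i < q then {x} else {}))"
      using C(1) by (intro card_mono) auto
    also have "\<dots> \<le> card {v \<in> ?C. s v \<le> i \<and> i < e v} + card (if p \<le> i \<and> i < q then {x} else {})"
      by (rule card_Un_le)
    also have "\<dots> \<le> snd (w' ! i) + of_bool (j \<in> fst (w' ! i))"
      using r i len jt[of i] unfolding realz_def by (intro add_mono) auto
    also have "\<dots> \<le> snd (w ! i)" using c i by (simp add: stepc_def)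
    finally show "card {v \<in> C. s' v \<le> i \<and> i < e' v} \<le> snd (w ! i)" .
  next
    have xv: "p < e v" "s v < q" if v: "v \<in> ?C" "adj x v" for v
    proof -
      have "a' j v" using a'[OF v(1), of j] v(2) by simp
      then obtain i where "s v \<le> i" "i < e v" "j \<in> fst (w' ! i)" using r v(1) unfolding realz_def by blast
      then show "p < e v" "s v < q" using jt[of i] b[OF v(1)] len by auto
    qed
    fix u v assume uv: "u \<in> C" "v \<in> C" "adj u v"
    consider "u = x" "v = x" | "u = x" "v \<in> ?C" | "u \<in> ?C" "v = x" | "u \<in> ?C" "v \<in> ?C" using uv by blast
    then show "s' u < e' v"
    proof cases
      case 4 then show ?thesis using r uv(3) se unfolding realz_def by simp
    qed (use xv uv(3) sym[OF uv(3)] se sx pq in auto)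
  next
    fix v l assume v: "v \<in> C" "a l v"
    show "\<exists>i. s' v \<le> i \<and> i < e' v \<and> l \<in> fst (w ! i)"
    proof (cases "v = x")
      case True
      then have "l \<in> N" using v N by simp
      then obtain i where "i < length w" "j \<in> fst (w' ! i)" "l \<in> fst (w' ! i)" using c unfolding stepc_def by blast
      then show ?thesis using jt[of i] sl[OF nj[OF v(2,1)]] True sx len by auto
    next
      case False
      then have vC: "v \<in> ?C" using v by simp
      have "a' l v" using a'[OF vC] v(2) nj[OF v(2,1)] by simp
      then obtain i where i: "s v \<le> i" "i < e v" "l \<in> fst (w' ! i)" using r vC unfolding realz_def by blast
      then show ?thesis using sl[OF nj[OF v(2,1)], of i] se[OF vC] b[OF vC] by (intro exI[of _ i]) auto
    qed
  next
    fix v assume v: "v \<in> C"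
    show "(\<exists>u\<in>C. adj u v \<and> s' u < s' v) \<or> (\<exists>j i. a j v \<and> i < s' v \<and> j \<in> fst (w ! i))"
    proof (cases "v = x")
      case True
      consider "j \<in> J'" | l i where "l \<in> N" "i < length w" "l \<in> fst (w' ! i)" "\<forall>q\<le>i. j \<notin> fst (w' ! q)"
        using c unfolding stepc_def by blast
      then show ?thesis
      proof cases
        case 1
        then obtain u where u: "u \<in> ?C" "a' j u" "\<forall>i\<le>s u. j \<notin> fst (w' ! i)" using r unfolding realz_def by blast
        have "adj u x" using sym a'[OF u(1)] u(2) by simp
        moreover have "s u < p" using u(3) jp by (meson leI)
        ultimately show ?thesis using True u(1) se sx by auto
      next
        case (2 l i)
        then have "a l x" using N by simp
        then have "l \<noteq> j" using nj C(2) by blast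
        have "i < p" using 2(4) jp by (meson leI)
        moreover have "l \<in> fst (w ! i)" using 2 sl[OF \<open>l \<noteq> j\<close>] by simp
        ultimately show ?thesis using True \<open>a l x\<close> sx by blast
      qed
    next
      case False
      then have vC: "v \<in> ?C" using v by simp
      consider u where "u \<in> ?C" "adj u v" "s u < s v" | l i where "a' l v" "i < s v" "l \<in> fst (w' ! i)"
        using r vC unfolding realz_def by blast
      then show ?thesis
      proof cases
        case 1 then show ?thesis using se vC by auto
      next
        case (2 l i)
        have il: "i < length w" using 2 b[OF vC] by simp
        show ?thesis
        proof (cases "l = j")
          case True
          then have "adj x v" "p \<le> i" using a'[OF vC] 2 jt[of i] il len by auto
          then show ?thesis using C(2) 2 se[OF vC] sx by auto
        next
          case False
          then have "a l v" using a'[OF vC] 2 by simp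
          then show ?thesis using 2 se[OF vC] sl[OF False il] by auto
        qed
      qed
    qed
  next
    fix l assume l: "l \<in> J"
    then have lj: "l \<noteq> j" using c by (auto simp: stepc_def)
    consider "l \<in> J'" | i where "l \<in> N" "i < length w" "j \<in> fst (w' ! i)" "\<forall>q\<le>i. l \<notin> fst (w' ! q)"
      using c l unfolding stepc_def by blast
    then show "\<exists>u\<in>C. a l u \<and> (\<forall>i\<le>s' u. l \<notin> fst (w ! i))"
    proof cases
      case 1
      then obtain u where u: "u \<in> ?C" "a' l u" "\<forall>i\<le>s u. l \<notin> fst (w' ! i)" using r unfolding realz_def by blast
      have "\<forall>i\<le>s u. l \<notin> fst (w ! i)" using u(3) sl[OF lj] b[OF u(1)] by simp
      moreover have "a l u" using a'[OF u(1)] u(2) lj by simp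
      ultimately show ?thesis using u(1) se[OF u(1)] by (intro bexI[of _ u]) auto
    next
      case (2 i)
      then have "p \<le> i" using jt[of i] len by simp
      then have "\<forall>q\<le>p. l \<notin> fst (w ! q)" using 2 sl[OF lj] by simp
      then show ?thesis using 2 N C(2) sx by (intro bexI[of _ x]) auto
    qed
  qed
  then show ?thesis by blast
qed

text \<open>Converse of \<open>realz_insert\<close>: slot \<open>j\<close> is made to follow the
  interval of \<open>x\<close>. Its previous trace may be erased because no vertex of
  \<open>C\<close> is adjacent to it. \<open>J'\<close> is chosen as large as possible.\<close>

lemma realz_remove:
  assumes r: "realz adj C a J u s e" and adm: "adm m k u" "j < m"
    and C: "finite C" "x \<in> C" and sym: "\<And>u v. adj u v \<Longrightarrow> adj v u"
    and irr: "\<And>u. \<not> adj u u"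
    and aj: "\<And>u. u \<in> C \<Longrightarrow> \<not> a j u"
    and a': "\<And>u i. u \<in> C - {x} \<Longrightarrow> a' i u = (if i = j then adj x u else a i u)"
    and N: "N = {l. a l x}" and J: "J \<subseteq> {..<m}"
  shows "\<exists>J' u'. (J', u') \<in> lang adj (C - {x}) a' m k \<and> stepc j N J J' u u'"
proof -
  let ?C = "C - {x}" and ?n = "length u"
  let ?in = "\<lambda>i. s x \<le> i \<and> i < e x"
  have b: "s v < e v" "e v \<le> ?n" if "v \<in> C" for v using r that unfolding realz_def by auto
  have nj: "l \<noteq> j" if "a l v" "v \<in> C" for l v using aj that by blast
  \<comment> \<open>The truncated subtraction is exact: wherever the interval of \<open>x\<close>
    runs, \<open>x\<close> itself occupies a unit of the capacity (see \<open>crd\<close>).\<close>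
  define u' where "u' = map (\<lambda>i. (fst (u ! i) - {j} \<union> (if ?in i then {j} else {}), snd (u ! i) - of_bool (?in i))) [0..<?n]"
  have len: "length u' = ?n" by (simp add: u'_def)
  have fu: "fst (u' ! i) = fst (u ! i) - {j} \<union> (if ?in i then {j} else {})" "snd (u' ! i) = snd (u ! i) - of_bool (?in i)"
    if "i < ?n" for i using that by (simp_all add: u'_def)
  have jt: "j \<in> fst (u' ! i) \<longleftrightarrow> ?in i" if "i < ?n" for i using fu(1)[OF that] by auto
  have sl: "l \<in> fst (u' ! i) \<longleftrightarrow> l \<in> fst (u ! i)" if "l \<noteq> j" "i < ?n" for l i using fu(1)[OF that(2)] that(1) by auto
  have crd: "card {v \<in> ?C. s v \<le> i \<and> i < e v} + of_bool (?in i) \<le> snd (u ! i)" if i: "i < ?n" for i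
  proof -
    have "{v \<in> C. s v \<le> i \<and> i < e v} = {v \<in> ?C. s v \<le> i \<and> i < e v} \<union> (if ?in i then {x} else {})"
      using C(2) by auto
    moreover have "card ({v \<in> ?C. s v \<le> i \<and> i < e v} \<union> (if ?in i then {x} else {})) =
        card {v \<in> ?C. s v \<le> i \<and> i < e v} + card (if ?in i then {x} else {})"
      using C(1) by (intro card_Un_disjoint) auto
    ultimately have "card {v \<in> ?C. s v \<le> i \<and> i < e v} + of_bool (?in i) = card {v \<in> C. s v \<le> i \<and> i < e v}"
      by simp
    then show ?thesis using r i unfolding realz_def by simp
  qed
  define J' where "J' = {l. l < m \<and> (\<exists>y\<in>?C. a' l y \<and> (\<forall>i\<le>s y. l \<notin> fst (u' ! i)))}"
  have "realz adj ?C a' J' u' s e"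
    unfolding realz_def
  proof (intro conjI ballI allI impI)
    fix v assume "v \<in> ?C" then show "s v < e v" "e v \<le> length u'" using b len by auto
  next
    fix i assume "i < length u'"
    then show "card {v \<in> ?C. s v \<le> i \<and> i < e v} \<le> snd (u' ! i)" using crd[of i] fu(2)[of i] len by simp
  next
    fix y v assume "y \<in> ?C" "v \<in> ?C" "adj y v" then show "s y < e v" using r unfolding realz_def by blast
  next
    fix v l assume v: "v \<in> ?C" "a' l v"
    show "\<exists>i. s v \<le> i \<and> i < e v \<and> l \<in> fst (u' ! i)"
    proof (cases "l = j")
      case True
      then have "adj x v" using a'[OF v(1)] v(2) by simp
      then have "s x < e v" "s v < e x" using r v(1) C(2) sym unfolding realz_def by blast+
      then show ?thesis using True jt[of "max (s x) (s v)"] b[of v] b[of x] v(1) C(2)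
        by (intro exI[of _ "max (s x) (s v)"]) auto
    next
      case False
      then have "a l v" using a'[OF v(1)] v(2) by simp
      then obtain i where "s v \<le> i" "i < e v" "l \<in> fst (u ! i)" using r v(1) unfolding realz_def by blast
      then show ?thesis using sl[OF False, of i] b[of v] v(1) by (intro exI[of _ i]) auto
    qed
  next
    fix v assume v: "v \<in> ?C"
    consider y where "y \<in> ?C" "adj y v" "s y < s v" | "adj x v" "s x < s v"
      | l i where "a l v" "i < s v" "l \<in> fst (u ! i)"
      using r v unfolding realz_def by blast
    then show "(\<exists>y\<in>?C. adj y v \<and> s y < s v) \<or> (\<exists>l i. a' l v \<and> i < s v \<and> l \<in> fst (u' ! i))"
    proof cases
      case 1 then show ?thesis by blast
    next
      case 2
      then have "a' j v" "j \<in> fst (u' ! s x)" using a'[OF v] jt[of "s x"] b[OF C(2)] by auto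
      then show ?thesis using 2 by blast
    next
      case (3 l i)
      have "l \<noteq> j" using nj 3(1) v by blast
      then have "a' l v" "l \<in> fst (u' ! i)" using a'[OF v] 3 sl[of l i] b[of v] v by auto
      then show ?thesis using 3 by blast
    qed
  next
    fix l assume "l \<in> J'" then show "\<exists>y\<in>?C. a' l y \<and> (\<forall>i\<le>s y. l \<notin> fst (u' ! i))" by (auto simp: J'_def)
  qed
  moreover have "adm m k u'"
  proof -
    have "itrace l u'" for l
    proof (cases "l = j")
      case True
      show ?thesis unfolding itrace_def True len using jt by (metis le_less_trans le_trans)
    next
      case False
      have "itrace l u" using adm(1) by (simp add: adm_def)
      then show ?thesis unfolding itrace_def len using sl[OF False] by simp
    qed
    moreover have "y \<in> Pow {..<m} \<times> {..k}" if y: "y \<in> set u'" for y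
    proof -
      obtain i where i: "i < ?n" "y = u' ! i" using y len by (auto simp: in_set_conv_nth)
      have "u ! i \<in> Pow {..<m} \<times> {..k}" using adm(1) i unfolding adm_def by (meson nth_mem subsetD)
      then have "fst (u ! i) \<subseteq> {..<m}" "snd (u ! i) \<le> k" by (auto simp: mem_Times_iff)
      then have "fst y \<subseteq> {..<m}" "snd y \<le> k" using fu[OF i(1)] i(2) adm(2) by auto
      then show ?thesis by (simp add: mem_Times_iff)
    qed
    ultimately show ?thesis unfolding adm_def by blast
  qed
  moreover have "J' \<subseteq> {..<m}" by (auto simp: J'_def)
  ultimately have "(J', u') \<in> lang adj ?C a' m k" using stretch_refl unfolding lang_def by blast
  moreover have "stepc j N J J' u u'"
    unfolding stepc_def
  proof (intro conjI allI impI ballI)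
    show "length u' = ?n" by (rule len)
    show "j \<notin> J" using r aj unfolding realz_def by blast
    show "\<exists>i<?n. j \<in> fst (u' ! i)" using jt[of "s x"] b[OF C(2)] by (intro exI[of _ "s x"]) auto
  next
    fix i assume i: "i < ?n"
    show "fst (u' ! i) - {j} = fst (u ! i) - {j}" using fu(1)[OF i] by auto
    show "snd (u' ! i) + of_bool (j \<in> fst (u' ! i)) \<le> snd (u ! i)"
      using crd[OF i] fu(2)[OF i] jt[OF i] by auto
  next
    fix l assume "l \<in> N"
    then have l: "a l x" using N by simp
    then obtain i where "s x \<le> i" "i < e x" "l \<in> fst (u ! i)" using r C(2) unfolding realz_def by blast
    then show "\<exists>i<?n. j \<in> fst (u' ! i) \<and> l \<in> fst (u' ! i)"
      using sl[OF nj[OF l C(2)], of i] jt[of i] b[OF C(2)] by (intro exI[of _ i]) auto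
  next
    consider y where "y \<in> C" "adj y x" "s y < s x" | l i where "a l x" "i < s x" "l \<in> fst (u ! i)"
      using r C(2) unfolding realz_def by blast
    then show "j \<in> J' \<or> (\<exists>l\<in>N. \<exists>i<?n. l \<in> fst (u' ! i) \<and> (\<forall>q\<le>i. j \<notin> fst (u' ! q)))"
    proof cases
      case 1
      then have y: "y \<in> ?C" using irr by auto
      then have "a' j y" using a'[OF y] sym[OF 1(2)] by simp
      moreover have "\<forall>i\<le>s y. j \<notin> fst (u' ! i)" using 1(3) jt b[OF C(2)] by simp
      ultimately have "j \<in> J'" using y adm(2) unfolding J'_def by blast
      then show ?thesis by simp
    next
      case (2 l i)
      have il: "i < ?n" using 2(2) b[OF C(2)] by simp
      have "l \<in> fst (u' ! i)" using sl[OF nj[OF 2(1) C(2)] il] 2(3) by simp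
      moreover have "\<forall>q\<le>i. j \<notin> fst (u' ! q)" using jt il 2(2) by simp
      ultimately show ?thesis using il 2(1) N by blast
    qed
  next
    fix l assume l: "l \<in> J"
    then obtain y where y: "y \<in> C" "a l y" "\<forall>i\<le>s y. l \<notin> fst (u ! i)" using r unfolding realz_def by blast
    note lj = nj[OF y(2,1)]
    have ny: "\<forall>i\<le>s y. l \<notin> fst (u' ! i)" using y(3) sl[OF lj] b[OF y(1)] by simp
    show "l \<in> J' \<or> (l \<in> N \<and> (\<exists>i<?n. j \<in> fst (u' ! i) \<and> (\<forall>q\<le>i. l \<notin> fst (u' ! q))))"
    proof (cases "y = x")
      case True
      then have "l \<in> N" "s x < ?n" "j \<in> fst (u' ! s x)" using y N jt[of "s x"] b[OF C(2)] by auto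
      then show ?thesis using ny True by blast
    next
      case False
      then have yC: "y \<in> ?C" using y by simp
      then have "a' l y" using a'[OF yC] y(2) lj by simp
      then have "l \<in> J'" using yC ny l J unfolding J'_def by blast
      then show ?thesis by simp
    qed
  qed
  ultimately show ?thesis by blast
qed

text \<open>A slot without neighbours in \<open>C\<close> can be overwritten, so slot numbers are
  recycled and \<open>m\<close> never grows. Being an equation, this determines the type of
  \<open>C\<close> from the smaller piece whatever \<open>x\<close> and \<open>j\<close> are
  chosen.\<close>

lemma lang_step:
  assumes C: "finite C" "x \<in> C" and sym: "\<And>u v. adj u v \<Longrightarrow> adj v u" and irr: "\<And>u. \<not> adj u u"
    and j: "j < m" and aj: "\<And>u. u \<in> C \<Longrightarrow> \<not> a j u"
    and a': "\<And>u i. u \<in> C - {x} \<Longrightarrow> a' i u = (if i = j then adj x u else a i u)"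
    and N: "N = {l. a l x}"
  shows "lang adj C a m k = stepop j N m k (lang adj (C - {x}) a' m k)"
proof (intro subset_antisym subsetI)
  fix z assume "z \<in> lang adj C a m k"
  then obtain J w u s e where z: "z = (J, w)" and J: "J \<subseteq> {..<m}" and w: "adm m k w"
    and u: "stretch w u" "realz adj C a J u s e" unfolding lang_def by blast
  have "adm m k u" using adm_stretch[OF u(1)] w by simp
  from realz_remove[OF u(2) this j C sym irr aj a' N J]
  show "z \<in> stepop j N m k (lang adj (C - {x}) a' m k)"
    using z J w u(1) unfolding stepop_def by blast
next
  fix z assume "z \<in> stepop j N m k (lang adj (C - {x}) a' m k)"
  then obtain J w u J' u' where z: "z = (J, w)" and J: "J \<subseteq> {..<m}" and w: "adm m k w"
    and u: "stretch w u" and l: "(J', u') \<in> lang adj (C - {x}) a' m k" and c: "stepc j N J J' u u'"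
    unfolding stepop_def by blast
  obtain v' s e where v': "stretch u' v'" "realz adj (C - {x}) a' J' v' s e" and "adm m k u'"
    using l unfolding lang_def by blast
  obtain f where f: "stretches u' v' f" using v'(1) by (auto simp: stretch_def)
  have it: "itrace j v'" using \<open>adm m k u'\<close> itrace_stretches[OF f] by (simp add: adm_def)
  let ?v = "map (\<lambda>i. u ! f i) [0..<length v']"
  have c': "stepc j N J J' ?v v'" by (rule stepc_stretches[OF c f refl])
  from realz_insert[OF v'(2) it c' C sym aj a' N]
  obtain s' e' where "realz adj C a J ?v s' e'" by blast
  moreover have "stretch w ?v"
    using stretch_trans[OF u] stretches_remap[OF f, of u] c unfolding stretch_def stepc_def by metis
  ultimately show "z \<in> lang adj C a m k" using z J w unfolding lang_def by blast
qed


section \<open>Interval models\<close>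

text \<open>Bags are indexed by all natural numbers, so no length has to be carried along.\<close>

definition model :: "('v \<Rightarrow> 'v \<Rightarrow> bool) \<Rightarrow> 'v set \<Rightarrow> 'v \<Rightarrow> nat \<Rightarrow> ('v \<Rightarrow> nat) \<Rightarrow> ('v \<Rightarrow> nat) \<Rightarrow> bool" where
  "model adj V r k s e \<longleftrightarrow>
     (\<forall>v\<in>V. s v < e v) \<and>
     (\<forall>u\<in>V. \<forall>v\<in>V. adj u v \<longrightarrow> s u < e v) \<and>
     (\<forall>i. card {v\<in>V. s v \<le> i \<and> i < e v} \<le> k) \<and>
     (\<forall>v\<in>V - {r}. \<exists>u\<in>V. adj u v \<and> s u < s v)"

text \<open>A chain of strictly earlier neighbours must end, and it can end only at
  \<open>r\<close>.\<close>

lemma model_root: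
  assumes mod: "model adj V r k s e" and "v \<in> V"
  shows "s r \<le> s v"
  using assms(2)
proof (induction "s v" arbitrary: v rule: less_induct)
  case less
  show ?case
  proof (cases "v = r")
    case False
    then obtain u where "u \<in> V" "s u < s v" using mod less.prems unfolding model_def by blast
    then show ?thesis using less.hyps by fastforce
  qed simp
qed

text \<open>Slot 0 holds the root, which has to occur and counts against the bag size.
  \<open>J\<close> is arbitrary because the root is exempt from the search for an earlier
  neighbour.\<close>

definition accepting :: "nat \<Rightarrow> (nat set \<times> letter list) set \<Rightarrow> bool" where
  "accepting k M \<longleftrightarrow> (\<exists>J w. (J, w) \<in> M \<and> (\<exists>i<length w. 0 \<in> fst (w ! i)) \<and>
     (\<forall>i<length w. snd (w ! i) + of_bool (0 \<in> fst (w ! i)) \<le> k))"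

text \<open>The same construction as in \<open>realz_insert\<close>: the trace of slot 0 becomes the
  interval of the root.\<close>

lemma accepting_model:
  assumes V: "finite V" "r \<in> V" and sym: "\<And>u v. adj u v \<Longrightarrow> adj v u" and irr: "\<And>u. \<not> adj u u"
    and a: "\<And>l v. v \<in> V - {r} \<Longrightarrow> a l v \<longleftrightarrow> l = 0 \<and> adj r v"
    and acc: "accepting k (lang adj (V - {r}) a m k)"
  shows "\<exists>s e. model adj V r k s e"
proof -
  let ?C = "V - {r}"
  obtain J w where l: "(J, w) \<in> lang adj ?C a m k" and ne: "\<exists>i<length w. 0 \<in> fst (w ! i)"
    and cap: "\<forall>i<length w. snd (w ! i) + of_bool (0 \<in> fst (w ! i)) \<le> k"
    using acc unfolding accepting_def by blast
  obtain u s e where u: "stretch w u" "realz adj ?C a J u s e" and adm: "adm m k w"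
    using l unfolding lang_def by blast
  obtain f where f: "stretches w u f" using u(1) by (auto simp: stretch_def)
  have itr: "itrace 0 u" using adm itrace_stretches[OF f] by (simp add: adm_def)
  have capu: "snd (u ! i) + of_bool (0 \<in> fst (u ! i)) \<le> k" if "i < length u" for i
    using cap stretches_less[OF f that] stretches_nth[OF f that] by simp
  have neu: "\<exists>i<length u. 0 \<in> fst (u ! i)"
    using first_later[OF f, of "\<lambda>x. 0 \<in> fst x" "\<lambda>_. True"] ne by simp
  obtain p q where pq: "p < q" "q \<le> length u" and jt: "\<And>i. i < length u \<Longrightarrow> 0 \<in> fst (u ! i) \<longleftrightarrow> p \<le> i \<and> i < q"
    using itrace_interval[OF itr neu] by metis
  define s' where "s' = s(r := p)"
  define e' where "e' = e(r := q)"
  have se: "s' v = s v" "e' v = e v" if "v \<in> ?C" for v using that by (auto simp: s'_def e'_def)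
  have sr: "s' r = p" "e' r = q" by (auto simp: s'_def e'_def)
  have b: "s v < e v" "e v \<le> length u" if "v \<in> ?C" for v using u(2) that unfolding realz_def by auto
  have "model adj V r k s' e'"
    unfolding model_def
  proof (intro conjI ballI allI impI)
    fix v assume "v \<in> V"
    then show "s' v < e' v" using b[of v] se[of v] sr pq by (cases "v = r") auto
  next
    have rv: "p < e v" "s v < q" if v: "v \<in> ?C" "adj r v" for v
    proof -
      have "a 0 v" using a[OF v(1)] v(2) by simp
      then obtain i where "s v \<le> i" "i < e v" "0 \<in> fst (u ! i)" using u(2) v(1) unfolding realz_def by blast
      then show "p < e v" "s v < q" using jt[of i] b[OF v(1)] by auto
    qed
    fix x y assume xy: "x \<in> V" "y \<in> V" "adj x y"
    consider "x = r" "y \<in> ?C" | "x \<in> ?C" "y = r" | "x \<in> ?C" "y \<in> ?C" using xy irr by blast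
    then show "s' x < e' y"
    proof cases
      case 3 then show ?thesis using u(2) xy(3) se unfolding realz_def by simp
    qed (use rv xy(3) sym[OF xy(3)] se sr in auto)
  next
    fix i
    show "card {v \<in> V. s' v \<le> i \<and> i < e' v} \<le> k"
    proof (cases "i < length u")
      case True
      have "{v \<in> V. s' v \<le> i \<and> i < e' v} \<subseteq> {v \<in> ?C. s v \<le> i \<and> i < e v} \<union> (if p \<le> i \<and> i < q then {r} else {})"
        by (auto simp: s'_def e'_def split: if_splits)
      then have "card {v \<in> V. s' v \<le> i \<and> i < e' v} \<le>
          card ({v \<in> ?C. s v \<le> i \<and> i < e v} \<union> (if p \<le> i \<and> i < q then {r} else {}))"
        using V(1) by (intro card_mono) auto
      also have "\<dots> \<le> card {v \<in> ?C. s v \<le> i \<and> i < e v} + card (if p \<le> i \<and> i < q then {r} else {})"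
        by (rule card_Un_le)
      also have "\<dots> \<le> snd (u ! i) + of_bool (0 \<in> fst (u ! i))"
        using u(2) True jt[of i] unfolding realz_def by (intro add_mono) auto
      also have "\<dots> \<le> k" by (rule capu[OF True])
      finally show ?thesis .
    next
      case False
      have "e' v \<le> length u" if "v \<in> V" for v using b[of v] se[of v] sr pq that by (cases "v = r") auto
      then have "{v \<in> V. s' v \<le> i \<and> i < e' v} = {}" using False by fastforce
      then show ?thesis by (simp only: card.empty zero_le)
    qed
  next
    fix v assume v: "v \<in> V - {r}"
    consider y where "y \<in> ?C" "adj y v" "s y < s v" | l i where "a l v" "i < s v" "l \<in> fst (u ! i)"
      using u(2) v unfolding realz_def by blast
    then show "\<exists>y\<in>V. adj y v \<and> s' y < s' v"
    proof cases
      case 1 then show ?thesis using se v by auto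
    next
      case (2 l i)
      then have "adj r v" "p \<le> i" using a[OF v] jt[of i] b[OF v] by auto
      then show ?thesis using 2 V(2) se[OF v] sr by (intro bexI[of _ r]) auto
    qed
  qed
  then show ?thesis by blast
qed

text \<open>The word reads the model bag by bag up to the last exit \<open>T\<close>. Its capacities
  are the exact occupancies by the other vertices, so the condition on capacities is the bound on
  the bags of the model.\<close>

lemma model_accepting:
  assumes V: "finite V" "r \<in> V" and sym: "\<And>u v. adj u v \<Longrightarrow> adj v u"
    and a: "\<And>l v. v \<in> V - {r} \<Longrightarrow> a l v \<longleftrightarrow> l = 0 \<and> adj r v" and m: "0 < m"
    and mod: "model adj V r k s e"
  shows "accepting k (lang adj (V - {r}) a m k)"
proof -
  let ?C = "V - {r}"
  define T where "T = Max (e ` V)"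
  have eT: "e v \<le> T" if "v \<in> V" for v using that V(1) unfolding T_def by (intro Max_ge) auto
  have se: "s v < e v" if "v \<in> V" for v using mod that unfolding model_def by blast
  define w where "w = map (\<lambda>i. (if s r \<le> i \<and> i < e r then {0} else {} :: nat set, card {v\<in>?C. s v \<le> i \<and> i < e v})) [0..<T]"
  have len: "length w = T" by (simp add: w_def)
  have nth: "fst (w ! i) = (if s r \<le> i \<and> i < e r then {0} else {})" "snd (w ! i) = card {v\<in>?C. s v \<le> i \<and> i < e v}"
    if "i < T" for i using that by (simp_all add: w_def)
  have cap: "card {v\<in>?C. s v \<le> i \<and> i < e v} + of_bool (s r \<le> i \<and> i < e r) \<le> k" for i
  proof -
    have "{v \<in> V. s v \<le> i \<and> i < e v} = {v \<in> ?C. s v \<le> i \<and> i < e v} \<union> (if s r \<le> i \<and> i < e r then {r} else {})"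
      using V(2) by auto
    moreover have "card ({v \<in> ?C. s v \<le> i \<and> i < e v} \<union> (if s r \<le> i \<and> i < e r then {r} else {})) =
        card {v \<in> ?C. s v \<le> i \<and> i < e v} + card (if s r \<le> i \<and> i < e r then {r} else {})"
      using V(1) by (intro card_Un_disjoint) auto
    ultimately have "card {v\<in>?C. s v \<le> i \<and> i < e v} + of_bool (s r \<le> i \<and> i < e r) = card {v \<in> V. s v \<le> i \<and> i < e v}"
      by simp
    then show ?thesis using mod unfolding model_def by simp
  qed
  have "adm m k w"
  proof -
    have "itrace j w" for j
      unfolding itrace_def len by (auto simp: nth split: if_splits)
    moreover have "y \<in> Pow {..<m} \<times> {..k}" if y: "y \<in> set w" for y
    proof -
      obtain i where i: "i < T" "y = w ! i" using y len by (auto simp: in_set_conv_nth)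
      have "fst y \<subseteq> {..<m}" using nth(1)[OF i(1)] i(2) m by auto
      moreover have "snd y \<le> k" using nth(2)[OF i(1)] i(2) cap[of i] by simp
      ultimately show ?thesis by (simp add: mem_Times_iff)
    qed
    ultimately show ?thesis unfolding adm_def by blast
  qed
  moreover have "realz adj ?C a {} w s e"
    unfolding realz_def
  proof (intro conjI ballI allI impI)
    fix v assume "v \<in> ?C" then show "s v < e v" "e v \<le> length w" using se eT len by auto
  next
    fix i assume "i < length w"
    then show "card {v\<in>?C. s v \<le> i \<and> i < e v} \<le> snd (w ! i)" using nth(2) len by simp
  next
    fix x y assume "x \<in> ?C" "y \<in> ?C" "adj x y" then show "s x < e y" using mod unfolding model_def by blast
  next
    fix v l assume v: "v \<in> ?C" "a l v"
    then have l: "l = 0" "adj r v" using a[OF v(1)] by auto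
    have "s r < e v" "s v < e r" using mod v(1) V(2) l(2) sym[OF l(2)] unfolding model_def by blast+
    then show "\<exists>i. s v \<le> i \<and> i < e v \<and> l \<in> fst (w ! i)"
      using nth(1)[of "max (s r) (s v)"] se[of v] se[of r] eT[of v] v(1) V(2) l
      by (intro exI[of _ "max (s r) (s v)"]) auto
  next
    fix v assume v: "v \<in> ?C"
    then obtain y where y: "y \<in> V" "adj y v" "s y < s v" using mod unfolding model_def by blast
    show "(\<exists>u\<in>?C. adj u v \<and> s u < s v) \<or> (\<exists>j i. a j v \<and> i < s v \<and> j \<in> fst (w ! i))"
    proof (cases "y = r")
      case True
      then have "a 0 v" using a[OF v] y by simp
      moreover have "0 \<in> fst (w ! s r)" using nth(1)[of "s r"] se[OF V(2)] eT[OF V(2)] by simp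
      ultimately show ?thesis using y True by blast
    next
      case False then show ?thesis using y by blast
    qed
  qed simp
  ultimately have "({}, w) \<in> lang adj ?C a m k" using stretch_refl unfolding lang_def by blast
  moreover have "\<exists>i<length w. 0 \<in> fst (w ! i)"
    using nth(1)[of "s r"] se[OF V(2)] eT[OF V(2)] len by (intro exI[of _ "s r"]) auto
  moreover have "\<forall>i<length w. snd (w ! i) + of_bool (0 \<in> fst (w ! i)) \<le> k"
  proof (intro allI impI)
    fix i assume "i < length w"
    then have "i < T" using len by simp
    then show "snd (w ! i) + of_bool (0 \<in> fst (w ! i)) \<le> k" using cap[of i] nth[of i]
      by (cases "s r \<le> i \<and> i < e r") auto
  qed
  ultimately show ?thesis unfolding accepting_def by blast
qed


section \<open>Derivations\<close>

text \<open>Only the head of an arc must avoid \<open>B\<close>, so \<open>c\<close> itself always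
  belongs to the set. For \<open>c\<close> outside \<open>B\<close> and symmetric \<open>adj\<close>
  this is the component of \<open>c\<close> in the graph minus \<open>B\<close>.\<close>

definition comp_of :: "('v \<Rightarrow> 'v \<Rightarrow> bool) \<Rightarrow> 'v set \<Rightarrow> 'v \<Rightarrow> 'v set" where
  "comp_of adj B c = {d. (c, d) \<in> {(u, v). adj u v \<and> v \<notin> B}\<^sup>*}"

text \<open>
  A slot that repeats the vertex of an earlier slot counts as isolated, hence is always free for reuse.
\<close>

definition slot_adj :: "('v \<Rightarrow> 'v \<Rightarrow> bool) \<Rightarrow> 'v list \<Rightarrow> nat \<Rightarrow> 'v \<Rightarrow> bool" where
  "slot_adj adj b l u \<longleftrightarrow> l < length b \<and> adj (b ! l) u \<and> (\<forall>i<l. b ! i \<noteq> b ! l)"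

text \<open>The pairs whose type can be computed with the slots at hand: slot \<open>j\<close>,
  which the component of \<open>c\<close> does not use, is overwritten by a vertex \<open>x\<close>
  of the component, and whatever remains must be derivable in turn.\<close>

inductive deriv :: "('v \<Rightarrow> 'v \<Rightarrow> bool) \<Rightarrow> 'v list \<Rightarrow> 'v \<Rightarrow> bool" for adj where
  "c \<notin> set b \<Longrightarrow> x \<in> comp_of adj (set b) c \<Longrightarrow> j < length b \<Longrightarrow>
   (\<forall>u\<in>comp_of adj (set b) c. \<not> slot_adj adj b j u) \<Longrightarrow>
   (\<And>d. d \<in> comp_of adj (set b) c - {x} \<Longrightarrow> deriv adj (b[j := x]) d) \<Longrightarrow> deriv adj b c"

lemma comp_of_self: "c \<in> comp_of adj B c"
  by (simp add: comp_of_def)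

lemma comp_of_step: "u \<in> comp_of adj B c \<Longrightarrow> adj u v \<Longrightarrow> v \<notin> B \<Longrightarrow> v \<in> comp_of adj B c"
  unfolding comp_of_def by (auto intro: rtrancl_into_rtrancl)

lemma comp_of_induct [consumes 1, case_names base step]:
  assumes "d \<in> comp_of adj B c" "P c"
    "\<And>u v. u \<in> comp_of adj B c \<Longrightarrow> P u \<Longrightarrow> adj u v \<Longrightarrow> v \<notin> B \<Longrightarrow> P v"
  shows "P d"
proof -
  have "(c, d) \<in> {(u, v). adj u v \<and> v \<notin> B}\<^sup>*" using assms(1) by (simp add: comp_of_def)
  then show ?thesis
    by (induction rule: rtrancl_induct) (use assms(2,3) in \<open>auto simp: comp_of_def\<close>)
qed

lemma comp_of_avoid: "d \<in> comp_of adj B c \<Longrightarrow> c \<notin> B \<Longrightarrow> d \<notin> B"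
  by (induction rule: comp_of_induct) auto

lemma comp_of_subset: "c \<in> V \<Longrightarrow> (\<And>u v. adj u v \<Longrightarrow> v \<in> V) \<Longrightarrow> comp_of adj B c \<subseteq> V"
  by (auto elim: comp_of_induct)

lemma comp_of_mono: "d \<in> comp_of adj B c \<Longrightarrow> comp_of adj B d \<subseteq> comp_of adj B c"
  unfolding comp_of_def by auto

lemma comp_of_sym:
  assumes sym: "\<And>u v. adj u v \<Longrightarrow> adj v u" and "d \<in> comp_of adj B c" "c \<notin> B"
  shows "c \<in> comp_of adj B d"
  using assms(2)
proof (induction rule: comp_of_induct)
  case base then show ?case by (rule comp_of_self)
next
  case (step u v)
  have "u \<in> comp_of adj B v"
    by (rule comp_of_step[of v])
      (rule comp_of_self, rule sym[OF step.hyps(2)], rule comp_of_avoid[OF step.hyps(1) assms(3)])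
  then show ?case using comp_of_mono step.IH by fastforce
qed

lemma comp_of_eq:
  assumes "\<And>u v. adj u v \<Longrightarrow> adj v u" "d \<in> comp_of adj B c" "c \<notin> B"
  shows "comp_of adj B d = comp_of adj B c"
  using comp_of_mono[OF assms(2)] comp_of_mono[OF comp_of_sym[OF assms]] by blast

text \<open>Giving up slot \<open>j\<close> opens no way out of the component: a boundary vertex
  adjacent to the component is credited to its first slot, which is not \<open>j\<close> by
  assumption, so it stays in the tuple.\<close>

lemma comp_of_shrink:
  assumes b: "c \<notin> set b" "x \<in> comp_of adj (set b) c" "j < length b"
    "\<forall>u\<in>comp_of adj (set b) c. \<not> slot_adj adj b j u"
    and sym: "\<And>u v. adj u v \<Longrightarrow> adj v u"
    and u: "u \<in> comp_of adj (set b) c" "adj u v" "v \<notin> set (b[j := x])"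
  shows "v \<in> comp_of adj (set b) c - {x}"
proof -
  have "v \<notin> set b"
  proof
    assume "v \<in> set b"
    then have ex: "\<exists>i. i < length b \<and> b ! i = v" by (auto simp: in_set_conv_nth)
    define i where "i = (LEAST i. i < length b \<and> b ! i = v)"
    have i: "i < length b" "b ! i = v" using LeastI_ex[OF ex] by (auto simp: i_def)
    have "b ! i' \<noteq> v" if "i' < i" for i'
      using not_less_Least[of i' "\<lambda>i. i < length b \<and> b ! i = v"] that i by (auto simp: i_def)
    then have "slot_adj adj b i u" using i sym[OF u(2)] by (simp add: slot_adj_def)
    then have "i \<noteq> j" using b(4) u(1) by blast
    then have "b[j := x] ! i = v" using i by simp
    then show False using u(3) i(1) by (metis length_list_update nth_mem)
  qed
  moreover have "x \<in> set (b[j := x])" using b(3) by (simp add: set_update_memI)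
  ultimately show ?thesis using comp_of_step[OF u(1,2)] u(3) by auto
qed

lemma comp_of_update:
  assumes b: "c \<notin> set b" "x \<in> comp_of adj (set b) c" "j < length b"
    "\<forall>u\<in>comp_of adj (set b) c. \<not> slot_adj adj b j u"
    and sym: "\<And>u v. adj u v \<Longrightarrow> adj v u" and d: "d \<in> comp_of adj (set b) c - {x}"
  shows "comp_of adj (set (b[j := x])) d \<subseteq> comp_of adj (set b) c - {x}"
proof
  fix v assume "v \<in> comp_of adj (set (b[j := x])) d"
  then show "v \<in> comp_of adj (set b) c - {x}"
    by (induction rule: comp_of_induct) (use d comp_of_shrink[OF b sym] in auto)
qed

text \<open>Overwriting slot \<open>j\<close> could promote a later duplicate to a first occurrence.
  For a vertex adjacent to \<open>u\<close> this is impossible, since its first slot is adjacent to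
  \<open>u\<close> and therefore differs from \<open>j\<close>.\<close>

lemma slot_adj_update:
  assumes b: "c \<notin> set b" "x \<in> comp_of adj (set b) c" "j < length b"
    "\<forall>u\<in>comp_of adj (set b) c. \<not> slot_adj adj b j u"
    and u: "u \<in> comp_of adj (set b) c - {x}"
  shows "slot_adj adj (b[j := x]) i u = (if i = j then adj x u else slot_adj adj b i u)"
proof (cases "i = j")
  case True
  have "x \<notin> set b" using comp_of_avoid[OF b(2,1)] .
  then have "b ! i \<noteq> x" if "i < length b" for i using that by auto
  then show ?thesis using True b(3) by (auto simp: slot_adj_def)
next
  case False
  have x: "x \<notin> set b" using comp_of_avoid[OF b(2,1)] .
  show ?thesis
  proof (cases "i < length b \<and> adj (b ! i) u")
    case True
    have bi: "b[j := x] ! i = b ! i" "b ! i \<noteq> x" using False True x by auto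
    have "(\<forall>i'<i. b[j := x] ! i' \<noteq> b ! i) \<longleftrightarrow> (\<forall>i'<i. b ! i' \<noteq> b ! i)"
    proof
      assume h: "\<forall>i'<i. b[j := x] ! i' \<noteq> b ! i"
      show "\<forall>i'<i. b ! i' \<noteq> b ! i"
      proof (intro allI impI notI)
        fix i' assume i': "i' < i" "b ! i' = b ! i"
        define i0 where "i0 = (LEAST i. b ! i = b ! i')"
        have i0: "b ! i0 = b ! i'" "i0 \<le> i'" unfolding i0_def by (rule LeastI, simp) (rule Least_le, simp)
        have "b ! q \<noteq> b ! i0" if "q < i0" for q
          using not_less_Least[of q "\<lambda>i. b ! i = b ! i'"] that i0 by (auto simp: i0_def)
        then have "slot_adj adj b i0 u" using i0 i' True by (simp add: slot_adj_def)
        then have "i0 \<noteq> j" using b(4) u by blast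
        then show False using h i0 i' by (metis le_less_trans nth_list_update_neq)
      qed
    next
      assume h: "\<forall>i'<i. b ! i' \<noteq> b ! i"
      show "\<forall>i'<i. b[j := x] ! i' \<noteq> b ! i"
        using h bi(2) True by (metis nth_list_update_eq nth_list_update_neq list_update_beyond leI)
    qed
    then show ?thesis using False bi by (simp add: slot_adj_def)
  next
    case no: False
    then show ?thesis using False by (auto simp: slot_adj_def)
  qed
qed

text \<open>The last premise is the invariant of the recursion. For a boundary vertex
  \<open>u\<close> with a neighbour \<open>y\<close> in the component and the earliest vertex
  \<open>x\<close> it yields \<open>s u <= s x <= s y < e u\<close>, so \<open>u\<close> is present
  when \<open>x\<close> enters. Moving the earliest vertex to the boundary preserves the
  invariant.\<close>

lemma deriv_complete:
  assumes mod: "model adj V r k s e" and V: "finite V"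
    and adjV: "\<And>u v. adj u v \<Longrightarrow> v \<in> V" and sym: "\<And>u v. adj u v \<Longrightarrow> adj v u"
  shows "c \<in> V \<Longrightarrow> c \<notin> set b \<Longrightarrow> length b = k \<Longrightarrow>
    (\<And>u y v. u \<in> set b \<Longrightarrow> y \<in> comp_of adj (set b) c \<Longrightarrow> adj u y \<Longrightarrow> v \<in> comp_of adj (set b) c \<Longrightarrow> s u \<le> s v)
    \<Longrightarrow> deriv adj b c"
proof (induction "card (comp_of adj (set b) c)" arbitrary: b c rule: less_induct)
  case less
  let ?C = "comp_of adj (set b) c"
  have CV: "?C \<subseteq> V" using less.prems(1) adjV by (rule comp_of_subset)
  have finC: "finite ?C" using CV V by (rule finite_subset)
  have "Min (s ` ?C) \<in> s ` ?C" using finC comp_of_self[of c adj "set b"] by (intro Min_in) auto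
  then obtain x where x: "x \<in> ?C" "s x = Min (s ` ?C)" by auto
  have min: "s x \<le> s v" if "v \<in> ?C" for v using x(2) finC that by simp
  have xb: "x \<notin> set b" using comp_of_avoid[OF x(1) less.prems(2)] .
  define N where "N = {u\<in>set b. \<exists>v\<in>?C. adj u v}"
  have sub: "insert x N \<subseteq> {v\<in>V. s v \<le> s x \<and> s x < e v}"
  proof
    fix u assume "u \<in> insert x N"
    then consider "u = x" | y where "u \<in> set b" "y \<in> ?C" "adj u y" by (auto simp: N_def)
    then show "u \<in> {v\<in>V. s v \<le> s x \<and> s x < e v}"
    proof cases
      case 1 then show ?thesis using x(1) CV mod unfolding model_def by auto
    next
      case (2 y)
      have uV: "u \<in> V" "y \<in> V" using adjV sym 2(3) by blast+
      have "s y < e u" using mod uV sym[OF 2(3)] unfolding model_def by blast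
      then show ?thesis using uV min[OF 2(2)] less.prems(4)[OF 2 x(1)] by simp
    qed
  qed
  then have "card (insert x N) \<le> card {v\<in>V. s v \<le> s x \<and> s x < e v}"
    using V by (intro card_mono) auto
  also have "\<dots> \<le> k" using mod unfolding model_def by blast
  finally have "card (insert x N) \<le> k" .
  moreover have "finite N" "x \<notin> N" using xb by (auto simp: N_def)
  ultimately have Nk: "card N < k" by simp
  \<comment> \<open>If all \<open>k\<close> slots were in use, they would all be first occurrences
    and thus hold \<open>k\<close> different vertices of \<open>N\<close>.\<close>
  have "\<exists>j<k. \<forall>u\<in>?C. \<not> slot_adj adj b j u"
  proof (rule ccontr)
    assume "\<not> ?thesis"
    then have all: "\<exists>u\<in>?C. slot_adj adj b j u" if "j < k" for j using that by blast
    have "inj_on ((!) b) {..<k}"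
    proof (rule linorder_inj_onI')
      fix i j assume "i \<in> {..<k}" "j \<in> {..<k}" "i < j"
      then show "b ! i \<noteq> b ! j" using all[of j] by (auto simp: slot_adj_def)
    qed
    moreover have "(!) b ` {..<k} \<subseteq> N"
      using all less.prems(3) by (auto simp: N_def slot_adj_def)
    ultimately have "card {..<k} \<le> card N" using \<open>finite N\<close> by (rule card_inj_on_le)
    then show False using Nk by simp
  qed
  then obtain j where j: "j < length b" "\<forall>u\<in>?C. \<not> slot_adj adj b j u" using less.prems(3) by blast
  show ?case
  proof (rule deriv.intros[OF less.prems(2) x(1) j])
    fix d assume d: "d \<in> ?C - {x}"
    let ?b = "b[j := x]"
    have sub: "comp_of adj (set ?b) d \<subseteq> ?C - {x}"
      by (rule comp_of_update[OF less.prems(2) x(1) j sym d])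
    have "card (comp_of adj (set ?b) d) \<le> card (?C - {x})" using sub finC by (intro card_mono) auto
    also have "\<dots> < card ?C" using finC x(1) by (rule card_Diff1_less)
    finally have lt: "card (comp_of adj (set ?b) d) < card ?C" .
    have sb: "set ?b \<subseteq> insert x (set b)" by (rule set_update_subset_insert)
    show "deriv adj ?b d"
    proof (rule less.hyps[OF lt])
      show "d \<in> V" using d CV by blast
      show "d \<notin> set ?b" using d sb comp_of_avoid[of d adj "set b" c] less.prems(2) by blast
      show "length ?b = k" using less.prems(3) by simp
    next
      fix u y v
      assume u: "u \<in> set ?b" "y \<in> comp_of adj (set ?b) d" "adj u y" "v \<in> comp_of adj (set ?b) d"
      have yv: "y \<in> ?C" "v \<in> ?C" using sub u by auto
      from u(1) sb consider "u = x" | "u \<in> set b" by blast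
      then show "s u \<le> s v" using min[OF yv(2)] less.prems(4)[OF _ yv(1) u(3) yv(2)] by cases auto
    qed
  qed
qed


section \<open>Connected pathwidth in terms of interval models\<close>

definition adj_on :: "'a pair_pre_digraph \<Rightarrow> 'a set \<Rightarrow> ('a \<times> 'a) set" where
  "adj_on G U = {(u, v). u \<in> U \<and> v \<in> U \<and> (u, v) \<in> parcs G}"

text \<open>The library speaks of the symmetric closure of the arcs and of reachability inside a
  vertex set; for symmetric arcs both reduce to reachability along \<open>adj_on\<close>.\<close>

lemma connected_induced_iff:
  assumes "pair_graph G"
  shows "Digraph_Component.connected (with_proj G \<restriction> U) \<longleftrightarrow>
    U \<noteq> {} \<and> (\<forall>u\<in>U. \<forall>v\<in>U. (u, v) \<in> (adj_on G U)\<^sup>*)"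
proof -
  interpret pair_graph G by fact
  have ends: "arcs_ends (with_proj G \<restriction> U) = adj_on G U"
    by (auto simp: arcs_ends_conv adj_on_def image_iff)
  have sym: "(adj_on G U)\<^sup>s = adj_on G U"
    by (auto simp: symcl_def adj_on_def arcs_symmetric)
  have "(u, v) \<in> rtrancl_on U (adj_on G U) \<longleftrightarrow> (u, v) \<in> (adj_on G U)\<^sup>*" if "u \<in> U" for u v
  proof
    assume "(u, v) \<in> rtrancl_on U (adj_on G U)"
    then show "(u, v) \<in> (adj_on G U)\<^sup>*" by (rule rtrancl_on_rtranclI)
  next
    assume "(u, v) \<in> (adj_on G U)\<^sup>*"
    then show "(u, v) \<in> rtrancl_on U (adj_on G U)"
      by (induction rule: rtrancl_induct) (use that in \<open>auto simp: adj_on_def intro: rtrancl_on_into_rtrancl_on\<close>)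
  qed
  then show ?thesis unfolding connected_conv ends sym induce_subgraph_verts by auto
qed

text \<open>\<open>\<rho>\<close> is the distance from \<open>A\<close> within \<open>U\<close>; the
  last step of a shortest path provides \<open>u\<close>.\<close>

lemma rank_exists:
  assumes c: "\<forall>u\<in>U. \<forall>v\<in>U. (u, v) \<in> (adj_on G U)\<^sup>*" and A: "A \<subseteq> U" "A \<noteq> {}"
  shows "\<exists>\<rho> :: 'a \<Rightarrow> nat. \<forall>v\<in>U - A. \<exists>u\<in>U. (u, v) \<in> parcs G \<and> \<rho> u < \<rho> v"
proof -
  let ?R = "adj_on G U"
  define \<rho> where "\<rho> v = (LEAST n. \<exists>a\<in>A. (a, v) \<in> ?R ^^ n)" for v
  have "\<exists>u\<in>U. (u, v) \<in> parcs G \<and> \<rho> u < \<rho> v" if v: "v \<in> U - A" for v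
  proof -
    obtain a where a: "a \<in> A" using A by blast
    then have "(a, v) \<in> ?R\<^sup>*" using c v A by blast
    then have "\<exists>n. \<exists>a\<in>A. (a, v) \<in> ?R ^^ n" using a rtrancl_power by blast
    then have "\<exists>a\<in>A. (a, v) \<in> ?R ^^ \<rho> v" unfolding \<rho>_def by (rule LeastI_ex)
    then obtain a where a: "a \<in> A" "(a, v) \<in> ?R ^^ \<rho> v" by blast
    have "\<rho> v \<noteq> 0" using a v by (auto intro: ccontr)
    then obtain n where n: "\<rho> v = Suc n" using not0_implies_Suc by blast
    then obtain u where u: "(a, u) \<in> ?R ^^ n" "(u, v) \<in> ?R" using a(2) by auto
    have "\<rho> u \<le> n" unfolding \<rho>_def by (rule Least_le) (use a u in blast)
    then show ?thesis using n u(2) by (auto simp: adj_on_def)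
  qed
  then show ?thesis by blast
qed

text \<open>Every bag is blown up to a block of \<open>K\<close> consecutive times. A vertex enters
  in the block of its first bag, delayed by its distance from the previous prefix, and leaves at the
  end of the block of its last bag. A time in block \<open>i\<close> therefore sees only vertices of
  bag \<open>i\<close>.\<close>

lemma decomposition_model:
  assumes G: "pair_graph G" and cpd: "connected_path_decomposition G Xs" and k: "\<forall>X\<in>set Xs. card X \<le> k"
  shows "\<exists>r\<in>pverts G. \<exists>s e. model (\<lambda>u v. (u, v) \<in> parcs G) (pverts G) r k s e"
proof -
  interpret pair_graph G by fact
  let ?V = "pverts G" and ?l = "length Xs"
  have pd: "path_decomposition G Xs" using cpd by (simp add: connected_path_decomposition_def)
  have cover: "\<Union>(set Xs) = ?V" and edge: "\<And>u v. (u, v) \<in> parcs G \<Longrightarrow> \<exists>X\<in>set Xs. u \<in> X \<and> v \<in> X"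
    and conv: "\<And>i j m. i \<le> j \<Longrightarrow> j \<le> m \<Longrightarrow> m < ?l \<Longrightarrow> Xs ! i \<inter> Xs ! m \<subseteq> Xs ! j" and ne: "Xs \<noteq> []"
    using pd unfolding path_decomposition_def by auto
  define P where "P i = \<Union>(set (take i Xs))" for i
  have Pin: "v \<in> P i \<longleftrightarrow> (\<exists>q<i. q < ?l \<and> v \<in> Xs ! q)" for v i
  proof
    assume "v \<in> P i"
    then obtain X where X: "X \<in> set (take i Xs)" "v \<in> X" unfolding P_def by blast
    then obtain q where "q < length (take i Xs)" "take i Xs ! q = X" by (meson in_set_conv_nth)
    then show "\<exists>q<i. q < ?l \<and> v \<in> Xs ! q" using X(2) by auto
  next
    assume "\<exists>q<i. q < ?l \<and> v \<in> Xs ! q"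
    then obtain q where q: "q < i" "q < ?l" "v \<in> Xs ! q" by blast
    then have "take i Xs ! q \<in> set (take i Xs)" by (intro nth_mem) simp
    then show "v \<in> P i" using q unfolding P_def by auto
  qed
  have PV: "P i \<subseteq> ?V" for i unfolding P_def cover[symmetric] by (auto dest: in_set_takeD)
  have conn: "P i \<noteq> {}" "\<forall>u\<in>P i. \<forall>v\<in>P i. (u, v) \<in> (adj_on G (P i))\<^sup>*" if "1 \<le> i" "i \<le> ?l" for i
    using cpd that connected_induced_iff[OF G, of "P i"]
    unfolding connected_path_decomposition_def P_def by auto
  have "P 1 \<noteq> {}" using conn(1)[of 1] ne by (cases Xs) auto
  then obtain r where r: "r \<in> Xs ! 0" using Pin by auto
  define f where "f v = (LEAST i. i < ?l \<and> v \<in> Xs ! i)" for v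
  define g where "g v = (GREATEST i. i < ?l \<and> v \<in> Xs ! i)" for v
  have ex: "\<exists>i. i < ?l \<and> v \<in> Xs ! i" if vV: "v \<in> ?V" for v
  proof -
    obtain X where "X \<in> set Xs" "v \<in> X" using vV cover by blast
    then show ?thesis by (metis in_set_conv_nth)
  qed
  have f: "f v < ?l" "v \<in> Xs ! f v" if "v \<in> ?V" for v
    using LeastI_ex[OF ex[OF that]] by (auto simp: f_def)
  have g: "g v < ?l" "v \<in> Xs ! g v" if "v \<in> ?V" for v
    using GreatestI_ex_nat[OF ex[OF that], of ?l] by (auto simp: g_def)
  have fle: "f v \<le> i" if "i < ?l" "v \<in> Xs ! i" for v i
    unfolding f_def by (rule Least_le) (use that in simp)
  have gge: "i \<le> g v" if "i < ?l" "v \<in> Xs ! i" for v i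
    unfolding g_def by (rule Greatest_le_nat[where b="?l"]) (use that in auto)
  \<comment> \<open>The first bag has no previous prefix to measure distances from; the root
    \<open>r\<close>, chosen in this bag, takes its place.\<close>
  define A where "A i = (if i = 0 then {r} else P i)" for i
  have "\<exists>\<rho> :: 'a \<Rightarrow> nat. \<forall>v\<in>P (Suc i) - A i. \<exists>u\<in>P (Suc i). (u, v) \<in> parcs G \<and> \<rho> u < \<rho> v" if i: "i < ?l" for i
  proof (rule rank_exists)
    show "\<forall>u\<in>P (Suc i). \<forall>v\<in>P (Suc i). (u, v) \<in> (adj_on G (P (Suc i)))\<^sup>*" using conn(2)[of "Suc i"] i by simp
    have "P i \<subseteq> P (Suc i)" unfolding P_def by (intro Union_mono set_take_subset_set_take) simp
    then show "A i \<subseteq> P (Suc i)" using r ne by (auto simp: A_def Pin)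
    show "A i \<noteq> {}" using conn(1)[of i] i by (auto simp: A_def)
  qed
  then obtain \<rho> :: "nat \<Rightarrow> 'a \<Rightarrow> nat" where rho: "\<And>i v. i < ?l \<Longrightarrow> v \<in> P (Suc i) - A i \<Longrightarrow>
      \<exists>u\<in>P (Suc i). (u, v) \<in> parcs G \<and> \<rho> i u < \<rho> i v"
    by metis
  \<comment> \<open>\<open>K\<close> exceeds every rank, so a delay never leaves its block.\<close>
  define K where "K = Suc (Max ((\<lambda>(i, v). \<rho> i v) ` ({..<?l} \<times> ?V)))"
  have rK: "\<rho> i v < K" if "i < ?l" "v \<in> ?V" for i v
  proof -
    have "\<rho> i v \<le> Max ((\<lambda>(i, v). \<rho> i v) ` ({..<?l} \<times> ?V))"
      by (rule Max_ge) (use that in \<open>auto intro!: image_eqI[of _ _ "(i, v)"]\<close>)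
    then show ?thesis by (simp add: K_def)
  qed
  define s where "s v = f v * K + \<rho> (f v) v" for v
  define e where "e v = Suc (g v) * K" for v
  have s_less: "s v < Suc (f v) * K" if "v \<in> ?V" for v
    using rK[OF f(1)[OF that] that] by (simp add: s_def)
  have s_ge: "f v * K \<le> s v" for v by (simp add: s_def)
  have "model (\<lambda>u v. (u, v) \<in> parcs G) ?V r k s e"
    unfolding model_def
  proof (intro conjI ballI allI impI)
    fix v assume v: "v \<in> ?V"
    have "Suc (f v) * K \<le> Suc (g v) * K" using gge[OF f[OF v]] by (intro mult_le_mono1) simp
    then show "s v < e v" unfolding e_def by (rule less_le_trans[OF s_less[OF v]])
  next
    fix u v assume uv: "u \<in> ?V" "v \<in> ?V" "(u, v) \<in> parcs G"
    obtain i where i: "i < ?l" "u \<in> Xs ! i" "v \<in> Xs ! i" using edge[OF uv(3)] by (auto simp: in_set_conv_nth)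
    have "f u \<le> g v" using fle[OF i(1,2)] gge[OF i(1,3)] by simp
    then have "Suc (f u) * K \<le> Suc (g v) * K" by (intro mult_le_mono1) simp
    then show "s u < e v" unfolding e_def by (rule less_le_trans[OF s_less[OF uv(1)]])
  next
    fix t
    let ?i = "t div K" and ?S = "{v \<in> ?V. s v \<le> t \<and> t < e v}"
    have K0: "0 < K" by (simp add: K_def)
    have S: "f v \<le> ?i" "?i \<le> g v" if "v \<in> ?S" for v
    proof -
      have "f v * K \<le> t" using s_ge[of v] that by simp
      then show "f v \<le> ?i" using K0 by (simp add: less_eq_div_iff_mult_less_eq)
      have "t < Suc (g v) * K" using that by (simp add: e_def)
      then have "?i < Suc (g v)" by (simp only: less_mult_imp_div_less)
      then show "?i \<le> g v" by simp
    qed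
    show "card ?S \<le> k"
    proof (cases "?S = {}")
      case False
      then obtain v where v: "v \<in> ?S" by blast
      have il: "?i < ?l" using S(2)[OF v] g(1)[of v] v by simp
      have "?S \<subseteq> Xs ! ?i"
      proof
        fix u assume u: "u \<in> ?S"
        then have uV: "u \<in> ?V" by simp
        show "u \<in> Xs ! ?i" using conv[OF S[OF u] g(1)[OF uV]] f(2)[OF uV] g(2)[OF uV] by blast
      qed
      moreover have "Xs ! ?i \<subseteq> ?V" using il cover nth_mem by blast
      then have "finite (Xs ! ?i)" using pair_finite_verts by (rule finite_subset)
      ultimately have "card ?S \<le> card (Xs ! ?i)" by (intro card_mono)
      then show ?thesis using k il by (meson le_trans nth_mem)
    next
      case True
      then show ?thesis by (simp only: card.empty)
    qed
  next
    fix v assume v: "v \<in> ?V - {r}"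
    then have vV: "v \<in> ?V" by simp
    let ?i = "f v"
    have "v \<notin> P ?i" using fle[of _ v] unfolding Pin by (meson not_le)
    then have "v \<in> P (Suc ?i) - A ?i" using f[OF vV] v by (auto simp: Pin A_def)
    then obtain u where u: "u \<in> P (Suc ?i)" "(u, v) \<in> parcs G" "\<rho> ?i u < \<rho> ?i v"
      using rho[OF f(1)[OF vV]] by blast
    have uV: "u \<in> ?V" using u(1) PV by blast
    have "f u \<le> ?i" using u(1) fle unfolding Pin by (meson le_trans less_Suc_eq_le)
    then have "s u < s v"
    proof (cases "f u = ?i")
      case True
      then show ?thesis using u(3) by (simp add: s_def)
    next
      case False
      with \<open>f u \<le> ?i\<close> have "Suc (f u) * K \<le> ?i * K" by (intro mult_le_mono1) simp
      then show ?thesis using s_less[OF uV] s_ge[of v] by linarith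
    qed
    then show "\<exists>u\<in>?V. (u, v) \<in> parcs G \<and> s u < s v" using uV u(2) by blast
  qed
  moreover have "r \<in> ?V" using r cover ne by (auto simp: nth_mem)
  ultimately show ?thesis by blast
qed

text \<open>The bags are the sets of vertices present at the times from \<open>s r\<close> on, the
  first entry of all. The union of a prefix is \<open>{v. s v <= t}\<close>, and chains of strictly
  earlier neighbours stay inside this set and lead to \<open>r\<close>.\<close>

lemma model_decomposition:
  assumes G: "pair_graph G" and r: "r \<in> pverts G"
    and mod: "model (\<lambda>u v. (u, v) \<in> parcs G) (pverts G) r k s e"
  shows "\<exists>Xs. connected_path_decomposition G Xs \<and> (\<forall>X\<in>set Xs. card X \<le> k)"
proof -
  interpret pair_graph G by fact
  let ?V = "pverts G"
  have se: "s v < e v" if "v \<in> ?V" for v using mod that unfolding model_def by blast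
  have early: "\<exists>u\<in>?V. (u, v) \<in> parcs G \<and> s u < s v" if "v \<in> ?V" "v \<noteq> r" for v
    using mod that unfolding model_def by blast
  define T where "T = Max (e ` ?V)"
  have eT: "e v \<le> T" if "v \<in> ?V" for v using that unfolding T_def by (intro Max_ge) auto
  note min = model_root[OF mod]
  define B where "B t = {v\<in>?V. s v \<le> t \<and> t < e v}" for t
  define Xs where "Xs = map B [s r..<T]"
  have len: "length Xs = T - s r" by (simp add: Xs_def)
  have nth: "Xs ! i = B (s r + i)" if "i < length Xs" for i using that by (simp add: Xs_def)
  have inX: "B t \<in> set Xs" if "s r \<le> t" "t < T" for t using that by (auto simp: Xs_def)
  have vB: "v \<in> B (s v)" "s r \<le> s v" "s v < T" if "v \<in> ?V" for v
    using se[OF that] min[OF that] eT[OF that] that by (auto simp: B_def)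
  have "path_decomposition G Xs"
    unfolding path_decomposition_def
  proof (intro conjI allI impI)
    show "Xs \<noteq> []" using vB[OF r] by (auto simp: Xs_def)
    show "(\<Union>X\<in>set Xs. X) = ?V"
    proof
      show "(\<Union>X\<in>set Xs. X) \<subseteq> ?V" by (auto simp: Xs_def B_def)
      show "?V \<subseteq> (\<Union>X\<in>set Xs. X)" using vB inX by blast
    qed
  next
    fix u v assume uv: "(u, v) \<in> parcs G"
    then have V: "u \<in> ?V" "v \<in> ?V" "(v, u) \<in> parcs G" by (auto simp: arcs_symmetric dest: wellformed)
    have "s u < e v" "s v < e u" using mod uv V unfolding model_def by blast+
    then have "u \<in> B (max (s u) (s v))" "v \<in> B (max (s u) (s v))" using se V by (auto simp: B_def)
    moreover have "B (max (s u) (s v)) \<in> set Xs"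
      using vB(2,3)[OF V(1)] vB(2,3)[OF V(2)] by (intro inX) (auto simp: le_max_iff_disj)
    ultimately show "\<exists>X\<in>set Xs. u \<in> X \<and> v \<in> X" by blast
  next
    fix i j m assume "i \<le> j \<and> j \<le> m \<and> m < length Xs"
    then show "Xs ! i \<inter> Xs ! m \<subseteq> Xs ! j" by (auto simp: nth B_def)
  qed
  moreover have "Digraph_Component.connected (with_proj G \<restriction> (\<Union>X\<in>set (take i Xs). X))" if i: "i \<in> {1..length Xs}" for i
  proof -
    define t where "t = s r + i - 1"
    define U where "U = {v\<in>?V. s v \<le> t}"
    have "(\<Union>X\<in>set (take i Xs). X) = U"
    proof
      show "(\<Union>X\<in>set (take i Xs). X) \<subseteq> U"
        using i by (auto simp: in_set_conv_nth nth B_def U_def t_def) linarith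
      show "U \<subseteq> (\<Union>X\<in>set (take i Xs). X)"
      proof
        fix v assume v: "v \<in> U"
        then have vV: "v \<in> ?V" and st: "s v \<le> t" by (auto simp: U_def)
        let ?q = "s v - s r"
        have q: "?q < i" "?q < length Xs" "s r + ?q = s v"
          using st vB[OF vV] i by (auto simp: t_def len)
        then have "Xs ! ?q \<in> set (take i Xs)" by (metis in_set_conv_nth length_take min_less_iff_conj nth_take)
        moreover have "v \<in> Xs ! ?q" using nth[OF q(2)] q(3) vB(1)[OF vV] by simp
        ultimately show "v \<in> (\<Union>X\<in>set (take i Xs). X)" by blast
      qed
    qed
    moreover have rU: "r \<in> U" using r i by (auto simp: U_def t_def)
    have to_r: "(r, v) \<in> (adj_on G U)\<^sup>*" if "v \<in> U" for v
      using that
    proof (induction "s v" arbitrary: v rule: less_induct)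
      case less
      show ?case
      proof (cases "v = r")
        case False
        then obtain u where u: "u \<in> ?V" "(u, v) \<in> parcs G" "s u < s v"
          using early less.prems by (auto simp: U_def)
        then have "u \<in> U" using less.prems by (auto simp: U_def)
        then have "(r, u) \<in> (adj_on G U)\<^sup>*" "(u, v) \<in> adj_on G U" using less u by (auto simp: adj_on_def)
        then show ?thesis by (rule rtrancl_into_rtrancl)
      qed simp
    qed
    have "sym (adj_on G U)" by (auto simp: sym_def adj_on_def arcs_symmetric)
    then have "sym ((adj_on G U)\<^sup>*)" by (rule sym_rtrancl)
    then have "(u, v) \<in> (adj_on G U)\<^sup>*" if "u \<in> U" "v \<in> U" for u v
      using to_r[OF that(1)] to_r[OF that(2)] by (meson rtrancl_trans symD)
    then have "Digraph_Component.connected (with_proj G \<restriction> U)"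
      using rU unfolding connected_induced_iff[OF G] by blast
    ultimately show ?thesis by simp
  qed
  moreover have "card X \<le> k" if "X \<in> set Xs" for X
    using that mod unfolding model_def by (auto simp: Xs_def B_def)
  ultimately show ?thesis unfolding connected_path_decomposition_def by blast
qed

lemma cpw_model:
  assumes "pair_graph G" "k \<ge> 1"
  shows "cpw G \<le> enat (k - 1) \<longleftrightarrow>
    (\<exists>r\<in>pverts G. \<exists>s e. model (\<lambda>u v. (u, v) \<in> parcs G) (pverts G) r k s e)"
  unfolding cpw_le_iff[OF assms(2)]
  using decomposition_model[OF assms(1)] model_decomposition[OF assms(1)] by blast


section \<open>Loop programs\<close>

text \<open>
  \<open>FFor x i c\<close> runs \<open>c\<close> with the cell \<open>x[i]\<close> set to \<open>0, \<dots>, n - 1\<close>, where \<open>n\<close> is the number of vertices.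
  Without other loops, the running time is bounded by the nesting depth alone.
\<close>

datatype fcom =
    FSkip
  | FAssign vname aexp aexp
  | FSeq fcom fcom  (infixr \<open>;;\<close> 60)
  | FIf aexp fcom fcom
  | FFor vname nat fcom

definition upd :: "vname \<Rightarrow> nat \<Rightarrow> nat \<Rightarrow> store \<Rightarrow> store" where
  "upd x i a s = s(x := (s x)(i := a))"

lemma upd_apply: "upd x i a s y j = (if y = x \<and> j = i then a else s y j)"
  by (simp add: upd_def)

lemma upd_same [simp]: "upd x i a s x i = a"
  by (simp add: upd_apply)

lemma upd_other [simp]: "y \<noteq> x \<Longrightarrow> upd x i a s y = s y"
  by (simp add: upd_def)

lemma upd_other_index [simp]: "j \<noteq> i \<Longrightarrow> upd x i a s x j = s x j"
  by (simp add: upd_apply)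

lemma exec_Assign: "exec (Assign x e1 e2) s (1 + acost e1 + acost e2) (upd x (aval e1 s) (aval e2 s) s)"
  unfolding upd_def by (rule exec.Assign)

text \<open>A loop means exactly \<open>n\<close> rounds. The counter is incremented from its value
  after the body, as in the compiled loop; \<open>wf_loops\<close> ensures that the body left it
  unchanged, so both versions agree.\<close>

primrec run :: "nat \<Rightarrow> fcom \<Rightarrow> store \<Rightarrow> store" where
  "run n FSkip = (\<lambda>s. s)"
| "run n (FAssign x e1 e2) = (\<lambda>s. upd x (aval e1 s) (aval e2 s) s)"
| "run n (c1 ;; c2) = (\<lambda>s. run n c2 (run n c1 s))"
| "run n (FIf e c1 c2) = (\<lambda>s. if aval e s \<noteq> 0 then run n c1 s else run n c2 s)"
| "run n (FFor x i c) = (\<lambda>s. ((\<lambda>s. upd x i (Suc (run n c s x i)) (run n c s)) ^^ n) (upd x i 0 s))"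

text \<open>Tracked by cells and not only by arrays, because the nested loops over tuples use the
  cells of the single array \<open>b\<close> as counters. A computed index counts as the whole
  array.\<close>

primrec writes :: "fcom \<Rightarrow> (vname \<times> nat) set" where
  "writes FSkip = {}"
| "writes (FAssign x e1 e2) = (case e1 of Const i \<Rightarrow> {(x, i)} | _ \<Rightarrow> {x} \<times> UNIV)"
| "writes (c1 ;; c2) = writes c1 \<union> writes c2"
| "writes (FIf e c1 c2) = writes c1 \<union> writes c2"
| "writes (FFor x i c) = insert (x, i) (writes c)"

primrec wf_loops :: "fcom \<Rightarrow> bool" where
  "wf_loops FSkip \<longleftrightarrow> True"
| "wf_loops (FAssign x e1 e2) \<longleftrightarrow> True"
| "wf_loops (c1 ;; c2) \<longleftrightarrow> wf_loops c1 \<and> wf_loops c2"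
| "wf_loops (FIf e c1 c2) \<longleftrightarrow> wf_loops c1 \<and> wf_loops c2"
| "wf_loops (FFor x i c) \<longleftrightarrow> (x, i) \<notin> writes c \<and> wf_loops c"

lemma run_frame: "(x, i) \<notin> writes c \<Longrightarrow> run n c s x i = s x i"
proof (induction c arbitrary: s)
  case (FAssign y e1 e2)
  then show ?case by (cases e1) (auto simp: upd_apply)
next
  case (FFor y j c)
  have "((\<lambda>s. upd y j (Suc (run n c s y j)) (run n c s)) ^^ m) (upd y j 0 s) x i = s x i" for m
    by (induction m) (use FFor in \<open>auto simp: upd_apply\<close>)
  then show ?case by simp
qed auto

lemma run_frame_name: "(\<forall>i. (x, i) \<notin> writes c) \<Longrightarrow> run n c s x = s x"
  by (rule ext) (simp add: run_frame)

lemma run_for: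
  assumes "(x, i) \<notin> writes c" "I 0 (upd x i 0 s)"
    "\<And>q s. q < n \<Longrightarrow> s x i = q \<Longrightarrow> I q s \<Longrightarrow> I (Suc q) (upd x i (Suc q) (run n c s))"
  shows "I n (run n (FFor x i c) s)"
proof -
  let ?g = "\<lambda>s. upd x i (Suc (run n c s x i)) (run n c s)"
  have "I q ((?g ^^ q) (upd x i 0 s)) \<and> (?g ^^ q) (upd x i 0 s) x i = q" if "q \<le> n" for q
    using that
  proof (induction q)
    case 0
    then show ?case using assms(2) by simp
  next
    case (Suc q)
    let ?s = "(?g ^^ q) (upd x i 0 s)"
    have q: "I q ?s" "?s x i = q" using Suc by auto
    have "run n c ?s x i = q" using run_frame[OF assms(1), of n ?s] q(2) by simp
    then show ?case using assms(3)[of q ?s] Suc.prems q by simp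
  qed
  then show ?thesis by simp
qed

primrec compile :: "fcom \<Rightarrow> com" where
  "compile FSkip = Skip"
| "compile (FAssign x e1 e2) = Assign x e1 e2"
| "compile (c1 ;; c2) = Seq (compile c1) (compile c2)"
| "compile (FIf e c1 c2) = com.If e (compile c1) (compile c2)"
| "compile (FFor x i c) = Seq (Assign x (Const i) (Const 0))
     (While (Minus (Cell ''n'' (Const 0)) (Cell x (Const i)))
        (Seq (compile c) (Assign x (Const i) (Plus (Cell x (Const i)) (Const 1)))))"

primrec depth :: "fcom \<Rightarrow> nat" where
  "depth FSkip = 0"
| "depth (FAssign x e1 e2) = 0"
| "depth (c1 ;; c2) = max (depth c1) (depth c2)"
| "depth (FIf e c1 c2) = max (depth c1) (depth c2)"
| "depth (FFor x i c) = Suc (depth c)"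

text \<open>The 21 of a loop is \<open>9 + 12\<close>: 3 for the initialisation and 6 for the
  failing test at the end, and in each round 6 for the test and 6 for the increment.\<close>

primrec factor :: "fcom \<Rightarrow> nat" where
  "factor FSkip = 1"
| "factor (FAssign x e1 e2) = 1 + acost e1 + acost e2"
| "factor (c1 ;; c2) = factor c1 + factor c2"
| "factor (FIf e c1 c2) = 1 + acost e + factor c1 + factor c2"
| "factor (FFor x i c) = 21 + factor c"

text \<open>The base is \<open>max 1 n\<close>, since for \<open>n = 0\<close> a loop still pays for
  its initialisation and first test, and the bound must not vanish.\<close>

lemma exec_compile:
  assumes "wf_loops c" "(''n'', 0) \<notin> writes c" "s ''n'' 0 = n"
  shows "\<exists>t. exec (compile c) s t (run n c s) \<and> t \<le> factor c * max 1 n ^ depth c"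
  using assms
proof (induction c arbitrary: s)
  case FSkip
  show ?case using exec.Skip by (intro exI[of _ 1]) simp
next
  case (FAssign x e1 e2)
  show ?case using exec_Assign by (intro exI[of _ "1 + acost e1 + acost e2"]) simp
next
  case (FSeq c1 c2)
  let ?N = "max 1 n"
  obtain t1 where t1: "exec (compile c1) s t1 (run n c1 s)" "t1 \<le> factor c1 * ?N ^ depth c1"
    using FSeq by force
  have "run n c1 s ''n'' 0 = n" using run_frame[of "''n''" 0 c1 n s] FSeq.prems by simp
  then obtain t2 where t2: "exec (compile c2) (run n c1 s) t2 (run n c2 (run n c1 s))"
      "t2 \<le> factor c2 * ?N ^ depth c2"
    using FSeq by force
  have "?N ^ depth c1 \<le> ?N ^ max (depth c1) (depth c2)" "?N ^ depth c2 \<le> ?N ^ max (depth c1) (depth c2)"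
    by (intro power_increasing; simp)+
  then have "factor c1 * ?N ^ depth c1 + factor c2 * ?N ^ depth c2 \<le> (factor c1 + factor c2) * ?N ^ max (depth c1) (depth c2)"
    unfolding add_mult_distrib by (intro add_mono mult_le_mono2)
  then show ?case using exec.Seq[OF t1(1) t2(1)] t1(2) t2(2) by (intro exI[of _ "t1 + t2"]) auto
next
  case (FIf e c1 c2)
  let ?N = "max 1 n"
  let ?d = "max (depth c1) (depth c2)"
  have N: "?N ^ depth c1 \<le> ?N ^ ?d" "?N ^ depth c2 \<le> ?N ^ ?d" "1 \<le> ?N ^ ?d"
    by ((intro power_increasing; simp)+) simp
  have sum: "1 + acost e + (A * ?N ^ ?d) \<le> (1 + acost e + factor c1 + factor c2) * ?N ^ ?d"
    if "A \<le> factor c1 + factor c2" for A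
  proof -
    have "1 + acost e \<le> (1 + acost e) * ?N ^ ?d"
      using mult_le_mono2[OF N(3), of "1 + acost e"] by (simp only: mult_1_right)
    moreover have "A * ?N ^ ?d \<le> (factor c1 + factor c2) * ?N ^ ?d" using that by (rule mult_le_mono1)
    ultimately have "1 + acost e + A * ?N ^ ?d \<le> (1 + acost e) * ?N ^ ?d + (factor c1 + factor c2) * ?N ^ ?d"
      by (rule add_mono)
    also have "\<dots> = (1 + acost e + factor c1 + factor c2) * ?N ^ ?d" by (simp only: add_mult_distrib add.assoc)
    finally show ?thesis .
  qed
  show ?case
  proof (cases "aval e s \<noteq> 0")
    case True
    obtain t where t: "exec (compile c1) s t (run n c1 s)" "t \<le> factor c1 * ?N ^ depth c1"
      using FIf by force
    have "t \<le> factor c1 * ?N ^ ?d" using t(2) N(1) by (meson le_trans mult_le_mono2)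
    then have "1 + acost e + t \<le> (1 + acost e + factor c1 + factor c2) * ?N ^ ?d"
      using sum[of "factor c1"] by simp
    then show ?thesis using exec.IfTrue[OF True t(1)] True by (intro exI[of _ "1 + acost e + t"]) auto
  next
    case False
    obtain t where t: "exec (compile c2) s t (run n c2 s)" "t \<le> factor c2 * ?N ^ depth c2"
      using FIf by force
    have "t \<le> factor c2 * ?N ^ ?d" using t(2) N(2) by (meson le_trans mult_le_mono2)
    then have "1 + acost e + t \<le> (1 + acost e + factor c1 + factor c2) * ?N ^ ?d"
      using sum[of "factor c2"] by simp
    then show ?thesis using exec.IfFalse[of e s] t(1) False by (intro exI[of _ "1 + acost e + t"]) auto
  qed
next
  case (FFor x i c)
  let ?N = "max 1 n"
  let ?b = "Minus (Cell ''n'' (Const 0)) (Cell x (Const i))"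
  let ?body = "Seq (compile c) (Assign x (Const i) (Plus (Cell x (Const i)) (Const 1)))"
  let ?g = "\<lambda>s. upd x i (Suc (run n c s x i)) (run n c s)"
  let ?T = "factor c * ?N ^ depth c"
  have xn: "(x, i) \<noteq> (''n'', 0)" "(x, i) \<notin> writes c" using FFor.prems by auto
  have loop: "\<exists>t. exec (While ?b ?body) s t ((?g ^^ m) s) \<and> t \<le> 6 + m * (12 + ?T)"
    if "s ''n'' 0 = n" "s x i + m = n" for m s
    using that
  proof (induction m arbitrary: s)
    case 0
    then have "aval ?b s = 0" by simp
    from exec.WhileFalse[OF this, of ?body] show ?case by (intro exI[of _ 6]) (simp add: eval_nat_numeral)
  next
    case (Suc m)
    then have b: "aval ?b s \<noteq> 0" by simp
    obtain t1 where t1: "exec (compile c) s t1 (run n c s)" "t1 \<le> ?T"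
      using FFor.IH FFor.prems Suc.prems by force
    have fr: "run n c s ''n'' 0 = n" "run n c s x i = s x i"
      using run_frame[of "''n''" 0 c n s] run_frame[OF xn(2), of n s] FFor.prems Suc.prems by auto
    have "exec ?body s (t1 + 6) (?g s)"
      using exec.Seq[OF t1(1) exec_Assign[of x "Const i" "Plus (Cell x (Const i)) (Const 1)"]] by (simp add: eval_nat_numeral)
    moreover have "?g s ''n'' 0 = n" "?g s x i + m = n" using fr xn Suc.prems by (auto simp: upd_apply)
    then obtain t2 where t2: "exec (While ?b ?body) (?g s) t2 ((?g ^^ m) (?g s))" "t2 \<le> 6 + m * (12 + ?T)"
      using Suc.IH by blast
    ultimately have "exec (While ?b ?body) s (1 + acost ?b + (t1 + 6) + t2) ((?g ^^ m) (?g s))"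
      using exec.WhileTrue[OF b] by blast
    moreover have "1 + acost ?b + (t1 + 6) + t2 \<le> 6 + Suc m * (12 + ?T)" using t1(2) t2(2) by simp
    moreover have "(?g ^^ Suc m) s = (?g ^^ m) (?g s)" by (simp only: funpow_Suc_right comp_apply)
    ultimately show ?case by (intro exI[of _ "1 + acost ?b + (t1 + 6) + t2"]) (simp only:)
  qed
  let ?s = "upd x i 0 s"
  have "?s ''n'' 0 = n" "?s x i + n = n" using FFor.prems xn by (auto simp: upd_apply)
  then obtain t where t: "exec (While ?b ?body) ?s t ((?g ^^ n) ?s)" "t \<le> 6 + n * (12 + ?T)"
    using loop[of ?s n] by blast
  have "exec (Assign x (Const i) (Const 0)) s 3 ?s" using exec_Assign[of x "Const i" "Const 0" s] by (simp add: eval_nat_numeral)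
  then have "exec (compile (FFor x i c)) s (3 + t) (run n (FFor x i c) s)"
    using t(1) by (simp add: exec.Seq)
  moreover have "3 + t \<le> factor (FFor x i c) * ?N ^ depth (FFor x i c)"
  proof -
    have P: "1 \<le> ?N ^ Suc (depth c)" "n \<le> ?N ^ Suc (depth c)"
    proof -
      show "1 \<le> ?N ^ Suc (depth c)" by simp
      have "?N ^ 1 \<le> ?N ^ Suc (depth c)" by (intro power_increasing) auto
      then show "n \<le> ?N ^ Suc (depth c)" by simp
    qed
    have "3 + t \<le> 9 + 12 * n + n * ?T" using t(2) by (simp add: algebra_simps)
    also have "n * ?T \<le> ?N * ?T" by (intro mult_le_mono1) simp
    also have "?N * ?T = factor c * ?N ^ Suc (depth c)" by (simp only: power_Suc mult.left_commute)
    finally have "3 + t \<le> 9 + 12 * n + factor c * ?N ^ Suc (depth c)" by simp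
    also have "\<dots> \<le> 9 * ?N ^ Suc (depth c) + 12 * ?N ^ Suc (depth c) + factor c * ?N ^ Suc (depth c)"
      using P by (intro add_mono mult_le_mono2) linarith+
    also have "\<dots> = (21 + factor c) * ?N ^ Suc (depth c)" by (simp only: add_mult_distrib)
    finally show ?thesis by simp
  qed
  ultimately show ?case by blast
qed


section \<open>Building blocks of the program\<close>

text \<open>
  The program keeps a boundary tuple in \<open>b[0], \<dots>, b[k - 1]\<close> and works on a copy \<open>e\<close>, in which one slot may
  be replaced.  The table \<open>T\<close> is indexed by such a tuple followed by a vertex \<open>c\<close>, read as digits in base
  \<open>n\<close>; an entry is the code of the type of the component of \<open>c\<close>, or 0 if it is not known yet.
\<close>

declare run.simps(5) [simp del]

abbreviation var :: "vname \<Rightarrow> aexp" where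
  "var x \<equiv> Cell x (Const 0)"

abbreviation assign :: "vname \<Rightarrow> aexp \<Rightarrow> fcom" where
  "assign x e \<equiv> FAssign x (Const 0) e"

lemma upd_other' [simp]: "x \<noteq> y \<Longrightarrow> upd x i a s y = s y"
  by (rule upd_other) simp

definition neq :: "aexp \<Rightarrow> aexp \<Rightarrow> aexp" where
  "neq e1 e2 = Plus (Minus e1 e2) (Minus e2 e1)"

lemma aval_neq [simp]: "aval (neq e1 e2) s = 0 \<longleftrightarrow> aval e1 s = aval e2 s"
  by (auto simp: neq_def)

lemma aval_neq' [simp]: "0 < aval (neq e1 e2) s \<longleftrightarrow> aval e1 s \<noteq> aval e2 s"
  by (auto simp: neq_def)

definition wnames :: "fcom \<Rightarrow> vname set" where
  "wnames c = fst ` writes c"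

lemma wnames_simps [simp]:
  "wnames FSkip = {}"
  "wnames (FAssign x e1 e2) = {x}"
  "wnames (c1 ;; c2) = wnames c1 \<union> wnames c2"
  "wnames (FIf e c1 c2) = wnames c1 \<union> wnames c2"
  "wnames (FFor x i c) = insert x (wnames c)"
  by (auto simp: wnames_def image_iff split: aexp.splits)

lemma not_writes: "x \<notin> wnames c \<Longrightarrow> (x, i) \<notin> writes c"
  by (force simp: wnames_def)

lemma run_keep: "x \<notin> wnames c \<Longrightarrow> run n c s x = s x"
  by (rule run_frame_name) (simp add: not_writes)

primrec unroll :: "nat \<Rightarrow> (nat \<Rightarrow> fcom) \<Rightarrow> fcom" where
  "unroll 0 f = FSkip"
| "unroll (Suc m) f = unroll m f ;; f m"

lemma wnames_unroll: "(\<And>j. wnames (f j) \<subseteq> X) \<Longrightarrow> wnames (unroll m f) \<subseteq> X"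
  by (induction m) auto

lemma wf_unroll: "(\<And>j. j < m \<Longrightarrow> wf_loops (f j)) \<Longrightarrow> wf_loops (unroll m f)"
  by (induction m) auto

lemma depth_unroll: "(\<And>j. j < m \<Longrightarrow> depth (f j) \<le> d) \<Longrightarrow> depth (unroll m f) \<le> d"
  by (induction m) auto

lemma run_unroll:
  assumes "I 0 s" "\<And>j t. j < m \<Longrightarrow> I j t \<Longrightarrow> I (Suc j) (run n (f j) t)"
  shows "I m (run n (unroll m f) s)"
  using assms by (induction m) auto

primrec switch :: "nat \<Rightarrow> aexp \<Rightarrow> (nat \<Rightarrow> fcom) \<Rightarrow> fcom" where
  "switch 0 e f = FSkip"
| "switch (Suc m) e f = FIf (neq e (Const m)) (switch m e f) (f m)"

lemma wnames_switch: "(\<And>j. wnames (f j) \<subseteq> X) \<Longrightarrow> wnames (switch m e f) \<subseteq> X"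
  by (induction m) auto

lemma wf_switch: "(\<And>j. wf_loops (f j)) \<Longrightarrow> wf_loops (switch m e f)"
  by (induction m) auto

lemma depth_switch: "(\<And>j. depth (f j) \<le> d) \<Longrightarrow> depth (switch m e f) \<le> d"
  by (induction m) auto

lemma run_switch: "aval e s < m \<Longrightarrow> run n (switch m e f) s = run n (f (aval e s)) s"
  by (induction m) (auto simp: less_Suc_eq)

text \<open>The machine has no multiplication; the factor \<open>n\<close> is obtained by
  \<open>n\<close> additions, at the price of one nesting level.\<close>

definition mul :: "vname \<Rightarrow> nat \<Rightarrow> fcom" where
  "mul y i = assign ''m'' (Const 0) ;; FFor ''mi'' 0 (assign ''m'' (Plus (var ''m'') (Cell y (Const i))))"

lemma mul_props [simp]:
  "wnames (mul y i) = {''m'', ''mi''}" "wf_loops (mul y i)" "depth (mul y i) = 1"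
  by (auto simp: mul_def)

lemma mul_keep [simp]: "x \<noteq> ''m'' \<Longrightarrow> x \<noteq> ''mi'' \<Longrightarrow> run n (mul y i) s x = s x"
  by (rule run_keep) simp

lemma run_mul [simp]:
  assumes "y \<noteq> ''m''" "y \<noteq> ''mi''"
  shows "run n (mul y i) s ''m'' 0 = n * s y i"
proof -
  let ?I = "\<lambda>q t. t ''m'' 0 = q * s y i \<and> t y i = s y i"
  have "?I n (run n (FFor ''mi'' 0 (assign ''m'' (Plus (var ''m'') (Cell y (Const i))))) (upd ''m'' 0 0 s))"
    by (rule run_for[where I="?I"]) (use assms in auto)
  then show ?thesis by (simp add: mul_def)
qed

section \<open>Tuples as numbers in base \<open>n\<close>\<close>

definition tup :: "nat \<Rightarrow> store \<Rightarrow> vname \<Rightarrow> nat list" where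
  "tup k s x = map (s x) [0..<k]"

lemma tup_simps [simp]: "length (tup k s x) = k" "j < k \<Longrightarrow> tup k s x ! j = s x j"
  by (auto simp: tup_def)

lemma set_tup: "set (tup k s x) = s x ` {..<k}"
  by (auto simp: tup_def)

lemma tup_cong: "s x = s' x \<Longrightarrow> tup k s x = tup k s' x"
  by (simp add: tup_def)

definition enc :: "nat \<Rightarrow> nat list \<Rightarrow> nat" where
  "enc n ds = foldl (\<lambda>a d. n * a + d) 0 ds"

lemma enc_simps [simp]: "enc n [] = 0" "enc n (ds @ [d]) = n * enc n ds + d"
  by (auto simp: enc_def)

text \<open>Digits are recovered from the right by \<open>mod n\<close>; equal lengths are required
  because leading zeros are invisible. Different pairs of tuple and vertex thus have different table
  entries.\<close>

lemma enc_inj: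
  assumes "length xs = length ys" "set xs \<subseteq> {..<n}" "set ys \<subseteq> {..<n}" "enc n xs = enc n ys"
  shows "xs = ys"
  using assms
proof (induction xs arbitrary: ys rule: rev_induct)
  case (snoc x xs)
  then obtain zs y where ys: "ys = zs @ [y]" by (cases ys rule: rev_cases) auto
  have lt: "x < n" "y < n" using snoc.prems ys by auto
  have eq: "n * enc n xs + x = n * enc n zs + y" using snoc.prems ys by simp
  from arg_cong[OF eq, of "\<lambda>z. z mod n"] have "x = y" using lt by simp
  then have "enc n xs = enc n zs" using eq lt by simp
  then show ?case using snoc ys \<open>x = y\<close> by simp
qed simp

definition addr :: "nat \<Rightarrow> vname \<Rightarrow> fcom" where
  "addr k y = assign ''a'' (Const 0) ;;
     unroll k (\<lambda>j. mul ''a'' 0 ;; assign ''a'' (Plus (var ''m'') (Cell ''e'' (Const j)))) ;;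
     mul ''a'' 0 ;; assign ''a'' (Plus (var ''m'') (var y))"

lemma addr_wnames: "wnames (addr k y) \<subseteq> {''a'', ''m'', ''mi''}"
proof -
  have "wnames (unroll k (\<lambda>j. mul ''a'' 0 ;; assign ''a'' (Plus (var ''m'') (Cell ''e'' (Const j))))) \<subseteq> {''a'', ''m'', ''mi''}"
    by (rule wnames_unroll) simp
  then show ?thesis unfolding addr_def wnames_simps by auto
qed

lemma addr_props [simp]: "wf_loops (addr k y)" "depth (addr k y) \<le> 1"
  by (auto simp: addr_def intro!: wf_unroll depth_unroll)

lemma addr_keep [simp]: "x \<notin> {''a'', ''m'', ''mi''} \<Longrightarrow> run n (addr k y) s x = s x"
  by (rule run_keep[OF contra_subsetD[OF addr_wnames]])

lemma run_addr [simp]: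
  assumes y: "y \<notin> {''a'', ''m'', ''mi''}"
  shows "run n (addr k y) s ''a'' 0 = enc n (tup k s ''e'' @ [s y 0])"
proof -
  let ?f = "\<lambda>j. mul ''a'' 0 ;; assign ''a'' (Plus (var ''m'') (Cell ''e'' (Const j)))"
  let ?I = "\<lambda>j t. t ''a'' 0 = enc n (map (s ''e'') [0..<j]) \<and> t ''e'' = s ''e'' \<and> t y = s y"
  have "?I k (run n (unroll k ?f) (upd ''a'' 0 0 s))"
    by (rule run_unroll[where I="?I"]) (use y in auto)
  then show ?thesis using y by (simp add: addr_def tup_def)
qed

definition memb :: "nat \<Rightarrow> vname \<Rightarrow> fcom" where
  "memb k y = assign ''f'' (Const 0) ;;
     unroll k (\<lambda>j. FIf (neq (var y) (Cell ''e'' (Const j))) FSkip (assign ''f'' (Const 1)))"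

lemma memb_wnames: "wnames (memb k y) \<subseteq> {''f''}"
proof -
  have "wnames (unroll k (\<lambda>j. FIf (neq (var y) (Cell ''e'' (Const j))) FSkip (assign ''f'' (Const 1)))) \<subseteq> {''f''}"
    by (rule wnames_unroll) simp
  then show ?thesis unfolding memb_def wnames_simps by auto
qed

lemma memb_props [simp]: "wf_loops (memb k y)" "depth (memb k y) = 0"
proof -
  have "depth (unroll k (\<lambda>j. FIf (neq (var y) (Cell ''e'' (Const j))) FSkip (assign ''f'' (Const 1)))) \<le> 0"
    by (rule depth_unroll) simp
  then show "depth (memb k y) = 0" by (simp add: memb_def)
  show "wf_loops (memb k y)" by (auto simp: memb_def intro!: wf_unroll)
qed

lemma memb_keep [simp]: "x \<noteq> ''f'' \<Longrightarrow> run n (memb k y) s x = s x"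
  by (rule run_keep[OF contra_subsetD[OF memb_wnames]]) simp

lemma run_memb [simp]:
  assumes y: "y \<noteq> ''f''"
  shows "run n (memb k y) s ''f'' 0 = 0 \<longleftrightarrow> s y 0 \<notin> set (tup k s ''e'')"
proof -
  let ?f = "\<lambda>j. FIf (neq (var y) (Cell ''e'' (Const j))) FSkip (assign ''f'' (Const 1))"
  let ?I = "\<lambda>j t. (t ''f'' 0 = 0 \<longleftrightarrow> s y 0 \<notin> s ''e'' ` {..<j}) \<and> t ''e'' = s ''e'' \<and> t y = s y"
  have "?I k (run n (unroll k ?f) (upd ''f'' 0 0 s))"
    by (rule run_unroll[where I="?I"]) (use y in \<open>auto simp: lessThan_Suc\<close>)
  then show ?thesis by (simp add: memb_def set_tup)
qed

lemma run_memb' [simp]: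
  "y \<noteq> ''f'' \<Longrightarrow> 0 < run n (memb k y) s ''f'' 0 \<longleftrightarrow> s y 0 \<in> set (tup k s ''e'')"
  using run_memb[of y n k s] by (metis neq0_conv)

section \<open>Searching the component of a vertex\<close>

definition relax :: "nat \<Rightarrow> fcom" where
  "relax k = FIf (Cell ''K'' (var ''u''))
     (mul ''u'' 0 ;; FIf (Cell ''adj'' (Plus (var ''m'') (var ''v'')))
        (memb k ''v'' ;; FIf (var ''f'') FSkip (FAssign ''K'' (var ''v'') (Const 1))) FSkip) FSkip"

definition relax_all :: "nat \<Rightarrow> fcom" where
  "relax_all k = FFor ''u'' 0 (FFor ''v'' 0 (relax k))"

text \<open>
  Every reachable vertex is reached within \<open>n * n\<close> steps, a bound on the number of arcs, whence the two
  nested counters.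
\<close>

definition reach :: "nat \<Rightarrow> vname \<Rightarrow> fcom" where
  "reach k y = FFor ''i'' 0 (FAssign ''K'' (var ''i'') (Const 0)) ;; FAssign ''K'' (var y) (Const 1) ;;
     FFor ''p'' 0 (FFor ''pp'' 0 (relax_all k))"

lemma relax_props: "wnames (relax k) \<subseteq> {''K'', ''m'', ''mi'', ''f''}" "wf_loops (relax k)" "depth (relax k) = 1"
  using memb_wnames[of k "''v''"] by (auto simp: relax_def)

lemma relax_all_props: "wnames (relax_all k) \<subseteq> {''K'', ''m'', ''mi'', ''f'', ''u'', ''v''}" "wf_loops (relax_all k)" "depth (relax_all k) = 3"
proof -
  have "''u'' \<notin> wnames (relax k)" "''v'' \<notin> wnames (relax k)" using relax_props(1)[of k] by auto
  then show "wf_loops (relax_all k)" using relax_props(2)[of k] by (simp add: relax_all_def not_writes)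
qed (use relax_props[of k] in \<open>auto simp: relax_all_def\<close>)

lemma reach_wnames: "wnames (reach k y) \<subseteq> {''i'', ''K'', ''p'', ''pp'', ''u'', ''v'', ''m'', ''mi'', ''f''}"
proof -
  have "wnames (relax_all k) \<subseteq> {''i'', ''K'', ''p'', ''pp'', ''u'', ''v'', ''m'', ''mi'', ''f''}"
    by (rule order_trans[OF relax_all_props(1)]) simp
  then show ?thesis by (simp add: reach_def)
qed

lemma reach_props [simp]:
  "wf_loops (reach k y)" "depth (reach k y) = 5"
proof -
  have "''p'' \<notin> wnames (relax_all k)" "''pp'' \<notin> wnames (relax_all k)" using relax_all_props(1)[of k] by auto
  then show "wf_loops (reach k y)" using relax_all_props(2)[of k] by (simp add: reach_def not_writes)
  show "depth (reach k y) = 5" by (simp add: reach_def relax_all_props(3))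
qed

lemma reach_keep [simp]:
  "x \<notin> {''i'', ''K'', ''p'', ''pp'', ''u'', ''v'', ''m'', ''mi'', ''f''} \<Longrightarrow> run n (reach k y) s x = s x"
  by (rule run_keep[OF contra_subsetD[OF reach_wnames]])

locale input_graph =
  fixes n :: nat and adj :: "nat \<Rightarrow> nat \<Rightarrow> bool"
  assumes adj_less: "adj u v \<Longrightarrow> u < n" and adj_sym: "adj u v \<Longrightarrow> adj v u" and adj_irr: "\<not> adj u u"
begin

definition stored :: "store \<Rightarrow> bool" where
  "stored s \<longleftrightarrow> (\<forall>u<n. \<forall>v<n. s ''adj'' (n * u + v) \<noteq> 0 \<longleftrightarrow> adj u v)"

lemma stored_cong: "s ''adj'' = s' ''adj'' \<Longrightarrow> stored s \<longleftrightarrow> stored s'"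
  by (simp add: stored_def)

lemma run_relax:
  assumes "stored s" "s ''u'' 0 < n" "s ''v'' 0 < n"
  shows "run n (relax k) s ''K'' = (if s ''K'' (s ''u'' 0) \<noteq> 0 \<and> adj (s ''u'' 0) (s ''v'' 0) \<and>
     s ''v'' 0 \<notin> set (tup k s ''e'') then (s ''K'') (s ''v'' 0 := 1) else s ''K'')"
proof -
  have A: "s ''adj'' (n * s ''u'' 0 + s ''v'' 0) = 0 \<longleftrightarrow> \<not> adj (s ''u'' 0) (s ''v'' 0)"
    using assms(1)[unfolded stored_def, rule_format, OF assms(2,3)] by auto
  have T: "tup k (run n (mul ''u'' 0) s) ''e'' = tup k s ''e''" by (rule tup_cong) simp
  show ?thesis using A T by (auto simp: relax_def upd_def)
qed

text \<open>Marks are updated in place and may spread along several arcs in one pass, so the outcome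
  is only bounded: from above by the component, from below by what is adjacent to the marks at the
  start.\<close>

lemma run_relax_all:
  assumes st: "stored s" and B: "B = set (tup k s ''e'')"
    and sound: "\<And>v. v < n \<Longrightarrow> s ''K'' v \<noteq> 0 \<Longrightarrow> v \<in> comp_of adj B c"
  shows "v < n \<Longrightarrow> run n (relax_all k) s ''K'' v \<noteq> 0 \<Longrightarrow> v \<in> comp_of adj B c"
    and "s ''K'' v \<noteq> 0 \<Longrightarrow> run n (relax_all k) s ''K'' v \<noteq> 0"
    and "s ''K'' u \<noteq> 0 \<Longrightarrow> adj u v \<Longrightarrow> v \<notin> B \<Longrightarrow> run n (relax_all k) s ''K'' v \<noteq> 0"
proof -
  \<comment> \<open>\<open>(q, q')\<close> are the two loop counters: the arcs lexicographically
    before this pair have been treated.\<close>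
  define P where "P q q' t \<longleftrightarrow> t ''adj'' = s ''adj'' \<and> t ''e'' = s ''e'' \<and>
     (\<forall>v<n. t ''K'' v \<noteq> 0 \<longrightarrow> v \<in> comp_of adj B c) \<and>
     (\<forall>v. s ''K'' v \<noteq> 0 \<longrightarrow> t ''K'' v \<noteq> 0) \<and>
     (\<forall>u v. s ''K'' u \<noteq> 0 \<longrightarrow> adj u v \<longrightarrow> v \<notin> B \<longrightarrow> u < q \<or> (u = q \<and> v < q') \<longrightarrow> t ''K'' v \<noteq> 0)"
    for q q' :: nat and t
  have P_upd: "P q q' (upd x i a t) \<longleftrightarrow> P q q' t" if "x \<notin> {''adj'', ''e'', ''K''}" for q q' x i a t
    using that by (simp add: P_def)
  have nw: "''u'' \<notin> wnames (FFor ''v'' 0 (relax k))" "''v'' \<notin> wnames (relax k)"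
    using relax_props(1)[of k] by auto
  have inner: "P (Suc q) 0 (run n (FFor ''v'' 0 (relax k)) t)" if q: "q < n" "t ''u'' 0 = q" "P q 0 t" for q t
  proof -
    have "(\<lambda>q' t. t ''u'' 0 = q \<and> P q q' t) n (run n (FFor ''v'' 0 (relax k)) t)"
    proof (rule run_for[where I="\<lambda>q' t. t ''u'' 0 = q \<and> P q q' t"])
      show "(''v'', 0) \<notin> writes (relax k)" using nw(2) by (rule not_writes)
      show "upd ''v'' 0 0 t ''u'' 0 = q \<and> P q 0 (upd ''v'' 0 0 t)" using q by (simp add: P_upd)
    next
      fix q' t assume q': "q' < n" "t ''v'' 0 = q'" "t ''u'' 0 = q \<and> P q q' t"
      have stt: "stored t" using q' st stored_cong[of s t] by (simp add: P_def)
      have e: "tup k t ''e'' = tup k s ''e''" using q' by (intro tup_cong) (simp add: P_def)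
      have K: "run n (relax k) t ''K'' = (if t ''K'' q \<noteq> 0 \<and> adj q q' \<and> q' \<notin> B then (t ''K'') (q' := 1) else t ''K'')"
        using run_relax[OF stt, of k] q' q(1) e B by simp
      have keep: "run n (relax k) t x = t x" if "x \<in> {''u'', ''adj'', ''e''}" for x
        using that relax_props(1)[of k] by (intro run_keep) auto
      have "P q (Suc q') (run n (relax k) t)"
        unfolding P_def
      proof (intro conjI allI impI)
        show "run n (relax k) t ''adj'' = s ''adj''" "run n (relax k) t ''e'' = s ''e''"
          using keep q' by (auto simp: P_def)
      next
        fix v assume v: "v < n" "run n (relax k) t ''K'' v \<noteq> 0"
        have snd: "t ''K'' v \<noteq> 0 \<Longrightarrow> v < n \<Longrightarrow> v \<in> comp_of adj B c" for v using q' unfolding P_def by blast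
        show "v \<in> comp_of adj B c"
          using v snd[of v] snd[OF _ q(1)] comp_of_step[of q adj B c q'] unfolding K by (auto split: if_splits)
      next
        fix v assume "s ''K'' v \<noteq> 0"
        then show "run n (relax k) t ''K'' v \<noteq> 0" using q' unfolding K P_def by auto
      next
        fix u v assume *: "s ''K'' u \<noteq> 0" "adj u v" "v \<notin> B" "u < q \<or> (u = q \<and> v < Suc q')"
        show "run n (relax k) t ''K'' v \<noteq> 0"
        proof (cases "u = q \<and> v = q'")
          case True
          then have "t ''K'' q \<noteq> 0" using * q' unfolding P_def by blast
          then show ?thesis using True * unfolding K by auto
        next
          case False
          then have "u < q \<or> (u = q \<and> v < q')" using *(4) by auto
          then have "t ''K'' v \<noteq> 0" using * q' unfolding P_def by blast
          then show ?thesis unfolding K by auto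
        qed
      qed
      then show "upd ''v'' 0 (Suc q') (run n (relax k) t) ''u'' 0 = q \<and>
          P q (Suc q') (upd ''v'' 0 (Suc q') (run n (relax k) t))"
        using keep[of "''u''"] q' by (simp add: P_upd)
    qed
    then have Pn: "P q n (run n (FFor ''v'' 0 (relax k)) t)" by simp
    have "u < q \<or> (u = q \<and> v < n)" if "adj u v" "u < Suc q \<or> (u = Suc q \<and> v < 0)" for u v
      using that adj_less[OF adj_sym[OF that(1)]] by auto
    then show ?thesis using Pn unfolding P_def by blast
  qed
  have "(\<lambda>q t. P q 0 t) n (run n (relax_all k) s)"
    unfolding relax_all_def
  proof (rule run_for[where I="\<lambda>q t. P q 0 t"])
    show "(''u'', 0) \<notin> writes (FFor ''v'' 0 (relax k))" using nw(1) by (rule not_writes)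
    show "P 0 0 (upd ''u'' 0 0 s)" using sound by (simp add: P_upd) (simp add: P_def)
  next
    fix q t assume "q < n" "t ''u'' 0 = q" "P q 0 t"
    then show "P (Suc q) 0 (upd ''u'' 0 (Suc q) (run n (FFor ''v'' 0 (relax k)) t))"
      using inner by (simp add: P_upd)
  qed
  then have P: "P n 0 (run n (relax_all k) s)" by simp
  show "v < n \<Longrightarrow> run n (relax_all k) s ''K'' v \<noteq> 0 \<Longrightarrow> v \<in> comp_of adj B c"
    and "s ''K'' v \<noteq> 0 \<Longrightarrow> run n (relax_all k) s ''K'' v \<noteq> 0"
    and "s ''K'' u \<noteq> 0 \<Longrightarrow> adj u v \<Longrightarrow> v \<notin> B \<Longrightarrow> run n (relax_all k) s ''K'' v \<noteq> 0"
    using P adj_less[of u v] unfolding P_def by blast+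
qed

lemma run_reach:
  assumes st: "stored s" and y: "y \<notin> {''i'', ''K'', ''p'', ''pp'', ''u'', ''v'', ''m'', ''mi'', ''f''}"
    and c: "s y 0 < n"
  shows "v < n \<Longrightarrow> run n (reach k y) s ''K'' v \<noteq> 0 \<longleftrightarrow> v \<in> comp_of adj (set (tup k s ''e'')) (s y 0)"
proof -
  let ?B = "set (tup k s ''e'')" and ?c = "s y 0"
  define R where "R = {(u, v). adj u v \<and> v \<notin> ?B}"
  let ?I0 = "\<lambda>q t. t ''adj'' = s ''adj'' \<and> t ''e'' = s ''e'' \<and> t y = s y \<and> (\<forall>i<q. t ''K'' i = 0)"
  let ?s0 = "run n (FFor ''i'' 0 (FAssign ''K'' (var ''i'') (Const 0))) s"
  have I0: "?I0 n ?s0"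
    by (rule run_for[where I="?I0"]) (use y in \<open>auto simp: upd_apply less_Suc_eq\<close>)
  let ?s1 = "upd ''K'' ?c 1 ?s0"
  define J where "J r t \<longleftrightarrow> t ''adj'' = s ''adj'' \<and> t ''e'' = s ''e'' \<and>
      (\<forall>v<n. t ''K'' v \<noteq> 0 \<longrightarrow> v \<in> comp_of adj ?B ?c) \<and>
      (\<forall>q v. q \<le> r \<longrightarrow> (?c, v) \<in> R ^^ q \<longrightarrow> t ''K'' v \<noteq> 0)" for r :: nat and t
  have J_upd: "J r (upd x i a t) \<longleftrightarrow> J r t" if "x \<notin> {''adj'', ''e'', ''K''}" for r x i a t
    using that by (simp add: J_def)
  have J1: "J 0 ?s1" using I0 comp_of_self[of ?c adj ?B] by (auto simp: J_def upd_apply split: if_splits)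
  have J_step: "J (Suc r) (run n (relax_all k) t)" if J: "J r t" for r t
  proof -
    have stt: "stored t" using J st stored_cong[of s t] by (simp add: J_def)
    have B: "?B = set (tup k t ''e'')" using J tup_cong[of s "''e''" t k] by (simp add: J_def)
    have snd: "\<And>v. v < n \<Longrightarrow> t ''K'' v \<noteq> 0 \<Longrightarrow> v \<in> comp_of adj ?B ?c" using J by (simp add: J_def)
    note rr = run_relax_all[OF stt B snd]
    have keep: "run n (relax_all k) t x = t x" if "x \<in> {''adj'', ''e''}" for x
      using that relax_all_props(1)[of k] by (intro run_keep) auto
    have "run n (relax_all k) t ''K'' v \<noteq> 0" if q: "q \<le> Suc r" "(?c, v) \<in> R ^^ q" for q v
    proof (cases "q \<le> r")
      case True
      then show ?thesis using J q(2) rr(2) unfolding J_def by blast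
    next
      case False
      then have "q = Suc r" using q(1) by simp
      then obtain u where u: "(?c, u) \<in> R ^^ r" "(u, v) \<in> R" using q(2) by auto
      then have "t ''K'' u \<noteq> 0" using J unfolding J_def by blast
      then show ?thesis using rr(3) u(2) by (simp add: R_def)
    qed
    then show ?thesis using rr(1) keep J unfolding J_def by auto
  qed
  have nw: "''pp'' \<notin> wnames (relax_all k)" "''p'' \<notin> wnames (FFor ''pp'' 0 (relax_all k))"
    using relax_all_props(1)[of k] by auto
  have "(\<lambda>q t. J (q * n) t) n (run n (FFor ''p'' 0 (FFor ''pp'' 0 (relax_all k))) ?s1)"
  proof (rule run_for[where I="\<lambda>q t. J (q * n) t"])
    show "(''p'', 0) \<notin> writes (FFor ''pp'' 0 (relax_all k))" by (rule not_writes[OF nw(2)])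
    show "J (0 * n) (upd ''p'' 0 0 ?s1)" using J1 by (simp add: J_upd)
  next
    fix q t assume q: "q < n" "t ''p'' 0 = q" "J (q * n) t"
    have "(\<lambda>q' t. J (q * n + q') t) n (run n (FFor ''pp'' 0 (relax_all k)) t)"
    proof (rule run_for[where I="\<lambda>q' t. J (q * n + q') t"])
      show "(''pp'', 0) \<notin> writes (relax_all k)" by (rule not_writes[OF nw(1)])
      show "J (q * n + 0) (upd ''pp'' 0 0 t)" using q by (simp add: J_upd)
    next
      fix q' t assume "J (q * n + q') t"
      then show "J (q * n + Suc q') (upd ''pp'' 0 (Suc q') (run n (relax_all k) t))"
        using J_step by (simp add: J_upd)
    qed
    then show "J (Suc q * n) (upd ''p'' 0 (Suc q) (run n (FFor ''pp'' 0 (relax_all k)) t))"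
      by (simp add: J_upd add.commute)
  qed
  moreover have "run n (reach k y) s = run n (FFor ''p'' 0 (FFor ''pp'' 0 (relax_all k))) ?s1"
    using I0 by (simp add: reach_def)
  ultimately have J: "J (n * n) (run n (reach k y) s)" by simp
  have sub: "R \<subseteq> {..<n} \<times> {..<n}" using adj_less adj_sym by (auto simp: R_def)
  then have fin: "finite R" by (rule finite_subset) simp
  have "card R \<le> card ({..<n} \<times> {..<n})" using sub by (intro card_mono) auto
  then have cR: "card R \<le> n * n" by simp
  assume v: "v < n"
  show "run n (reach k y) s ''K'' v \<noteq> 0 \<longleftrightarrow> v \<in> comp_of adj ?B ?c"
  proof
    assume "run n (reach k y) s ''K'' v \<noteq> 0"
    then show "v \<in> comp_of adj ?B ?c" using J v unfolding J_def by blast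
  next
    assume "v \<in> comp_of adj ?B ?c"
    then have "(?c, v) \<in> R\<^sup>*" by (simp add: comp_of_def R_def)
    then obtain q where "q \<le> card R" "(?c, v) \<in> R ^^ q"
      using rtrancl_finite_eq_relpow[OF fin] by auto
    then show "run n (reach k y) s ''K'' v \<noteq> 0" using J cR unfolding J_def by (meson le_trans)
  qed
qed

end


section \<open>Computing types\<close>

text \<open>Codes start at 1 to keep 0 for unknown entries; the bound \<open>Q\<close> turns a case
  distinction over codes into a finite program.\<close>

locale type_codes =
  fixes k Q :: nat and code :: "(nat set \<times> letter list) set \<Rightarrow> nat"
  assumes k_pos: "1 \<le> k"
    and code_range: "nice k k M \<Longrightarrow> 1 \<le> code M \<and> code M \<le> Q"
    and code_inj: "nice k k M \<Longrightarrow> nice k k M' \<Longrightarrow> code M = code M' \<Longrightarrow> M = M'"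
begin

definition decode :: "nat \<Rightarrow> (nat set \<times> letter list) set" where
  "decode p = (SOME M. nice k k M \<and> code M = p)"

lemma decode_code: "nice k k M \<Longrightarrow> decode (code M) = M"
  unfolding decode_def by (rule some_equality) (simp, metis code_inj)

lemma code_lang: "code (lang adj C a k k) \<le> Q" "1 \<le> code (lang adj C a k k)"
  using code_range[OF nice_lang] by blast+

text \<open>This and \<open>step_code\<close> are not evaluated at run time: their values for
  arguments up to \<open>Q\<close> are constants in the program text.\<close>

definition merge_code :: "nat \<Rightarrow> nat \<Rightarrow> nat" where
  "merge_code p q = code (mergeop k k (decode p) (decode q))"

definition step_code :: "nat \<Rightarrow> nat set \<Rightarrow> nat \<Rightarrow> nat" where
  "step_code j N p = code (stepop j N k k (decode p))"

definition empty_code :: nat where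
  "empty_code = code (lang (\<lambda>_ _. False) ({} :: nat set) (\<lambda>_ _. False) k k)"

definition mark :: fcom where
  "mark = reach k ''d'' ;; FFor ''i'' 0 (FIf (Cell ''K'' (var ''i'')) (FAssign ''S'' (var ''i'') (Const 1)) FSkip)"

definition merge :: fcom where
  "merge = switch (Suc Q) (var ''w'') (\<lambda>p. switch (Suc Q) (var ''q'') (\<lambda>q. assign ''w'' (Const (merge_code p q))))"

definition visit :: fcom where
  "visit = addr k ''d'' ;; assign ''q'' (Cell ''T'' (var ''a'')) ;; FIf (var ''q'') merge (assign ''o'' (Const 0)) ;; mark"

text \<open>
  Accumulates in \<open>w\<close> the type of the piece \<open>Z\<close>, one component of the graph minus the boundary \<open>e\<close> at a
  time, and clears \<open>o\<close> if the table \<open>T\<close> has no entry for some component.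
\<close>

definition gather :: fcom where
  "gather = assign ''w'' (Const empty_code) ;;
     FFor ''i'' 0 (FAssign ''S'' (var ''i'') (Const 0)) ;;
     FFor ''d'' 0 (FIf (Cell ''Z'' (var ''d'')) (FIf (Cell ''S'' (var ''d'')) FSkip visit) FSkip)"

abbreviation mark_names :: "vname set" where
  "mark_names \<equiv> {''S'', ''i'', ''K'', ''p'', ''pp'', ''u'', ''v'', ''m'', ''mi'', ''f''}"

lemma mark_wnames: "wnames mark \<subseteq> mark_names"
proof -
  have "wnames (reach k ''d'') \<subseteq> mark_names" by (rule order_trans[OF reach_wnames]) simp
  then show ?thesis by (simp add: mark_def)
qed

lemma mark_keep [simp]: "x \<notin> mark_names \<Longrightarrow> run n mark s x = s x"
  by (rule run_keep[OF contra_subsetD[OF mark_wnames]])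

lemma mark_props [simp]: "wf_loops mark" "depth mark = 5"
  by (simp_all add: mark_def)

lemma merge_wnames: "wnames merge \<subseteq> {''w''}"
  unfolding merge_def by (intro wnames_switch) simp

lemma merge_keep [simp]: "x \<noteq> ''w'' \<Longrightarrow> run n merge s x = s x"
  by (rule run_keep[OF contra_subsetD[OF merge_wnames]]) simp

lemma merge_props [simp]: "wf_loops merge" "depth merge = 0"
proof -
  show "wf_loops merge" unfolding merge_def by (intro wf_switch) simp
  have "depth merge \<le> 0" unfolding merge_def by (intro depth_switch) simp
  then show "depth merge = 0" by simp
qed

lemma run_merge: "s ''w'' 0 \<le> Q \<Longrightarrow> s ''q'' 0 \<le> Q \<Longrightarrow>
    run n merge s = upd ''w'' 0 (merge_code (s ''w'' 0) (s ''q'' 0)) s"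
  by (simp add: merge_def run_switch del: switch.simps)

abbreviation visit_names :: "vname set" where
  "visit_names \<equiv> {''a'', ''q'', ''w'', ''o'', ''S'', ''i'', ''K'', ''p'', ''pp'', ''u'', ''v'', ''m'', ''mi'', ''f''}"

lemma visit_wnames: "wnames visit \<subseteq> visit_names"
proof -
  have "wnames mark \<subseteq> visit_names" by (rule order_trans[OF mark_wnames]) simp
  moreover have "wnames (addr k ''d'') \<subseteq> visit_names" by (rule order_trans[OF addr_wnames]) simp
  moreover have "wnames merge \<subseteq> visit_names" by (rule order_trans[OF merge_wnames]) simp
  ultimately show ?thesis by (simp add: visit_def)
qed

lemma visit_keep [simp]: "x \<notin> visit_names \<Longrightarrow> run n visit s x = s x"
  by (rule run_keep[OF contra_subsetD[OF visit_wnames]])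

lemma visit_props: "wf_loops visit" "depth visit = 5"
  using addr_props(2)[of k "''d''"] by (auto simp: visit_def)

abbreviation gather_names :: "vname set" where
  "gather_names \<equiv> {''d'', ''a'', ''q'', ''w'', ''o'', ''S'', ''i'', ''K'', ''p'', ''pp'', ''u'', ''v'', ''m'', ''mi'', ''f''}"

lemma gather_wnames: "wnames gather \<subseteq> gather_names"
proof -
  have "wnames visit \<subseteq> gather_names" by (rule order_trans[OF visit_wnames]) simp
  then show ?thesis by (simp add: gather_def)
qed

lemma gather_keep [simp]: "x \<notin> gather_names \<Longrightarrow> run n gather s x = s x"
  by (rule run_keep[OF contra_subsetD[OF gather_wnames]])

lemma visit_d: "''d'' \<notin> wnames visit"
  by (rule contra_subsetD[OF visit_wnames]) simp

lemma gather_props: "wf_loops gather" "depth gather = 6"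
  using visit_props visit_d by (auto simp: gather_def not_writes)

end

locale type_program = type_codes + input_graph
begin

section \<open>Correctness of assembling the type of a piece\<close>

definition ptype :: "nat list \<Rightarrow> nat \<Rightarrow> (nat set \<times> letter list) set" where
  "ptype b c = lang adj (comp_of adj (set b) c) (slot_adj adj b) k k"

definition sound_at :: "store \<Rightarrow> nat list \<Rightarrow> nat \<Rightarrow> bool" where
  "sound_at s b c \<longleftrightarrow> s ''T'' (enc n (b @ [c])) = 0 \<or> s ''T'' (enc n (b @ [c])) = code (ptype b c)"

lemma run_mark:
  assumes st: "stored s" and d: "s ''d'' 0 < n" and v: "v < n"
  shows "run n mark s ''S'' v \<noteq> 0 \<longleftrightarrow> s ''S'' v \<noteq> 0 \<or> v \<in> comp_of adj (set (tup k s ''e'')) (s ''d'' 0)"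
proof -
  let ?s = "run n (reach k ''d'') s"
  let ?I = "\<lambda>q t. t ''K'' = ?s ''K'' \<and> (\<forall>v. t ''S'' v \<noteq> 0 \<longleftrightarrow> s ''S'' v \<noteq> 0 \<or> (v < q \<and> ?s ''K'' v \<noteq> 0))"
  have "?I n (run n (FFor ''i'' 0 (FIf (Cell ''K'' (var ''i'')) (FAssign ''S'' (var ''i'') (Const 1)) FSkip)) ?s)"
    by (rule run_for[where I="?I"]) (auto simp: upd_apply less_Suc_eq)
  then show ?thesis using run_reach[OF st _ d v] v by (simp add: mark_def)
qed

lemma run_visit:
  assumes st: "stored s" and d: "s ''d'' 0 < n" and A: "A = enc n (tup k s ''e'' @ [s ''d'' 0])"
  shows "v < n \<Longrightarrow> run n visit s ''S'' v \<noteq> 0 \<longleftrightarrow>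
      s ''S'' v \<noteq> 0 \<or> v \<in> comp_of adj (set (tup k s ''e'')) (s ''d'' 0)"
    and "s ''T'' A = 0 \<Longrightarrow> run n visit s ''o'' 0 = 0"
    and "s ''T'' A \<noteq> 0 \<Longrightarrow> run n visit s ''o'' 0 = s ''o'' 0"
    and "s ''T'' A \<noteq> 0 \<Longrightarrow> s ''T'' A \<le> Q \<Longrightarrow> s ''w'' 0 \<le> Q \<Longrightarrow>
      run n visit s ''w'' 0 = merge_code (s ''w'' 0) (s ''T'' A)"
proof -
  let ?s1 = "run n (addr k ''d'') s"
  let ?s2 = "upd ''q'' 0 (s ''T'' A) ?s1"
  let ?s3 = "run n (FIf (var ''q'') merge (assign ''o'' (Const 0))) ?s2"
  have a: "?s1 ''a'' 0 = A" using A by simp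
  have v: "run n visit s = run n mark ?s3" using a by (simp add: visit_def)
  have keep: "?s3 x = s x" if "x \<in> {''adj'', ''e'', ''d'', ''S''}" for x using that by auto
  have adj3: "?s3 ''adj'' = s ''adj''" by (rule keep) simp
  have st3: "stored ?s3" using st unfolding stored_def adj3 .
  have tup3: "tup k ?s3 ''e'' = tup k s ''e''" by (rule tup_cong) (rule keep, simp)
  show "v < n \<Longrightarrow> run n visit s ''S'' v \<noteq> 0 \<longleftrightarrow>
      s ''S'' v \<noteq> 0 \<or> v \<in> comp_of adj (set (tup k s ''e'')) (s ''d'' 0)"
    using run_mark[OF st3, of v] d keep[of "''d''"] keep[of "''S''"] unfolding v tup3 by simp
  show "s ''T'' A = 0 \<Longrightarrow> run n visit s ''o'' 0 = 0" unfolding v by simp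
  show "s ''T'' A \<noteq> 0 \<Longrightarrow> run n visit s ''o'' 0 = s ''o'' 0" unfolding v by simp
  show "s ''T'' A \<noteq> 0 \<Longrightarrow> s ''T'' A \<le> Q \<Longrightarrow> s ''w'' 0 \<le> Q \<Longrightarrow>
      run n visit s ''w'' 0 = merge_code (s ''w'' 0) (s ''T'' A)"
    unfolding v by (simp add: run_merge)
qed

lemma comp_less: "d < n \<Longrightarrow> comp_of adj B d \<subseteq> {..<n}"
  using comp_of_subset[of d "{..<n}" adj B] adj_less adj_sym by blast

lemma merge_code_lang:
  assumes "C1 \<subseteq> {..<n}" "C2 \<subseteq> {..<n}" "C1 \<inter> C2 = {}" "\<And>u v. u \<in> C1 \<Longrightarrow> v \<in> C2 \<Longrightarrow> \<not> adj u v"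
  shows "merge_code (code (lang adj C1 a k k)) (code (lang adj C2 a k k)) = code (lang adj (C1 \<union> C2) a k k)"
proof -
  have "lang adj (C1 \<union> C2) a k k = mergeop k k (lang adj C1 a k k) (lang adj C2 a k k)"
    by (rule lang_merge) (use assms adj_sym finite_subset in blast)+
  then show ?thesis by (simp add: merge_code_def decode_code nice_lang)
qed

text \<open>\<open>U q\<close> is the part of \<open>Z\<close> covered by the components of its
  vertices below \<open>q\<close>. The marks \<open>S\<close> describe it, so every component is
  merged only once; distinct components are disjoint and not adjacent, as
  \<open>merge_code_lang\<close> demands. After a missing entry nothing is claimed about
  \<open>w\<close>.\<close>

lemma run_gather:
  assumes st: "stored s" and o: "s ''o'' 0 \<noteq> 0"
    and b: "b = tup k s ''e''" and Z: "Z = {v. v < n \<and> s ''Z'' v \<noteq> 0}"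
    and ZB: "Z \<inter> set b = {}" and closed: "\<And>d. d \<in> Z \<Longrightarrow> comp_of adj (set b) d \<subseteq> Z"
    and sound: "\<And>d. d \<in> Z \<Longrightarrow> sound_at s b d"
  shows "run n gather s ''o'' 0 \<noteq> 0 \<Longrightarrow> run n gather s ''w'' 0 = code (lang adj Z (slot_adj adj b) k k)"
    and "run n gather s ''o'' 0 = 0 \<Longrightarrow> \<exists>d\<in>Z. s ''T'' (enc n (b @ [d])) = 0"
proof -
  define U where "U q = (\<Union>d\<in>{d\<in>Z. d < q}. comp_of adj (set b) d)" for q :: nat
  have UZ: "U q \<subseteq> Z" for q using closed by (auto simp: U_def)
  have Zn: "Z \<subseteq> {..<n}" using Z by auto
  define P where "P q t \<longleftrightarrow> (\<forall>x\<in>{''adj'', ''e'', ''T'', ''Z''}. t x = s x) \<and>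
      (\<forall>v<n. t ''S'' v \<noteq> 0 \<longleftrightarrow> v \<in> U q) \<and>
      (t ''o'' 0 \<noteq> 0 \<longrightarrow> t ''w'' 0 = code (lang adj (U q) (slot_adj adj b) k k)) \<and>
      (t ''o'' 0 = 0 \<longrightarrow> (\<exists>d\<in>Z. s ''T'' (enc n (b @ [d])) = 0))" for q t
  have P_upd: "P q (upd ''d'' i a t) \<longleftrightarrow> P q t" for q i a t by (simp add: P_def)
  let ?s1 = "upd ''w'' 0 empty_code s"
  let ?I0 = "\<lambda>q t. (\<forall>x\<in>{''adj'', ''e'', ''T'', ''Z'', ''o'', ''w''}. t x = ?s1 x) \<and> (\<forall>v<q. t ''S'' v = 0)"
  let ?s2 = "run n (FFor ''i'' 0 (FAssign ''S'' (var ''i'') (Const 0))) ?s1"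
  have "?I0 n ?s2"
    by (rule run_for[where I="?I0"]) (auto simp: upd_apply less_Suc_eq)
  moreover have "empty_code = code (lang adj (U 0) (slot_adj adj b) k k)"
    by (simp add: empty_code_def U_def lang_empty)
  ultimately have P0: "P 0 ?s2" using o by (auto simp: P_def U_def)
  let ?body = "FIf (Cell ''Z'' (var ''d'')) (FIf (Cell ''S'' (var ''d'')) FSkip visit) FSkip"
  have step: "P (Suc q) (run n ?body t)" if q: "q < n" "t ''d'' 0 = q" "P q t" for q t
  proof -
    have keep: "\<And>x. x \<in> {''adj'', ''e'', ''T'', ''Z''} \<Longrightarrow> t x = s x"
      and S: "\<And>v. v < n \<Longrightarrow> t ''S'' v \<noteq> 0 \<longleftrightarrow> v \<in> U q"
      using q(3) unfolding P_def by blast+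
    have tz: "t ''Z'' q \<noteq> 0 \<longleftrightarrow> q \<in> Z" using keep[of "''Z''"] Z q(1) by simp
    have U_Suc: "U (Suc q) = U q \<union> (if q \<in> Z then comp_of adj (set b) q else {})"
      by (auto simp: U_def less_Suc_eq)
    consider "q \<notin> Z" | "q \<in> Z" "q \<in> U q" | "q \<in> Z" "q \<notin> U q" by blast
    then show ?thesis
    proof cases
      case 1
      then have "U (Suc q) = U q" "run n ?body t = t" using U_Suc tz q(2) by auto
      then show ?thesis using q(3) by (simp add: P_def)
    next
      case 2
      then obtain d where d: "d \<in> Z" "q \<in> comp_of adj (set b) d" "d < q" by (auto simp: U_def)
      then have "comp_of adj (set b) q \<subseteq> U q" using comp_of_mono[OF d(2)] by (auto simp: U_def)
      then have "U (Suc q) = U q" using U_Suc by auto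
      moreover have "run n ?body t = t" using 2 tz q(1,2) S[OF q(1)] by simp
      ultimately show ?thesis using q(3) by (simp add: P_def)
    next
      case 3
      have r: "run n ?body t = run n visit t" using 3 tz q(1,2) S[OF q(1)] by simp
      have stt: "stored t" using keep[of "''adj''"] st stored_cong[of s t] by simp
      have tb: "tup k t ''e'' = b" using b keep[of "''e''"] tup_cong[of t "''e''" s k] by simp
      let ?A = "enc n (b @ [q])"
      have A: "?A = enc n (tup k t ''e'' @ [t ''d'' 0])" using tb q(2) by simp
      have dn: "t ''d'' 0 < n" using q(1,2) by simp
      note rv = run_visit[OF stt dn A]
      have U': "U (Suc q) = U q \<union> comp_of adj (set b) q" using U_Suc 3 by simp
      have tT: "t ''T'' ?A = s ''T'' ?A" using keep[of "''T''"] by simp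
      have "P (Suc q) (run n visit t)"
        unfolding P_def
      proof (intro conjI ballI allI impI)
        fix x assume x: "x \<in> {''adj'', ''e'', ''T'', ''Z''}"
        then have "run n visit t x = t x" by (intro visit_keep) auto
        then show "run n visit t x = s x" using keep x by simp
      next
        fix v assume "v < n"
        then show "run n visit t ''S'' v \<noteq> 0 \<longleftrightarrow> v \<in> U (Suc q)"
          using rv(1)[of v] S[of v] q(2) unfolding U' tb by simp
      next
        assume o: "run n visit t ''o'' 0 \<noteq> 0"
        have Tn: "t ''T'' ?A \<noteq> 0"
        proof
          assume "t ''T'' ?A = 0"
          then have "run n visit t ''o'' 0 = 0" by (rule rv(2))
          with o show False by contradiction
        qed
        have "t ''o'' 0 \<noteq> 0" using rv(3) o Tn by simp
        then have w: "t ''w'' 0 = code (lang adj (U q) (slot_adj adj b) k k)" using q(3) unfolding P_def by blast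
        have T: "t ''T'' ?A = code (lang adj (comp_of adj (set b) q) (slot_adj adj b) k k)"
          using sound[OF 3(1)] Tn tT unfolding sound_at_def ptype_def by simp
        have "run n visit t ''w'' 0 = merge_code (t ''w'' 0) (t ''T'' ?A)"
          by (rule rv(4)[OF Tn]) (simp_all only: w T code_lang)
        also have "\<dots> = code (lang adj (U (Suc q)) (slot_adj adj b) k k)"
          unfolding w T U'
        proof (rule merge_code_lang)
          show "U q \<subseteq> {..<n}" using UZ Zn by blast
          show "comp_of adj (set b) q \<subseteq> {..<n}" using comp_less q(1) by blast
          have qb: "q \<notin> set b" using ZB 3 by blast
          have sep: "v \<notin> comp_of adj (set b) q" if vU: "v \<in> U q" for v
          proof
            assume v: "v \<in> comp_of adj (set b) q"
            obtain d where d: "d \<in> Z" "d < q" "v \<in> comp_of adj (set b) d" using vU by (auto simp: U_def)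
            have "d \<notin> set b" using ZB d by blast
            then have "comp_of adj (set b) d = comp_of adj (set b) q"
              using comp_of_eq[OF adj_sym d(3)] comp_of_eq[OF adj_sym v qb] by simp
            then have "q \<in> U q" using comp_of_self[of q adj "set b"] d by (auto simp: U_def)
            then show False using 3 by simp
          qed
          then show "U q \<inter> comp_of adj (set b) q = {}" by blast
          fix u v assume u: "u \<in> U q" and v: "v \<in> comp_of adj (set b) q"
          show "\<not> adj u v"
          proof
            assume "adj u v"
            moreover have "v \<notin> set b" by (rule comp_of_avoid[OF v qb])
            ultimately have "v \<in> U q" using u comp_of_step by (fastforce simp: U_def)
            then show False using sep v by blast
          qed
        qed
        finally show "run n visit t ''w'' 0 = code (lang adj (U (Suc q)) (slot_adj adj b) k k)" .
      next
        assume o: "run n visit t ''o'' 0 = 0"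
        show "\<exists>d\<in>Z. s ''T'' (enc n (b @ [d])) = 0"
        proof (cases "t ''T'' ?A = 0")
          case True
          then show ?thesis using 3 tT by auto
        next
          case False
          then have "t ''o'' 0 = 0" using rv(3) o by simp
          then show ?thesis using q(3) unfolding P_def by blast
        qed
      qed
      then show ?thesis using r by simp
    qed
  qed
  have "P n (run n (FFor ''d'' 0 ?body) ?s2)"
  proof (rule run_for[where I=P])
    show "(''d'', 0) \<notin> writes ?body" by (rule not_writes) (use visit_d in simp)
    show "P 0 (upd ''d'' 0 0 ?s2)" using P0 P_upd by simp
  next
    fix q t assume "q < n" "t ''d'' 0 = q" "P q t"
    then show "P (Suc q) (upd ''d'' 0 (Suc q) (run n ?body t))" unfolding P_upd by (rule step)
  qed
  moreover have "run n gather s = run n (FFor ''d'' 0 ?body) ?s2" by (simp add: gather_def)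
  ultimately have P: "P n (run n gather s)" by simp
  have "U n = Z"
    using UZ[of n] Zn comp_of_self[of _ adj "set b"] by (auto simp: U_def)
  then show "run n gather s ''o'' 0 \<noteq> 0 \<Longrightarrow> run n gather s ''w'' 0 = code (lang adj Z (slot_adj adj b) k k)"
    and "run n gather s ''o'' 0 = 0 \<Longrightarrow> \<exists>d\<in>Z. s ''T'' (enc n (b @ [d])) = 0"
    using P unfolding P_def by auto
qed

end


section \<open>The program\<close>

text \<open>A decision tree over the flags \<open>g\<close> that collects the set of flagged slots;
  with a leaf for each set, the constants of the program may depend on that set.\<close>

primrec branch :: "nat \<Rightarrow> (nat set \<Rightarrow> fcom) \<Rightarrow> nat set \<Rightarrow> fcom" where
  "branch 0 f N = f N"
| "branch (Suc i) f N = FIf (Cell ''g'' (Const i)) (branch i f (insert i N)) (branch i f N)"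

lemma wnames_branch: "(\<And>N. wnames (f N) \<subseteq> X) \<Longrightarrow> wnames (branch i f N) \<subseteq> X"
  by (induction i arbitrary: N) auto

lemma wf_branch: "(\<And>N. wf_loops (f N)) \<Longrightarrow> wf_loops (branch i f N)"
  by (induction i arbitrary: N) auto

lemma depth_branch: "(\<And>N. depth (f N) \<le> d) \<Longrightarrow> depth (branch i f N) \<le> d"
  by (induction i arbitrary: N) auto

lemma run_branch: "run n (branch i f N) s = run n (f (N \<union> {l. l < i \<and> s ''g'' l \<noteq> 0})) s"
proof (induction i arbitrary: N)
  case (Suc i)
  have "{l. l < Suc i \<and> s ''g'' l \<noteq> 0} = {l. l < i \<and> s ''g'' l \<noteq> 0} \<union> (if s ''g'' i \<noteq> 0 then {i} else {})"
    by (auto simp: less_Suc_eq)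
  then show ?case using Suc by (auto simp: Un_assoc insert_commute)
qed simp

primrec nest :: "nat \<Rightarrow> fcom \<Rightarrow> fcom" where
  "nest 0 c = c"
| "nest (Suc i) c = FFor ''b'' i (nest i c)"

lemma wnames_nest: "wnames (nest i c) \<subseteq> insert ''b'' (wnames c)"
  by (induction i) auto

lemma writes_nest: "(''b'', j) \<in> writes (nest i c) \<Longrightarrow> ''b'' \<notin> wnames c \<Longrightarrow> j < i"
  by (induction i) (auto simp: not_writes less_Suc_eq)

lemma wf_nest: "''b'' \<notin> wnames c \<Longrightarrow> wf_loops c \<Longrightarrow> wf_loops (nest i c)"
  by (induction i) (auto dest: writes_nest)

lemma depth_nest: "depth (nest i c) = i + depth c"
  by (induction i) auto

text \<open>\<open>G\<close> is an invariant, and \<open>D \<tau>\<close> expresses that tuple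
  \<open>\<tau>\<close> has been dealt with, which is never undone. The inner \<open>i\<close> loops
  reach exactly the tuples that agree with the current array \<open>b\<close> from index
  \<open>i\<close> on.\<close>

lemma run_nest:
  assumes b: "''b'' \<notin> wnames c"
    and G: "\<And>i a s. G (upd ''b'' i a s) \<longleftrightarrow> G s" and D: "\<And>\<tau> i a s. D \<tau> (upd ''b'' i a s) \<longleftrightarrow> D \<tau> s"
    and body: "\<And>s. G s \<Longrightarrow> (\<And>l. l < k \<Longrightarrow> s ''b'' l < n) \<Longrightarrow>
      G (run n c s) \<and> (\<forall>\<tau>. D \<tau> s \<longrightarrow> D \<tau> (run n c s)) \<and> D (tup k s ''b'') (run n c s)"
  shows "i \<le> k \<Longrightarrow> G s \<Longrightarrow> (\<And>l. i \<le> l \<Longrightarrow> l < k \<Longrightarrow> s ''b'' l < n) \<Longrightarrow>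
    G (run n (nest i c) s) \<and> (\<forall>\<tau>. D \<tau> s \<longrightarrow> D \<tau> (run n (nest i c) s)) \<and>
    (\<forall>\<tau>. length \<tau> = k \<longrightarrow> set \<tau> \<subseteq> {..<n} \<longrightarrow> (\<forall>l. i \<le> l \<longrightarrow> l < k \<longrightarrow> \<tau> ! l = s ''b'' l) \<longrightarrow> D \<tau> (run n (nest i c) s))"
proof (induction i arbitrary: s)
  case 0
  have eq: "\<tau> = tup k s ''b''" if "length \<tau> = k" "\<forall>l. 0 \<le> l \<longrightarrow> l < k \<longrightarrow> \<tau> ! l = s ''b'' l" for \<tau>
    using that by (intro nth_equalityI) auto
  have lt: "\<And>l. l < k \<Longrightarrow> s ''b'' l < n" using 0(3) by simp
  note B = body[OF 0(2) lt]
  show ?case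
  proof (intro conjI allI impI)
    show "G (run n (nest 0 c) s)" using B by simp
    show "D \<tau> (run n (nest 0 c) s)" if "D \<tau> s" for \<tau> using B that by simp
    show "D \<tau> (run n (nest 0 c) s)"
      if "length \<tau> = k" "\<forall>l. 0 \<le> l \<longrightarrow> l < k \<longrightarrow> \<tau> ! l = s ''b'' l" for \<tau>
      using B eq[OF that] by simp
  qed
next
  case (Suc i)
  let ?I = "\<lambda>q t. G t \<and> (\<forall>l. Suc i \<le> l \<longrightarrow> l < k \<longrightarrow> t ''b'' l = s ''b'' l) \<and> (\<forall>\<tau>. D \<tau> s \<longrightarrow> D \<tau> t) \<and>
    (\<forall>\<tau>. length \<tau> = k \<longrightarrow> set \<tau> \<subseteq> {..<n} \<longrightarrow> (\<forall>l. Suc i \<le> l \<longrightarrow> l < k \<longrightarrow> \<tau> ! l = s ''b'' l) \<longrightarrow> \<tau> ! i < q \<longrightarrow> D \<tau> t)"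
  have "?I n (run n (FFor ''b'' i (nest i c)) s)"
  proof (rule run_for[where I="?I"])
    show "(''b'', i) \<notin> writes (nest i c)" using writes_nest[OF _ b] by blast
    show "?I 0 (upd ''b'' i 0 s)" using Suc.prems G D by simp
  next
    fix q t assume q: "q < n" "t ''b'' i = q" and I: "?I q t"
    let ?t = "run n (nest i c) t"
    have lt: "t ''b'' l < n" if "i \<le> l" "l < k" for l
      using that q I Suc.prems(3)[of l] by (cases "l = i") auto
    have IH: "G ?t" "\<And>\<tau>. D \<tau> t \<Longrightarrow> D \<tau> ?t"
      "\<And>\<tau>. length \<tau> = k \<Longrightarrow> set \<tau> \<subseteq> {..<n} \<Longrightarrow> (\<And>l. i \<le> l \<Longrightarrow> l < k \<Longrightarrow> \<tau> ! l = t ''b'' l) \<Longrightarrow> D \<tau> ?t"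
      using Suc.IH[of t] lt I Suc.prems(1) by auto
    have fr: "?t ''b'' l = t ''b'' l" if "i \<le> l" for l
      using writes_nest[OF _ b, of l i] that by (intro run_frame) auto
    have "D \<tau> ?t" if \<tau>: "length \<tau> = k" "set \<tau> \<subseteq> {..<n}" "\<forall>l. Suc i \<le> l \<longrightarrow> l < k \<longrightarrow> \<tau> ! l = s ''b'' l" "\<tau> ! i < Suc q" for \<tau>
    proof (cases "\<tau> ! i < q")
      case True
      then show ?thesis using I \<tau> IH(2) by blast
    next
      case False
      then have ti: "\<tau> ! i = q" using \<tau>(4) by simp
      show ?thesis
      proof (rule IH(3)[OF \<tau>(1,2)])
        fix l assume l: "i \<le> l" "l < k"
        show "\<tau> ! l = t ''b'' l"
          using ti q \<tau>(3) I l by (cases "l = i") auto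
      qed
    qed
    then show "?I (Suc q) (upd ''b'' i (Suc q) ?t)"
      using IH(1,2) I fr G D by simp
  qed
  then have I: "?I n (run n (nest (Suc i) c) s)" by simp
  have "D \<tau> (run n (nest (Suc i) c) s)"
    if \<tau>: "length \<tau> = k" "set \<tau> \<subseteq> {..<n}" "\<forall>l. Suc i \<le> l \<longrightarrow> l < k \<longrightarrow> \<tau> ! l = s ''b'' l" for \<tau>
  proof -
    have "\<tau> ! i \<in> set \<tau>" using \<tau>(1) Suc.prems(1) by (intro nth_mem) simp
    then have "\<tau> ! i < n" using \<tau>(2) by auto
    then show ?thesis using I \<tau> by blast
  qed
  then show ?case using I by blast
qed

context type_codes
begin

definition copy :: fcom where
  "copy = unroll k (\<lambda>j. FAssign ''e'' (Const j) (Cell ''b'' (Const j)))"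

definition slotc :: "nat \<Rightarrow> vname \<Rightarrow> fcom" where
  "slotc l y = mul ''b'' l ;; assign ''h'' (Cell ''adj'' (Plus (var ''m'') (var y))) ;;
     unroll l (\<lambda>i. FIf (neq (Cell ''b'' (Const i)) (Cell ''b'' (Const l))) FSkip (assign ''h'' (Const 0)))"

definition droppable :: "nat \<Rightarrow> fcom" where
  "droppable j = assign ''o'' (Const 1) ;;
     FFor ''u'' 0 (FIf (Cell ''C'' (var ''u'')) (slotc j ''u'' ;; FIf (var ''h'') (assign ''o'' (Const 0)) FSkip) FSkip)"

definition prepare :: "nat \<Rightarrow> fcom" where
  "prepare j = copy ;; FAssign ''e'' (Const j) (var ''x'') ;;
     FFor ''i'' 0 (FAssign ''Z'' (var ''i'') (Cell ''C'' (var ''i''))) ;; FAssign ''Z'' (var ''x'') (Const 0)"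

definition neighbours :: fcom where
  "neighbours = unroll k (\<lambda>l. slotc l ''x'' ;; FAssign ''g'' (Const l) (var ''h''))"

definition enter :: "nat \<Rightarrow> fcom" where
  "enter j = branch k (\<lambda>N. switch (Suc Q) (var ''w'') (\<lambda>p. FAssign ''T'' (var ''a'') (Const (step_code j N p)))) {}"

text \<open>After \<open>gather\<close> the array \<open>e\<close> still holds the modified tuple;
  the second \<open>copy\<close> restores the original one, so that \<open>addr\<close> yields the
  entry to be written.\<close>

definition cand :: "nat \<Rightarrow> fcom" where
  "cand j = droppable j ;; FIf (var ''o'')
     (prepare j ;; gather ;; FIf (var ''o'') (neighbours ;; copy ;; addr k ''c'' ;; enter j) FSkip) FSkip"

definition cell :: fcom where
  "cell = copy ;; memb k ''c'' ;; FIf (var ''f'') FSkip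
     (reach k ''c'' ;; FFor ''i'' 0 (FAssign ''C'' (var ''i'') (Cell ''K'' (var ''i''))) ;;
      FFor ''x'' 0 (FIf (Cell ''C'' (var ''x'')) (unroll k cand) FSkip))"

definition table :: fcom where
  "table = FFor ''rd'' 0 (nest k (FFor ''c'' 0 cell))"

text \<open>All slots repeat the root. By the convention of \<open>slot_adj\<close> only slot 0 is
  then in use, as \<open>accepting\<close> expects, and the others are free.\<close>

definition try_root :: fcom where
  "try_root = unroll k (\<lambda>j. FAssign ''e'' (Const j) (var ''r'')) ;;
     FFor ''i'' 0 (FAssign ''Z'' (var ''i'') (Const 1)) ;; FAssign ''Z'' (var ''r'') (Const 0) ;;
     assign ''o'' (Const 1) ;; gather ;;
     FIf (var ''o'')
       (switch (Suc Q) (var ''w'') (\<lambda>p. if accepting k (decode p) then assign ''answer'' (Const 1) else FSkip)) FSkip"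

definition program :: fcom where
  "program = table ;; FFor ''r'' 0 try_root"

section \<open>Written cells and nesting depths of the program parts\<close>

lemma copy_wnames: "wnames copy \<subseteq> {''e''}"
  unfolding copy_def by (rule wnames_unroll) simp

lemma copy_keep [simp]: "x \<noteq> ''e'' \<Longrightarrow> run n copy s x = s x"
  by (rule run_keep[OF contra_subsetD[OF copy_wnames]]) simp

lemma copy_props [simp]: "wf_loops copy" "depth copy = 0"
proof -
  show "wf_loops copy" unfolding copy_def by (rule wf_unroll) simp
  have "depth copy \<le> 0" unfolding copy_def by (rule depth_unroll) simp
  then show "depth copy = 0" by simp
qed

lemma run_copy [simp]: "tup k (run n copy s) ''e'' = tup k s ''b''"
proof -
  let ?I = "\<lambda>j t. t ''b'' = s ''b'' \<and> (\<forall>i<j. t ''e'' i = s ''b'' i)"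
  have "?I k (run n copy s)"
    unfolding copy_def by (rule run_unroll[where I="?I"]) (auto simp: upd_apply less_Suc_eq)
  then show ?thesis by (simp add: tup_def)
qed

lemma slotc_wnames: "wnames (slotc l y) \<subseteq> {''m'', ''mi'', ''h''}"
proof -
  have "wnames (unroll l (\<lambda>i. FIf (neq (Cell ''b'' (Const i)) (Cell ''b'' (Const l))) FSkip (assign ''h'' (Const 0)))) \<subseteq> {''m'', ''mi'', ''h''}"
    by (rule wnames_unroll) simp
  then show ?thesis by (simp add: slotc_def)
qed

lemma slotc_keep [simp]: "x \<notin> {''m'', ''mi'', ''h''} \<Longrightarrow> run n (slotc l y) s x = s x"
  by (rule run_keep[OF contra_subsetD[OF slotc_wnames]])

lemma slotc_props [simp]: "wf_loops (slotc l y)" "depth (slotc l y) = 1"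
proof -
  show "wf_loops (slotc l y)" by (auto simp: slotc_def intro!: wf_unroll)
  have "depth (unroll l (\<lambda>i. FIf (neq (Cell ''b'' (Const i)) (Cell ''b'' (Const l))) FSkip (assign ''h'' (Const 0)))) \<le> 0"
    by (rule depth_unroll) simp
  then show "depth (slotc l y) = 1" by (simp add: slotc_def)
qed

lemma droppable_wnames: "wnames (droppable j) \<subseteq> {''o'', ''u'', ''m'', ''mi'', ''h''}"
proof -
  have "wnames (slotc j ''u'') \<subseteq> {''o'', ''u'', ''m'', ''mi'', ''h''}"
    by (rule order_trans[OF slotc_wnames]) simp
  then show ?thesis by (simp add: droppable_def)
qed

lemma droppable_keep [simp]: "x \<notin> {''o'', ''u'', ''m'', ''mi'', ''h''} \<Longrightarrow> run n (droppable j) s x = s x"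
  by (rule run_keep[OF contra_subsetD[OF droppable_wnames]])

lemma slotc_u: "''u'' \<notin> wnames (slotc j y)"
  by (rule contra_subsetD[OF slotc_wnames]) simp

lemma droppable_props [simp]: "wf_loops (droppable j)" "depth (droppable j) = 2"
  using slotc_u by (auto simp: droppable_def not_writes)

lemma prepare_wnames: "wnames (prepare j) \<subseteq> {''e'', ''i'', ''Z''}"
proof -
  have "wnames copy \<subseteq> {''e'', ''i'', ''Z''}" by (rule order_trans[OF copy_wnames]) simp
  then show ?thesis by (simp add: prepare_def)
qed

lemma prepare_keep [simp]: "x \<notin> {''e'', ''i'', ''Z''} \<Longrightarrow> run n (prepare j) s x = s x"
  by (rule run_keep[OF contra_subsetD[OF prepare_wnames]])

lemma prepare_props [simp]: "wf_loops (prepare j)" "depth (prepare j) = 1"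
  by (auto simp: prepare_def)

lemma run_prepare:
  assumes "j < k" "s ''x'' 0 < n"
  shows "tup k (run n (prepare j) s) ''e'' = (tup k s ''b'')[j := s ''x'' 0]"
    and "v < n \<Longrightarrow> run n (prepare j) s ''Z'' v \<noteq> 0 \<longleftrightarrow> s ''C'' v \<noteq> 0 \<and> v \<noteq> s ''x'' 0"
proof -
  let ?s1 = "upd ''e'' j (s ''x'' 0) (run n copy s)"
  let ?I = "\<lambda>q t. t ''e'' = ?s1 ''e'' \<and> t ''C'' = s ''C'' \<and> t ''x'' = s ''x'' \<and> (\<forall>i<q. t ''Z'' i = s ''C'' i)"
  let ?s2 = "run n (FFor ''i'' 0 (FAssign ''Z'' (var ''i'') (Cell ''C'' (var ''i'')))) ?s1"
  have I: "?I n ?s2"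
    by (rule run_for[where I="?I"]) (auto simp: upd_apply less_Suc_eq)
  have r: "run n (prepare j) s = upd ''Z'' (s ''x'' 0) 0 ?s2" using I by (simp add: prepare_def)
  have "run n copy s ''e'' i = s ''b'' i" if "i < k" for i
    using run_copy[of n s] that by (metis tup_simps(2))
  then have "?s2 ''e'' i = (if i = j then s ''x'' 0 else s ''b'' i)" if "i < k" for i
    using I that by (simp add: upd_apply)
  then show "tup k (run n (prepare j) s) ''e'' = (tup k s ''b'')[j := s ''x'' 0]"
    unfolding r by (intro nth_equalityI) (auto simp: nth_list_update)
  show "v < n \<Longrightarrow> run n (prepare j) s ''Z'' v \<noteq> 0 \<longleftrightarrow> s ''C'' v \<noteq> 0 \<and> v \<noteq> s ''x'' 0"
    unfolding r using I by (simp add: upd_apply)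
qed

lemma neighbours_wnames: "wnames neighbours \<subseteq> {''m'', ''mi'', ''h'', ''g''}"
proof -
  have "wnames (slotc l ''x'') \<subseteq> {''m'', ''mi'', ''h'', ''g''}" for l
    by (rule order_trans[OF slotc_wnames]) simp
  then show ?thesis unfolding neighbours_def by (intro wnames_unroll) simp
qed

lemma neighbours_keep [simp]: "x \<notin> {''m'', ''mi'', ''h'', ''g''} \<Longrightarrow> run n neighbours s x = s x"
  by (rule run_keep[OF contra_subsetD[OF neighbours_wnames]])

lemma neighbours_props [simp]: "wf_loops neighbours" "depth neighbours \<le> 1"
  by (auto simp: neighbours_def intro!: wf_unroll depth_unroll)

lemma enter_wnames: "wnames (enter j) \<subseteq> {''T''}"
  unfolding enter_def by (intro wnames_branch wnames_switch) simp

lemma enter_keep [simp]: "x \<noteq> ''T'' \<Longrightarrow> run n (enter j) s x = s x"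
  by (rule run_keep[OF contra_subsetD[OF enter_wnames]]) simp

lemma enter_props [simp]: "wf_loops (enter j)" "depth (enter j) = 0"
proof -
  show "wf_loops (enter j)" unfolding enter_def by (intro wf_branch wf_switch) simp
  have "depth (enter j) \<le> 0" unfolding enter_def by (intro depth_branch depth_switch) simp
  then show "depth (enter j) = 0" by simp
qed

lemma run_enter: "s ''w'' 0 \<le> Q \<Longrightarrow>
    run n (enter j) s = upd ''T'' (s ''a'' 0) (step_code j {l. l < k \<and> s ''g'' l \<noteq> 0} (s ''w'' 0)) s"
  by (simp add: enter_def run_branch run_switch del: switch.simps)

abbreviation cand_names :: "vname set" where
  "cand_names \<equiv> {''T'', ''g'', ''h'', ''e'', ''Z'', ''d'', ''a'', ''q'', ''w'', ''o'', ''S'', ''i'', ''K'', ''p'', ''pp'',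
     ''u'', ''v'', ''m'', ''mi'', ''f''}"

lemma cand_wnames: "wnames (cand j) \<subseteq> cand_names"
proof -
  have "wnames (droppable j) \<subseteq> cand_names" by (rule order_trans[OF droppable_wnames]) simp
  moreover have "wnames (prepare j) \<subseteq> cand_names" by (rule order_trans[OF prepare_wnames]) simp
  moreover have "wnames gather \<subseteq> cand_names" by (rule order_trans[OF gather_wnames]) simp
  moreover have "wnames neighbours \<subseteq> cand_names" by (rule order_trans[OF neighbours_wnames]) simp
  moreover have "wnames copy \<subseteq> cand_names" by (rule order_trans[OF copy_wnames]) simp
  moreover have "wnames (addr k ''c'') \<subseteq> cand_names" by (rule order_trans[OF addr_wnames]) simp
  moreover have "wnames (enter j) \<subseteq> cand_names" by (rule order_trans[OF enter_wnames]) simp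
  ultimately show ?thesis unfolding cand_def wnames_simps by (intro Un_least empty_subsetI)
qed

lemma cand_keep [simp]: "x \<notin> cand_names \<Longrightarrow> run n (cand j) s x = s x"
  by (rule run_keep[OF contra_subsetD[OF cand_wnames]])

lemma cand_props: "wf_loops (cand j)" "depth (cand j) \<le> 6"
proof -
  show "wf_loops (cand j)" by (simp add: cand_def gather_props)
  have "depth neighbours \<le> 1" "depth (addr k ''c'') \<le> 1" by (rule neighbours_props(2), rule addr_props(2))
  then show "depth (cand j) \<le> 6" by (simp add: cand_def gather_props del: neighbours_props addr_props)
qed

abbreviation cell_names :: "vname set" where
  "cell_names \<equiv> {''C'', ''x'', ''T'', ''g'', ''h'', ''e'', ''Z'', ''d'', ''a'', ''q'', ''w'', ''o'', ''S'', ''i'', ''K'', ''p'', ''pp'',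
     ''u'', ''v'', ''m'', ''mi'', ''f''}"

lemma cands_wnames: "wnames (unroll k cand) \<subseteq> cand_names"
  by (intro wnames_unroll cand_wnames)

lemma cell_wnames: "wnames cell \<subseteq> cell_names"
proof -
  have "wnames copy \<subseteq> cell_names" by (rule order_trans[OF copy_wnames]) simp
  moreover have "wnames (memb k ''c'') \<subseteq> cell_names" by (rule order_trans[OF memb_wnames]) simp
  moreover have "wnames (reach k ''c'') \<subseteq> cell_names" by (rule order_trans[OF reach_wnames]) simp
  moreover have "wnames (unroll k cand) \<subseteq> cell_names" by (rule order_trans[OF cands_wnames]) simp
  ultimately show ?thesis by (simp add: cell_def)
qed

lemma cell_keep [simp]: "x \<notin> cell_names \<Longrightarrow> run n cell s x = s x"
  by (rule run_keep[OF contra_subsetD[OF cell_wnames]])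

lemma cands_x: "''x'' \<notin> wnames (unroll k cand)"
  by (rule contra_subsetD[OF cands_wnames]) simp

lemma cell_props: "wf_loops cell" "depth cell \<le> 7"
proof -
  have "wf_loops (unroll k cand)" by (intro wf_unroll cand_props)
  then show "wf_loops cell" using cands_x by (simp add: cell_def not_writes)
  have "depth (unroll k cand) \<le> 6" by (intro depth_unroll cand_props)
  then show "depth cell \<le> 7" by (simp add: cell_def)
qed

lemma try_root_wnames: "wnames try_root \<subseteq> {''answer'', ''e'', ''Z'', ''d'', ''a'', ''q'', ''w'', ''o'', ''S'', ''i'', ''K'', ''p'', ''pp'',
    ''u'', ''v'', ''m'', ''mi'', ''f''}" (is "_ \<subseteq> ?X")
proof -
  have "wnames (unroll k (\<lambda>j. FAssign ''e'' (Const j) (var ''r''))) \<subseteq> ?X" by (rule wnames_unroll) simp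
  moreover have "wnames gather \<subseteq> ?X" by (rule order_trans[OF gather_wnames]) simp
  moreover have "wnames (switch (Suc Q) (var ''w'') (\<lambda>p. if accepting k (decode p) then assign ''answer'' (Const 1) else FSkip)) \<subseteq> ?X"
    by (rule wnames_switch) simp
  ultimately show ?thesis by (simp add: try_root_def del: switch.simps)
qed

lemma try_root_keep: "x \<notin> {''answer'', ''e'', ''Z'', ''d'', ''a'', ''q'', ''w'', ''o'', ''S'', ''i'', ''K'', ''p'', ''pp'',
    ''u'', ''v'', ''m'', ''mi'', ''f''} \<Longrightarrow> run n try_root s x = s x"
  by (rule run_keep[OF contra_subsetD[OF try_root_wnames]])

lemma try_root_props: "wf_loops try_root" "depth try_root \<le> 6"
proof -
  have "wf_loops (switch (Suc Q) (var ''w'') (\<lambda>p. if accepting k (decode p) then assign ''answer'' (Const 1) else FSkip))"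
    by (rule wf_switch) simp
  moreover have "wf_loops (unroll k (\<lambda>j. FAssign ''e'' (Const j) (var ''r'')))"
    by (rule wf_unroll) simp
  ultimately show "wf_loops try_root" by (simp add: try_root_def gather_props del: switch.simps)
  have "depth (switch (Suc Q) (var ''w'') (\<lambda>p. if accepting k (decode p) then assign ''answer'' (Const 1) else FSkip)) \<le> 0"
    by (rule depth_switch) simp
  moreover have "depth (unroll k (\<lambda>j. FAssign ''e'' (Const j) (var ''r''))) \<le> 0"
    by (rule depth_unroll) simp
  ultimately show "depth try_root \<le> 6" by (simp add: try_root_def gather_props del: switch.simps)
qed

lemma table_wnames: "wnames table \<subseteq> {''rd'', ''b'', ''c''} \<union> cell_names"
proof -
  have "wnames (nest k (FFor ''c'' 0 cell)) \<subseteq> insert ''b'' (insert ''c'' (wnames cell))"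
    using wnames_nest[of k "FFor ''c'' 0 cell"] by simp
  then have "wnames table \<subseteq> {''rd'', ''b'', ''c''} \<union> wnames cell" by (simp add: table_def) blast
  also have "\<dots> \<subseteq> {''rd'', ''b'', ''c''} \<union> cell_names" by (rule Un_mono[OF order_refl cell_wnames])
  finally show ?thesis .
qed

text \<open>One loop for the rounds, \<open>k\<close> loops for the tuple, one for \<open>c\<close>
  and at most seven levels inside \<open>cell\<close> add up to \<open>k + 9\<close>.\<close>

lemma program_props: "wf_loops program" "depth program \<le> k + 9" "(''n'', 0) \<notin> writes program"
proof -
  have nc: "''b'' \<notin> wnames (FFor ''c'' 0 cell)" "''c'' \<notin> wnames cell"
    using contra_subsetD[OF cell_wnames, of "''b''"] contra_subsetD[OF cell_wnames, of "''c''"] by simp_all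
  have "''rd'' \<notin> wnames cell" by (rule contra_subsetD[OF cell_wnames]) simp
  then have "''rd'' \<notin> wnames (nest k (FFor ''c'' 0 cell))"
    using wnames_nest[of k "FFor ''c'' 0 cell"] by auto
  moreover have "wf_loops (nest k (FFor ''c'' 0 cell))"
    by (rule wf_nest[OF nc(1)]) (use nc(2) cell_props in \<open>simp add: not_writes\<close>)
  moreover have "''r'' \<notin> wnames try_root" by (rule contra_subsetD[OF try_root_wnames]) simp
  ultimately show "wf_loops program" using try_root_props(1) by (simp add: program_def table_def not_writes)
  show "depth program \<le> k + 9"
    using cell_props(2) try_root_props(2) by (simp add: program_def table_def depth_nest)
  have "''n'' \<notin> wnames table" by (rule contra_subsetD[OF table_wnames]) simp
  moreover have "''n'' \<notin> wnames try_root" by (rule contra_subsetD[OF try_root_wnames]) simp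
  ultimately have "''n'' \<notin> wnames program" by (simp add: program_def)
  then show "(''n'', 0) \<notin> writes program" by (rule not_writes)
qed

end


context type_program
begin

section \<open>Correctness of the table and of the answer\<close>

lemma run_slotc:
  assumes st: "stored s" and l: "l < k" "s ''b'' l < n" and y: "y \<notin> {''m'', ''mi'', ''h''}" "s y 0 < n"
  shows "run n (slotc l y) s ''h'' 0 = 0 \<longleftrightarrow> \<not> slot_adj adj (tup k s ''b'') l (s y 0)"
proof -
  let ?s1 = "upd ''h'' 0 (s ''adj'' (n * s ''b'' l + s y 0)) (run n (mul ''b'' l) s)"
  let ?u = "unroll l (\<lambda>i. FIf (neq (Cell ''b'' (Const i)) (Cell ''b'' (Const l))) FSkip (assign ''h'' (Const 0)))"
  have h: "s ''adj'' (n * s ''b'' l + s y 0) \<noteq> 0 \<longleftrightarrow> adj (s ''b'' l) (s y 0)"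
    using st[unfolded stored_def, rule_format, OF l(2) y(2)] .
  let ?I = "\<lambda>j t. t ''b'' = s ''b'' \<and>
    (t ''h'' 0 = 0 \<longleftrightarrow> \<not> (adj (s ''b'' l) (s y 0) \<and> (\<forall>i<j. s ''b'' i \<noteq> s ''b'' l)))"
  have "?I l (run n ?u ?s1)"
    by (rule run_unroll[where I="?I"]) (use h in \<open>auto simp: less_Suc_eq\<close>)
  moreover have "run n (slotc l y) s = run n ?u ?s1" using y by (simp add: slotc_def)
  moreover have "(\<forall>i<l. tup k s ''b'' ! i \<noteq> tup k s ''b'' ! l) \<longleftrightarrow> (\<forall>i<l. s ''b'' i \<noteq> s ''b'' l)"
    using l(1) by auto
  ultimately show ?thesis using l(1) by (simp add: slot_adj_def)
qed

lemma run_droppable: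
  assumes st: "stored s" and j: "j < k" "s ''b'' j < n"
  shows "run n (droppable j) s ''o'' 0 \<noteq> 0 \<longleftrightarrow> (\<forall>u<n. s ''C'' u \<noteq> 0 \<longrightarrow> \<not> slot_adj adj (tup k s ''b'') j u)"
proof -
  let ?body = "FIf (Cell ''C'' (var ''u'')) (slotc j ''u'' ;; FIf (var ''h'') (assign ''o'' (Const 0)) FSkip) FSkip"
  let ?P = "\<lambda>u. s ''C'' u \<noteq> 0 \<longrightarrow> \<not> slot_adj adj (tup k s ''b'') j u"
  let ?I = "\<lambda>q t. t ''adj'' = s ''adj'' \<and> t ''b'' = s ''b'' \<and> t ''C'' = s ''C'' \<and> (t ''o'' 0 \<noteq> 0 \<longleftrightarrow> (\<forall>u<q. ?P u))"
  have "?I n (run n (FFor ''u'' 0 ?body) (upd ''o'' 0 1 s))"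
  proof (rule run_for[where I="?I"])
    show "(''u'', 0) \<notin> writes ?body" by (rule not_writes) (use slotc_u in simp)
    show "?I 0 (upd ''u'' 0 0 (upd ''o'' 0 1 s))" by simp
  next
    fix q t assume q: "q < n" "t ''u'' 0 = q" and I: "?I q t"
    have stt: "stored t" using I st by (simp add: stored_def)
    have tb: "tup k t ''b'' = tup k s ''b''" using I by (intro tup_cong) simp
    have h: "run n (slotc j ''u'') t ''h'' 0 = 0 \<longleftrightarrow> \<not> slot_adj adj (tup k s ''b'') j q"
      using run_slotc[OF stt j(1), of "''u''"] q I j(2) tb by simp
    have all: "(\<forall>u<Suc q. ?P u) \<longleftrightarrow> (\<forall>u<q. ?P u) \<and> ?P q" by (auto simp: less_Suc_eq)
    show "?I (Suc q) (upd ''u'' 0 (Suc q) (run n ?body t))"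
      unfolding all using I q h by (cases "s ''C'' q = 0"; cases "slot_adj adj (tup k s ''b'') j q") simp_all
  qed
  moreover have "run n (droppable j) s = run n (FFor ''u'' 0 ?body) (upd ''o'' 0 1 s)" by (simp add: droppable_def)
  ultimately show ?thesis by simp
qed

lemma run_neighbours:
  assumes st: "stored s" and b: "\<And>l. l < k \<Longrightarrow> s ''b'' l < n" and x: "s ''x'' 0 < n"
  shows "l < k \<Longrightarrow> run n neighbours s ''g'' l \<noteq> 0 \<longleftrightarrow> slot_adj adj (tup k s ''b'') l (s ''x'' 0)"
proof -
  let ?I = "\<lambda>j t. t ''adj'' = s ''adj'' \<and> t ''b'' = s ''b'' \<and> t ''x'' = s ''x'' \<and>
    (\<forall>l<j. t ''g'' l \<noteq> 0 \<longleftrightarrow> slot_adj adj (tup k s ''b'') l (s ''x'' 0))"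
  have "?I k (run n neighbours s)"
    unfolding neighbours_def
  proof (rule run_unroll[where I="?I"])
    show "?I 0 s" by simp
  next
    fix j t assume j: "j < k" and I: "?I j t"
    have stt: "stored t" using I st by (simp add: stored_def)
    have tb: "tup k t ''b'' = tup k s ''b''" using I by (intro tup_cong) simp
    have h: "run n (slotc j ''x'') t ''h'' 0 = 0 \<longleftrightarrow> \<not> slot_adj adj (tup k s ''b'') j (s ''x'' 0)"
      using run_slotc[OF stt j, of "''x''"] I b[OF j] x tb by simp
    show "?I (Suc j) (run n (slotc j ''x'' ;; FAssign ''g'' (Const j) (var ''h'')) t)"
      using I h by (auto simp: upd_apply less_Suc_eq)
  qed
  then show "l < k \<Longrightarrow> run n neighbours s ''g'' l \<noteq> 0 \<longleftrightarrow> slot_adj adj (tup k s ''b'') l (s ''x'' 0)" by blast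
qed

lemma step_code_ptype:
  assumes c: "c < n" "c \<notin> set b" and b: "length b = k" and j: "j < k"
    and x: "x \<in> comp_of adj (set b) c" and drop: "\<forall>u\<in>comp_of adj (set b) c. \<not> slot_adj adj b j u"
  shows "step_code j {l. l < k \<and> slot_adj adj b l x}
      (code (lang adj (comp_of adj (set b) c - {x}) (slot_adj adj (b[j := x])) k k)) = code (ptype b c)"
proof -
  have "finite (comp_of adj (set b) c)" using comp_less[OF c(1)] finite_subset by blast
  then have "ptype b c = stepop j {l. slot_adj adj b l x} k k
      (lang adj (comp_of adj (set b) c - {x}) (slot_adj adj (b[j := x])) k k)"
    unfolding ptype_def
  proof (rule lang_step[OF _ x adj_sym adj_irr j])
    fix u assume "u \<in> comp_of adj (set b) c"
    then show "\<not> slot_adj adj b j u" using drop by blast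
  next
    fix u i assume "u \<in> comp_of adj (set b) c - {x}"
    then show "slot_adj adj (b[j := x]) i u = (if i = j then adj x u else slot_adj adj b i u)"
      using slot_adj_update[OF c(2) x _ drop] j b by simp
  qed simp_all
  moreover have "{l. l < k \<and> slot_adj adj b l x} = {l. slot_adj adj b l x}"
    using b by (auto simp: slot_adj_def)
  ultimately show ?thesis by (simp add: step_code_def decode_code nice_lang)
qed

definition enters :: "nat list \<Rightarrow> nat \<Rightarrow> store \<Rightarrow> store \<Rightarrow> bool" where
  "enters b c s s' \<longleftrightarrow> s' ''T'' = s ''T'' \<or> s' ''T'' = (s ''T'')(enc n (b @ [c]) := code (ptype b c))"

text \<open>Whichever \<open>x\<close> and \<open>j\<close> are tried, a written entry is the true
  type of the pair, because \<open>step_code_ptype\<close> is an equation. That something is written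
  requires slot \<open>j\<close> to be free and the entries of all remaining components to be
  known.\<close>

lemma run_cand:
  assumes st: "stored s" and j: "j < k" and b: "b = tup k s ''b''" "set b \<subseteq> {..<n}"
    and c: "c = s ''c'' 0" "c < n" "c \<notin> set b"
    and C: "\<And>v. v < n \<Longrightarrow> s ''C'' v \<noteq> 0 \<longleftrightarrow> v \<in> comp_of adj (set b) c"
    and x: "x = s ''x'' 0" "x \<in> comp_of adj (set b) c"
    and sound: "\<And>d. d < n \<Longrightarrow> sound_at s (b[j := x]) d"
  shows "enters b c s (run n (cand j) s)"
    and "(\<forall>u\<in>comp_of adj (set b) c. \<not> slot_adj adj b j u) \<Longrightarrow>
      (\<forall>d\<in>comp_of adj (set b) c - {x}. s ''T'' (enc n (b[j := x] @ [d])) \<noteq> 0) \<Longrightarrow>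
      run n (cand j) s ''T'' (enc n (b @ [c])) \<noteq> 0"
proof -
  let ?C = "comp_of adj (set b) c" and ?b = "b[j := x]" and ?A = "enc n (b @ [c])"
  have Cn: "?C \<subseteq> {..<n}" by (rule comp_less[OF c(2)])
  have lb: "length b = k" using b(1) by simp
  have bl: "s ''b'' l < n" if "l < k" for l using b that by (auto simp: set_tup)
  have xn: "x < n" using x(2) Cn by blast
  let ?s1 = "run n (droppable j) s"
  have "?s1 ''o'' 0 \<noteq> 0 \<longleftrightarrow> (\<forall>u<n. s ''C'' u \<noteq> 0 \<longrightarrow> \<not> slot_adj adj b j u)"
    using run_droppable[OF st j bl[OF j]] b(1) by simp
  also have "\<dots> \<longleftrightarrow> (\<forall>u\<in>?C. \<not> slot_adj adj b j u)" using C Cn by blast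
  finally have drop: "?s1 ''o'' 0 \<noteq> 0 \<longleftrightarrow> (\<forall>u\<in>?C. \<not> slot_adj adj b j u)" .
  have "enters b c s (run n (cand j) s) \<and>
    ((\<forall>u\<in>?C. \<not> slot_adj adj b j u) \<longrightarrow> (\<forall>d\<in>?C - {x}. s ''T'' (enc n (?b @ [d])) \<noteq> 0) \<longrightarrow>
      run n (cand j) s ''T'' ?A \<noteq> 0)"
  proof (cases "?s1 ''o'' 0 = 0")
    case True
    then have "run n (cand j) s = ?s1" by (simp add: cand_def)
    then have "enters b c s (run n (cand j) s)" by (simp add: enters_def)
    moreover have "\<not> (\<forall>u\<in>?C. \<not> slot_adj adj b j u)" using True drop by blast
    ultimately show ?thesis by blast
  next
    case False
    then have dr: "\<forall>u\<in>?C. \<not> slot_adj adj b j u" using drop by blast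
    let ?s2 = "run n (prepare j) ?s1"
    let ?s3 = "run n gather ?s2"
    have x1: "?s1 ''x'' 0 < n" using x(1) xn by simp
    have b1: "tup k ?s1 ''b'' = b" unfolding b(1) by (rule tup_cong) simp
    have e2: "tup k ?s2 ''e'' = ?b" using run_prepare(1)[where s="?s1" and n=n, OF j x1] b1 x(1) by simp
    have Z2: "{v. v < n \<and> ?s2 ''Z'' v \<noteq> 0} = ?C - {x}"
    proof -
      have "?s2 ''Z'' v \<noteq> 0 \<longleftrightarrow> v \<in> ?C - {x}" if "v < n" for v
        using run_prepare(2)[where s="?s1" and n=n, OF j x1 that] C[OF that] x(1) by simp
      then show ?thesis using Cn by blast
    qed
    have st2: "stored ?s2" using st by (simp add: stored_def)
    have o2: "?s2 ''o'' 0 \<noteq> 0" using False by simp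
    have T2: "?s2 ''T'' = s ''T''" by simp
    have sb: "set ?b \<subseteq> insert x (set b)" by (rule set_update_subset_insert)
    have ZB: "(?C - {x}) \<inter> set ?b = {}" using sb comp_of_avoid[OF _ c(3)] by blast
    have closed: "comp_of adj (set ?b) d \<subseteq> ?C - {x}" if "d \<in> ?C - {x}" for d
      by (rule comp_of_update[OF c(3) x(2) _ dr adj_sym that]) (use j lb in simp)
    have snd: "sound_at ?s2 ?b d" if "d \<in> ?C - {x}" for d
    proof -
      have "d < n" using that Cn by blast
      then show ?thesis using sound[of d] unfolding sound_at_def T2 by blast
    qed
    have ga: "?s3 ''o'' 0 \<noteq> 0 \<Longrightarrow> ?s3 ''w'' 0 = code (lang adj (?C - {x}) (slot_adj adj ?b) k k)"
      "?s3 ''o'' 0 = 0 \<Longrightarrow> \<exists>d\<in>?C - {x}. ?s2 ''T'' (enc n (?b @ [d])) = 0"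
      by (rule run_gather[OF st2 o2 e2[symmetric] Z2[symmetric] ZB closed snd]; assumption)+
    show ?thesis
    proof (cases "?s3 ''o'' 0 = 0")
      case True
      then have "run n (cand j) s = ?s3" using False by (simp add: cand_def)
      then have "enters b c s (run n (cand j) s)" by (simp add: enters_def)
      moreover have "\<exists>d\<in>?C - {x}. s ''T'' (enc n (?b @ [d])) = 0" using ga(2)[OF True] unfolding T2 .
      ultimately show ?thesis by blast
    next
      case nz: False
      have w: "?s3 ''w'' 0 = code (lang adj (?C - {x}) (slot_adj adj ?b) k k)" by (rule ga(1)[OF nz])
      let ?s4 = "run n neighbours ?s3"
      let ?s5 = "run n copy ?s4"
      let ?s6 = "run n (addr k ''c'') ?s5"
      have r: "run n (cand j) s = run n (enter j) ?s6" using False nz by (simp add: cand_def)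
      have st3: "stored ?s3" using st by (simp add: stored_def)
      have b3: "tup k ?s3 ''b'' = b" unfolding b(1) by (rule tup_cong) simp
      have "?s4 ''g'' l \<noteq> 0 \<longleftrightarrow> slot_adj adj b l x" if "l < k" for l
        using run_neighbours[OF st3 _ _ that] bl x(1) xn b3 by simp
      then have g: "{l. l < k \<and> ?s6 ''g'' l \<noteq> 0} = {l. l < k \<and> slot_adj adj b l x}" by auto
      have b4: "tup k ?s4 ''b'' = b" unfolding b(1) by (rule tup_cong) simp
      have a6: "?s6 ''a'' 0 = ?A" using b4 c(1) by simp
      have w6: "?s6 ''w'' 0 = code (lang adj (?C - {x}) (slot_adj adj ?b) k k)" using w by simp
      have "run n (enter j) ?s6 = upd ''T'' (?s6 ''a'' 0)
          (step_code j {l. l < k \<and> ?s6 ''g'' l \<noteq> 0} (?s6 ''w'' 0)) ?s6"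
        by (rule run_enter) (unfold w6, rule code_lang)
      then have "run n (cand j) s = upd ''T'' ?A (code (ptype b c)) ?s6"
        unfolding r g a6 w6 step_code_ptype[OF c(2,3) lb j x(2) dr] .
      moreover have "?s6 ''T'' = s ''T''" by simp
      ultimately have T: "run n (cand j) s ''T'' = (s ''T'')(?A := code (ptype b c))"
        by (simp add: upd_def)
      have "code (ptype b c) \<noteq> 0" using code_lang(2) unfolding ptype_def by (metis not_one_le_zero)
      then show ?thesis using T by (simp add: enters_def)
    qed
  qed
  then show "enters b c s (run n (cand j) s)"
    and "(\<forall>u\<in>?C. \<not> slot_adj adj b j u) \<Longrightarrow> (\<forall>d\<in>?C - {x}. s ''T'' (enc n (?b @ [d])) \<noteq> 0) \<Longrightarrow>
      run n (cand j) s ''T'' ?A \<noteq> 0"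
    by blast+
qed

definition sound :: "store \<Rightarrow> bool" where
  "sound s \<longleftrightarrow> (\<forall>b c. length b = k \<longrightarrow> set b \<subseteq> {..<n} \<longrightarrow> c < n \<longrightarrow> sound_at s b c)"

definition grows :: "store \<Rightarrow> store \<Rightarrow> bool" where
  "grows s s' \<longleftrightarrow> (\<forall>a. s ''T'' a \<noteq> 0 \<longrightarrow> s' ''T'' a \<noteq> 0)"

lemma code_ptype_pos: "code (ptype b c) \<noteq> 0"
  using code_lang(2) unfolding ptype_def by (metis not_one_le_zero)

lemma enters_grows: "enters b c s s' \<Longrightarrow> grows s s'"
  using code_ptype_pos by (auto simp: enters_def grows_def)

text \<open>By \<open>enc_inj\<close> the write touches the entry of one pair only.\<close>

lemma enters_sound:
  assumes e: "enters b c s s'" and s: "sound s" and b: "length b = k" "set b \<subseteq> {..<n}" "c < n"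
  shows "sound s'"
  unfolding sound_def
proof (intro allI impI)
  fix b' c' assume b': "length b' = k" "set b' \<subseteq> {..<n}" "c' < n"
  have s0: "sound_at s b' c'" using s b' by (simp add: sound_def)
  show "sound_at s' b' c'"
  proof (cases "enc n (b' @ [c']) = enc n (b @ [c])")
    case True
    have "b' @ [c'] = b @ [c]" by (rule enc_inj[OF _ _ _ True]) (use b b' in auto)
    then show ?thesis using e s0 by (auto simp: enters_def sound_at_def)
  next
    case False
    then show ?thesis using e s0 by (auto simp: enters_def sound_at_def)
  qed
qed

lemma grows_refl: "grows s s"
  by (simp add: grows_def)

lemma grows_trans: "grows s t \<Longrightarrow> grows t u \<Longrightarrow> grows s u"
  by (simp add: grows_def)


text \<open>For a derivable pair the loops over \<open>x\<close> and \<open>j\<close> meet the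
  choice made by the derivation. The components left over are strictly smaller there, so the
  assumption supplies their entries.\<close>

lemma run_cell:
  assumes st: "stored s" and snd: "sound s" and b: "b = tup k s ''b''" and bl: "\<And>l. l < k \<Longrightarrow> s ''b'' l < n"
    and c: "c = s ''c'' 0" "c < n"
  shows "sound (run n cell s) \<and> grows s (run n cell s)"
    and "deriv adj b c \<Longrightarrow> (\<And>b' d. length b' = k \<Longrightarrow> set b' \<subseteq> {..<n} \<Longrightarrow> d < n \<Longrightarrow> deriv adj b' d \<Longrightarrow>
        card (comp_of adj (set b') d) < card (comp_of adj (set b) c) \<Longrightarrow> s ''T'' (enc n (b' @ [d])) \<noteq> 0) \<Longrightarrow>
      run n cell s ''T'' (enc n (b @ [c])) \<noteq> 0"
proof -
  let ?C = "comp_of adj (set b) c" and ?A = "enc n (b @ [c])"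
  let ?s2 = "run n (memb k ''c'') (run n copy s)"
  have lb: "length b = k" and sb: "set b \<subseteq> {..<n}" using b bl by (auto simp: set_tup)
  have Cn: "?C \<subseteq> {..<n}" by (rule comp_less[OF c(2)])
  have f: "?s2 ''f'' 0 = 0 \<longleftrightarrow> c \<notin> set b" using b c(1) by simp
  \<comment> \<open>Stated for the table at the start; it persists because entries never
    disappear.\<close>
  define good where "good j x \<longleftrightarrow> (\<forall>u\<in>?C. \<not> slot_adj adj b j u) \<and>
      (\<forall>d\<in>?C - {x}. s ''T'' (enc n (b[j := x] @ [d])) \<noteq> 0)" for j x
  have main: "sound (run n cell s) \<and> grows s (run n cell s) \<and>
      (c \<notin> set b \<longrightarrow> (\<forall>x\<in>?C. \<forall>j<k. good j x \<longrightarrow> run n cell s ''T'' ?A \<noteq> 0))"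
  proof (cases "c \<in> set b")
    case True
    then have "run n cell s = ?s2" using f by (simp add: cell_def)
    moreover have "?s2 ''T'' = s ''T''" by simp
    ultimately show ?thesis using snd True by (simp add: sound_def sound_at_def grows_def)
  next
    case False
    let ?s3 = "run n (reach k ''c'') ?s2"
    let ?I = "\<lambda>q t. t ''K'' = ?s3 ''K'' \<and> (\<forall>x\<in>{''adj'', ''b'', ''c'', ''T''}. t x = s x) \<and> (\<forall>i<q. t ''C'' i = ?s3 ''K'' i)"
    let ?s4 = "run n (FFor ''i'' 0 (FAssign ''C'' (var ''i'') (Cell ''K'' (var ''i'')))) ?s3"
    have I4: "?I n ?s4"
      by (rule run_for[where I="?I"]) (auto simp: upd_apply less_Suc_eq)
    have st2: "stored ?s2" using st by (simp add: stored_def)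
    have "tup k ?s2 ''e'' = tup k (run n copy s) ''e''" by (rule tup_cong) simp
    then have e2: "tup k ?s2 ''e'' = b" using b by simp
    have C4: "?s4 ''C'' v \<noteq> 0 \<longleftrightarrow> v \<in> ?C" if "v < n" for v
      using run_reach[OF st2, of "''c''" v k] e2 c that I4 by simp
    define P where "P q j t \<longleftrightarrow> (\<forall>x\<in>{''adj'', ''b'', ''c''}. t x = s x) \<and> (\<forall>v<n. t ''C'' v \<noteq> 0 \<longleftrightarrow> v \<in> ?C) \<and>
        sound t \<and> grows s t \<and>
        (\<forall>x j'. x \<in> ?C \<longrightarrow> j' < k \<longrightarrow> good j' x \<longrightarrow> x < q \<or> (x = q \<and> j' < j) \<longrightarrow> t ''T'' ?A \<noteq> 0)"
      for q j :: nat and t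
    have snd_cong: "sound t \<longleftrightarrow> sound t'" if "t ''T'' = t' ''T''" for t t'
      using that by (simp add: sound_def sound_at_def)
    have P_upd: "P q j (upd ''x'' i a t) \<longleftrightarrow> P q j t" for q j i a t
      using snd_cong[of "upd ''x'' i a t" t] by (simp add: P_def grows_def)
    have P0: "P 0 0 ?s4"
      using I4 C4 snd snd_cong[of ?s4 s] by (simp add: P_def grows_def)
    let ?body = "FIf (Cell ''C'' (var ''x'')) (unroll k cand) FSkip"
    have step: "P (Suc q) 0 (run n ?body t)" if q: "q < n" "t ''x'' 0 = q" "P q 0 t" for q t
    proof (cases "q \<in> ?C")
      case no: False
      have "t ''C'' q = 0" using q(1,3) no unfolding P_def by auto
      then have "run n ?body t = t" using q(2) by simp
      moreover have "P (Suc q) 0 t" using q(3) no unfolding P_def by (auto simp: less_Suc_eq)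
      ultimately show ?thesis by simp
    next
      case yes: True
      have "t ''C'' q \<noteq> 0" using q(1,3) yes unfolding P_def by auto
      then have r: "run n ?body t = run n (unroll k cand) t" using q(2) by simp
      have "(\<lambda>j t. t ''x'' 0 = q \<and> P q j t) k (run n (unroll k cand) t)"
      proof (rule run_unroll[where I="\<lambda>j t. t ''x'' 0 = q \<and> P q j t"])
        show "t ''x'' 0 = q \<and> P q 0 t" using q by blast
      next
        fix j t assume j: "j < k" and I: "t ''x'' 0 = q \<and> P q j t"
        let ?t = "run n (cand j) t"
        have keep: "t ''adj'' = s ''adj''" "t ''b'' = s ''b''" "t ''c'' = s ''c''" and tC: "\<And>v. v < n \<Longrightarrow> t ''C'' v \<noteq> 0 \<longleftrightarrow> v \<in> ?C"
          and ts: "sound t" and tg: "grows s t"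
          using I unfolding P_def by blast+
        have stt: "stored t" using st keep by (simp add: stored_def)
        have tb: "b = tup k t ''b''" unfolding b by (rule tup_cong) (simp add: keep)
        have tc: "c = t ''c'' 0" using c keep by simp
        have sat: "sound_at t (b[j := q]) d" if "d < n" for d
        proof -
          have "set (b[j := q]) \<subseteq> {..<n}" using set_update_subset_insert[of b j q] sb q(1) by auto
          then show ?thesis using ts that lb unfolding sound_def by simp
        qed
        have tx: "q = t ''x'' 0" using I by simp
        note rc = run_cand[OF stt j tb sb tc c(2) False tC tx yes sat]
        have g: "grows s ?t" using grows_trans[OF tg enters_grows[OF rc(1)]] .
        have "?t ''T'' ?A \<noteq> 0" if *: "x \<in> ?C" "j' < k" "good j' x" "x < q \<or> (x = q \<and> j' < Suc j)" for x j'
        proof (cases "x = q \<and> j' = j")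
          case True
          have "\<forall>d\<in>?C - {q}. t ''T'' (enc n (b[j := q] @ [d])) \<noteq> 0"
            using *(3) True tg unfolding good_def grows_def by blast
          then show ?thesis using rc(2) *(3) True unfolding good_def by blast
        next
          case no: False
          then have "x < q \<or> (x = q \<and> j' < j)" using *(4) by auto
          then have "t ''T'' ?A \<noteq> 0" using I * unfolding P_def by blast
          then show ?thesis using enters_grows[OF rc(1)] unfolding grows_def by blast
        qed
        moreover have "\<forall>x\<in>{''adj'', ''b'', ''c''}. ?t x = s x" using keep by simp
        moreover have "\<forall>v<n. ?t ''C'' v \<noteq> 0 \<longleftrightarrow> v \<in> ?C" using tC by simp
        moreover have "sound ?t" by (rule enters_sound[OF rc(1) ts lb sb c(2)])
        ultimately have "P q (Suc j) ?t" using g unfolding P_def by blast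
        then show "?t ''x'' 0 = q \<and> P q (Suc j) ?t" using I by simp
      qed
      then have Pk: "P q k (run n (unroll k cand) t)" by simp
      have "x < q \<or> (x = q \<and> j' < k)" if "j' < k" "x < Suc q \<or> (x = Suc q \<and> j' < 0)" for x j'
        using that by auto
      then have "P (Suc q) 0 (run n (unroll k cand) t)" using Pk unfolding P_def by blast
      then show ?thesis using r by simp
    qed
    have "(\<lambda>q t. P q 0 t) n (run n (FFor ''x'' 0 ?body) ?s4)"
    proof (rule run_for[where I="\<lambda>q t. P q 0 t"])
      show "(''x'', 0) \<notin> writes ?body" by (rule not_writes) (use cands_x in simp)
      show "P 0 0 (upd ''x'' 0 0 ?s4)" using P0 P_upd by simp
    next
      fix q t assume "q < n" "t ''x'' 0 = q" "P q 0 t"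
      then show "P (Suc q) 0 (upd ''x'' 0 (Suc q) (run n ?body t))" unfolding P_upd by (rule step)
    qed
    moreover have "run n cell s = run n (FFor ''x'' 0 ?body) ?s4" using False f by (simp add: cell_def)
    ultimately have "P n 0 (run n cell s)" by simp
    then show ?thesis using Cn unfolding P_def by blast
  qed
  then show "sound (run n cell s) \<and> grows s (run n cell s)" by blast
  assume d: "deriv adj b c" and IH: "\<And>b' d. length b' = k \<Longrightarrow> set b' \<subseteq> {..<n} \<Longrightarrow> d < n \<Longrightarrow> deriv adj b' d \<Longrightarrow>
        card (comp_of adj (set b') d) < card ?C \<Longrightarrow> s ''T'' (enc n (b' @ [d])) \<noteq> 0"
  from d obtain x j where cb: "c \<notin> set b" and x: "x \<in> ?C" and j: "j < length b"
    and drop: "\<forall>u\<in>?C. \<not> slot_adj adj b j u" and ds: "\<And>d. d \<in> ?C - {x} \<Longrightarrow> deriv adj (b[j := x]) d"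
    by (cases rule: deriv.cases) blast
  have "s ''T'' (enc n (b[j := x] @ [d])) \<noteq> 0" if d: "d \<in> ?C - {x}" for d
  proof (rule IH)
    show "length (b[j := x]) = k" using lb by simp
    show "set (b[j := x]) \<subseteq> {..<n}" using set_update_subset_insert[of b j x] sb x Cn by auto
    show "d < n" using d Cn by auto
    show "deriv adj (b[j := x]) d" by (rule ds[OF d])
    have fin: "finite ?C" using Cn finite_subset by blast
    have "comp_of adj (set (b[j := x])) d \<subseteq> ?C - {x}"
      by (rule comp_of_update[OF cb x j drop adj_sym d])
    then have "card (comp_of adj (set (b[j := x])) d) \<le> card (?C - {x})" using fin by (intro card_mono) auto
    also have "\<dots> < card ?C" using fin x by (rule card_Diff1_less)
    finally show "card (comp_of adj (set (b[j := x])) d) < card ?C" .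
  qed
  then have "good j x" using drop unfolding good_def by blast
  then show "run n cell s ''T'' ?A \<noteq> 0" using main cb x j lb by blast
qed

text \<open>Progress is measured by component size, which drops along a derivation. Each round over
  all entries gains one size, so \<open>n\<close> rounds suffice.\<close>

definition complete_upto :: "nat \<Rightarrow> store \<Rightarrow> bool" where
  "complete_upto i s \<longleftrightarrow> (\<forall>b c. length b = k \<longrightarrow> set b \<subseteq> {..<n} \<longrightarrow> c < n \<longrightarrow> deriv adj b c \<longrightarrow>
     card (comp_of adj (set b) c) \<le> i \<longrightarrow> s ''T'' (enc n (b @ [c])) \<noteq> 0)"

lemma run_table:
  assumes st: "stored s" and T: "\<And>a. s ''T'' a = 0"
  shows "stored (run n table s)" "sound (run n table s)" "complete_upto n (run n table s)"
proof -
  define G where "G i t \<longleftrightarrow> stored t \<and> sound t \<and> complete_upto i t" for i t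
  \<comment> \<open>During round \<open>i\<close>, the entries of tuple \<open>\<tau>\<close> are
    already complete up to size \<open>Suc i\<close>; \<open>run_nest\<close> collects this for all
    tuples.\<close>
  define D where "D i \<tau> t \<longleftrightarrow> (\<forall>c<n. deriv adj \<tau> c \<longrightarrow> card (comp_of adj (set \<tau>) c) \<le> Suc i \<longrightarrow>
      t ''T'' (enc n (\<tau> @ [c])) \<noteq> 0)" for i \<tau> and t :: store
  have G_upd: "G i (upd y l a t) \<longleftrightarrow> G i t" if "y \<notin> {''adj'', ''T''}" for i y l a t
    using that by (simp add: G_def stored_def sound_def sound_at_def complete_upto_def)
  have D_upd: "D i \<tau> (upd y l a t) \<longleftrightarrow> D i \<tau> t" if "y \<noteq> ''T''" for i \<tau> y l a t
    using that by (simp add: D_def)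
  let ?row = "FFor ''c'' 0 cell"
  have cc: "''c'' \<notin> wnames cell" "''b'' \<notin> wnames ?row"
    using contra_subsetD[OF cell_wnames, of "''c''"] contra_subsetD[OF cell_wnames, of "''b''"] by simp_all
  have row: "G i (run n ?row s) \<and> (\<forall>\<tau>. D i \<tau> s \<longrightarrow> D i \<tau> (run n ?row s)) \<and> D i (tup k s ''b'') (run n ?row s)"
    if G: "G i s" and bl: "\<And>l. l < k \<Longrightarrow> s ''b'' l < n" for i s
  proof -
    let ?b = "tup k s ''b''"
    define I where "I q t \<longleftrightarrow> stored t \<and> sound t \<and> grows s t \<and> t ''b'' = s ''b'' \<and>
        (\<forall>c<q. deriv adj ?b c \<longrightarrow> card (comp_of adj (set ?b) c) \<le> Suc i \<longrightarrow> t ''T'' (enc n (?b @ [c])) \<noteq> 0)" for q t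
    have I_upd: "I q (upd ''c'' l a t) \<longleftrightarrow> I q t" for q l a t
      by (simp add: I_def stored_def sound_def sound_at_def grows_def)
    have "I n (run n ?row s)"
    proof (rule run_for[where I=I])
      show "(''c'', 0) \<notin> writes cell" by (rule not_writes[OF cc(1)])
      show "I 0 (upd ''c'' 0 0 s)" unfolding I_upd using G by (simp add: I_def G_def grows_refl)
    next
      fix q t assume q: "q < n" "t ''c'' 0 = q" and It: "I q t"
      let ?t = "run n cell t"
      have tt: "stored t" "sound t" "grows s t" "t ''b'' = s ''b''" using It by (auto simp: I_def)
      have tb: "?b = tup k t ''b''" by (rule tup_cong) (simp add: tt)
      have tl: "\<And>l. l < k \<Longrightarrow> t ''b'' l < n" using bl tt(4) by simp
      note rc = run_cell[OF tt(1,2) tb tl q(2)[symmetric] q(1)]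
      have "?t ''T'' (enc n (?b @ [c])) \<noteq> 0"
        if c: "c < Suc q" "deriv adj ?b c" "card (comp_of adj (set ?b) c) \<le> Suc i" for c
      proof (cases "c = q")
        case False
        then have "t ''T'' (enc n (?b @ [c])) \<noteq> 0" using c It by (auto simp: I_def)
        then show ?thesis using rc(1) unfolding grows_def by blast
      next
        case True
        have "t ''T'' (enc n (b' @ [d])) \<noteq> 0"
          if "length b' = k" "set b' \<subseteq> {..<n}" "d < n" "deriv adj b' d"
            "card (comp_of adj (set b') d) < card (comp_of adj (set ?b) q)" for b' d
        proof -
          have "s ''T'' (enc n (b' @ [d])) \<noteq> 0"
            using G that c(3) True unfolding G_def complete_upto_def by (metis less_Suc_eq_le less_le_trans)
          then show ?thesis using tt(3) unfolding grows_def by blast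
        qed
        then show ?thesis using rc(2) c(2) True by blast
      qed
      moreover have "stored ?t" using tt(1) by (simp add: stored_def)
      moreover have "grows s ?t" using grows_trans[OF tt(3)] rc(1) by blast
      ultimately have "I (Suc q) ?t" using rc(1) tt(4) by (simp add: I_def)
      then show "I (Suc q) (upd ''c'' 0 (Suc q) ?t)" unfolding I_upd .
    qed
    then have R: "stored (run n ?row s)" "sound (run n ?row s)" "grows s (run n ?row s)" "D i ?b (run n ?row s)"
      by (auto simp: I_def D_def)
    then show ?thesis using G unfolding G_def D_def complete_upto_def grows_def by blast
  qed
  have rd: "G (Suc i) (run n (nest k ?row) s)" if "G i s" for i s
  proof -
    have N: "G i (run n (nest k ?row) s) \<and> (\<forall>\<tau>. D i \<tau> s \<longrightarrow> D i \<tau> (run n (nest k ?row) s)) \<and>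
      (\<forall>\<tau>. length \<tau> = k \<longrightarrow> set \<tau> \<subseteq> {..<n} \<longrightarrow> (\<forall>l. k \<le> l \<longrightarrow> l < k \<longrightarrow> \<tau> ! l = s ''b'' l) \<longrightarrow>
        D i \<tau> (run n (nest k ?row) s))"
      by (rule run_nest[where G="G i" and D="D i", OF cc(2)])
         (use that row in \<open>simp_all add: G_upd D_upd\<close>)
    then have "D i \<tau> (run n (nest k ?row) s)" if "length \<tau> = k" "set \<tau> \<subseteq> {..<n}" for \<tau>
      using that by auto
    then show ?thesis using N unfolding G_def D_def complete_upto_def by blast
  qed
  have "G n (run n table s)"
    unfolding table_def
  proof (rule run_for[where I=G])
    have "''rd'' \<notin> wnames cell" by (rule contra_subsetD[OF cell_wnames]) simp
    then have "''rd'' \<notin> wnames (nest k ?row)" using wnames_nest[of k ?row] by auto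
    then show "(''rd'', 0) \<notin> writes (nest k ?row)" by (rule not_writes)
  next
    \<comment> \<open>Vacuous, as a component contains at least its vertex \<open>c\<close>.\<close>
    have "complete_upto 0 s"
      unfolding complete_upto_def
    proof (intro allI impI)
      fix b c assume c: "c < n" "card (comp_of adj (set b) c) \<le> 0"
      have "finite (comp_of adj (set b) c)" using comp_less[OF c(1)] finite_subset by blast
      then show "s ''T'' (enc n (b @ [c])) \<noteq> 0" using c(2) comp_of_self[of c adj "set b"] by auto
    qed
    then have "G 0 s" using st T by (simp add: G_def sound_def sound_at_def)
    then show "G 0 (upd ''rd'' 0 0 s)" by (simp add: G_upd)
  next
    fix q t assume "G q t"
    then have "G (Suc q) (run n (nest k ?row) t)" by (rule rd)
    then show "G (Suc q) (upd ''rd'' 0 (Suc q) (run n (nest k ?row) t))" by (simp add: G_upd)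
  qed
  then show "stored (run n table s)" "sound (run n table s)" "complete_upto n (run n table s)"
    by (auto simp: G_def)
qed

text \<open>If an entry is missing, completeness of the table and \<open>deriv_complete\<close>
  exclude a model with root \<open>r\<close>. Otherwise \<open>w\<close> is the exact type of all
  vertices but \<open>r\<close>, and its acceptance is equivalent to a model.\<close>

lemma run_try_root:
  assumes st: "stored s" and snd: "sound s" and cm: "complete_upto n s" and r: "r = s ''r'' 0" "r < n"
  shows "run n try_root s ''answer'' 0 \<noteq> 0 \<longleftrightarrow> s ''answer'' 0 \<noteq> 0 \<or> (\<exists>f e. model adj {..<n} r k f e)"
proof -
  let ?b = "replicate k r" and ?V = "{..<n}"
  let ?fill = "unroll k (\<lambda>j. FAssign ''e'' (Const j) (var ''r''))"
  let ?s1 = "run n ?fill s"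
  have "wnames ?fill \<subseteq> {''e''}" by (rule wnames_unroll) simp
  then have k1: "?s1 x = s x" if "x \<noteq> ''e''" for x using that by (intro run_keep) auto
  let ?I = "\<lambda>j t. t ''r'' = s ''r'' \<and> (\<forall>i<j. t ''e'' i = r)"
  have "?I k ?s1"
    by (rule run_unroll[where I="?I"]) (use r in \<open>auto simp: upd_apply less_Suc_eq\<close>)
  then have e1: "tup k ?s1 ''e'' = ?b" by (intro nth_equalityI) auto
  let ?s2 = "run n (FFor ''i'' 0 (FAssign ''Z'' (var ''i'') (Const 1))) ?s1"
  let ?J = "\<lambda>q t. (\<forall>x. x \<notin> {''i'', ''Z''} \<longrightarrow> t x = ?s1 x) \<and> (\<forall>i<q. t ''Z'' i = 1)"
  have J: "?J n ?s2"
    by (rule run_for[where I="?J"]) (auto simp: upd_apply less_Suc_eq)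
  then have J1: "\<And>x. x \<notin> {''i'', ''Z''} \<Longrightarrow> ?s2 x = ?s1 x" and J2: "\<And>i. i < n \<Longrightarrow> ?s2 ''Z'' i = 1"
    by blast+
  let ?s3 = "upd ''o'' 0 1 (upd ''Z'' r 0 ?s2)"
  have k3: "?s3 x = s x" if "x \<notin> {''i'', ''Z'', ''o'', ''e''}" for x
    using that J1[of x] k1[of x] by simp
  have e3: "tup k ?s3 ''e'' = ?b" unfolding e1[symmetric] by (rule tup_cong) (use J1[of "''e''"] in simp)
  have "?s3 ''Z'' v \<noteq> 0 \<longleftrightarrow> v \<noteq> r" if "v < n" for v using J2[OF that] by (simp add: upd_apply)
  then have Z3: "{v. v < n \<and> ?s3 ''Z'' v \<noteq> 0} = ?V - {r}" by blast
  have r2: "?s2 ''r'' 0 = r" using J1[of "''r''"] k1[of "''r''"] r by simp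
  let ?s4 = "run n gather ?s3"
  let ?acc = "switch (Suc Q) (var ''w'') (\<lambda>p. if accepting k (decode p) then assign ''answer'' (Const 1) else FSkip)"
  have run: "run n try_root s = run n (FIf (var ''o'') ?acc FSkip) ?s4"
    using r2 by (simp add: try_root_def del: switch.simps)
  have ans: "?s4 ''answer'' = s ''answer''" using k3[of "''answer''"] by simp
  have adj3: "?s3 ''adj'' = s ''adj''" and T3: "?s3 ''T'' = s ''T''" by (rule k3; simp)+
  have st3: "stored ?s3" using st unfolding stored_def adj3 .
  have sb: "set ?b = {r}" using k_pos by simp
  have o3: "?s3 ''o'' 0 \<noteq> 0" by simp
  have ZB: "(?V - {r}) \<inter> set ?b = {}" using sb by simp
  have closed: "comp_of adj (set ?b) d \<subseteq> ?V - {r}" if "d \<in> ?V - {r}" for d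
    using comp_less[of d "set ?b"] comp_of_avoid[of _ adj "set ?b" d] that sb by auto
  have sat: "sound_at ?s3 ?b d" if "d \<in> ?V - {r}" for d
    using snd that r(2) sb unfolding sound_def sound_at_def T3 by simp
  have ga: "?s4 ''o'' 0 \<noteq> 0 \<Longrightarrow> ?s4 ''w'' 0 = code (lang adj (?V - {r}) (slot_adj adj ?b) k k)"
    "?s4 ''o'' 0 = 0 \<Longrightarrow> \<exists>d\<in>?V - {r}. ?s3 ''T'' (enc n (?b @ [d])) = 0"
    by (rule run_gather[OF st3 o3 e3[symmetric] Z3[symmetric] ZB closed sat]; assumption)+
  have sa: "slot_adj adj ?b l v \<longleftrightarrow> l = 0 \<and> adj r v" for l v
    using k_pos by (cases l) (auto simp: slot_adj_def)
  show ?thesis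
  proof (cases "?s4 ''o'' 0 = 0")
    case True
    then obtain d where d: "d \<in> ?V - {r}" "s ''T'' (enc n (?b @ [d])) = 0" using ga(2) unfolding T3 by blast
    have "\<not> model adj ?V r k f e" for f e
    proof
      assume mod: "model adj ?V r k f e"
      have "deriv adj ?b d"
      proof (rule deriv_complete[OF mod])
        show "adj u v \<Longrightarrow> v \<in> ?V" for u v using adj_less adj_sym by blast
        \<comment> \<open>The invariant of \<open>deriv_complete\<close> holds initially because the
          root enters no later than any vertex.\<close>
        show "f u \<le> f v" if "u \<in> set ?b" "v \<in> comp_of adj (set ?b) d" for u v
        proof -
          have "v \<in> ?V" using that(2) closed[OF d(1)] by blast
          then show ?thesis using model_root[OF mod] that(1) sb by simp
        qed
      qed (use d adj_sym sb in auto)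
      moreover have "card (comp_of adj (set ?b) d) \<le> card ?V"
        using comp_less[of d "set ?b"] d by (intro card_mono) auto
      ultimately have "s ''T'' (enc n (?b @ [d])) \<noteq> 0"
        using cm[unfolded complete_upto_def, rule_format, of ?b d] d(1) sb r(2) by (simp del: enc_simps)
      then show False using d(2) by contradiction
    qed
    moreover have "run n try_root s = ?s4" unfolding run using True by simp
    ultimately show ?thesis using ans by simp
  next
    case False
    note w = ga(1)[OF False]
    have "?s4 ''w'' 0 < Suc Q" unfolding w using code_lang(1) by (simp add: less_Suc_eq_le)
    then have "run n ?acc ?s4 = run n (if accepting k (decode (?s4 ''w'' 0)) then assign ''answer'' (Const 1) else FSkip) ?s4"
      by (simp add: run_switch del: switch.simps)
    moreover have "decode (?s4 ''w'' 0) = lang adj (?V - {r}) (slot_adj adj ?b) k k"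
      unfolding w by (rule decode_code[OF nice_lang])
    moreover have "accepting k (lang adj (?V - {r}) (slot_adj adj ?b) k k) \<longleftrightarrow> (\<exists>f e. model adj ?V r k f e)"
    proof
      assume "accepting k (lang adj (?V - {r}) (slot_adj adj ?b) k k)"
      then show "\<exists>f e. model adj ?V r k f e"
        by (rule accepting_model[rotated -1]) (use r adj_sym adj_irr sa in auto)
    next
      assume "\<exists>f e. model adj ?V r k f e"
      then obtain f e where "model adj ?V r k f e" by blast
      then show "accepting k (lang adj (?V - {r}) (slot_adj adj ?b) k k)"
        by (rule model_accepting[rotated -1]) (use r adj_sym sa k_pos in auto)
    qed
    ultimately show ?thesis unfolding run using False ans by simp
  qed
qed

theorem run_program:
  assumes st: "stored s" and T: "\<And>a. s ''T'' a = 0" and ans: "s ''answer'' 0 = 0"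
  shows "run n program s ''answer'' 0 \<noteq> 0 \<longleftrightarrow> (\<exists>r<n. \<exists>f e. model adj {..<n} r k f e)"
proof -
  let ?t = "run n table s"
  define I where "I q t \<longleftrightarrow> stored t \<and> sound t \<and> complete_upto n t \<and>
      (t ''answer'' 0 \<noteq> 0 \<longleftrightarrow> (\<exists>r<q. \<exists>f e. model adj {..<n} r k f e))" for q t
  have I_upd: "I q (upd ''r'' i a t) \<longleftrightarrow> I q t" for q i a t
    by (simp add: I_def stored_def sound_def sound_at_def complete_upto_def)
  have "I n (run n (FFor ''r'' 0 try_root) ?t)"
  proof (rule run_for[where I=I])
    have "''r'' \<notin> wnames try_root" by (rule contra_subsetD[OF try_root_wnames]) simp
    then show "(''r'', 0) \<notin> writes try_root" by (rule not_writes)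
    have "?t ''answer'' = s ''answer''"
      by (rule run_keep, rule contra_subsetD[OF table_wnames]) simp
    then have "I 0 ?t" using run_table[OF st T] ans by (simp add: I_def)
    then show "I 0 (upd ''r'' 0 0 ?t)" by (simp add: I_upd)
  next
    fix q t assume q: "q < n" "t ''r'' 0 = q" and It: "I q t"
    let ?u = "run n try_root t"
    have keep: "?u ''adj'' = t ''adj''" "?u ''T'' = t ''T''" by (rule try_root_keep; simp)+
    have "stored ?u" "sound ?u" "complete_upto n ?u"
      using It unfolding I_def stored_def sound_def sound_at_def complete_upto_def keep by blast+
    moreover have "?u ''answer'' 0 \<noteq> 0 \<longleftrightarrow> (\<exists>r<Suc q. \<exists>f e. model adj {..<n} r k f e)"
    proof -
      have "?u ''answer'' 0 \<noteq> 0 \<longleftrightarrow> t ''answer'' 0 \<noteq> 0 \<or> (\<exists>f e. model adj {..<n} q k f e)"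
        by (rule run_try_root) (use It q in \<open>simp_all add: I_def\<close>)
      also have "t ''answer'' 0 \<noteq> 0 \<longleftrightarrow> (\<exists>r<q. \<exists>f e. model adj {..<n} r k f e)"
        using It unfolding I_def by blast
      finally show ?thesis unfolding less_Suc_eq by blast
    qed
    ultimately have "I (Suc q) ?u" unfolding I_def by blast
    then show "I (Suc q) (upd ''r'' 0 (Suc q) ?u)" unfolding I_upd .
  qed
  then show ?thesis by (simp add: program_def I_def)
qed

end

section \<open>Time bound and conclusion\<close>

lemma decides_in_time_mono:
  assumes "decides_in_time A Q T" "\<And>n. T n \<le> T' n"
  shows "decides_in_time A Q T'"
  unfolding decides_in_time_def
proof (intro allI impI)
  fix n and G :: "nat pair_pre_digraph" assume "pair_graph G \<and> pverts G = {..<n}"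
  then obtain t s where "exec A (graph_input n G) t s" "t \<le> T n" "s ''answer'' 0 \<noteq> 0 \<longleftrightarrow> Q G"
    using assms(1) unfolding decides_in_time_def by blast
  then show "\<exists>t s. exec A (graph_input n G) t s \<and> t \<le> T' n \<and> (s ''answer'' 0 \<noteq> 0 \<longleftrightarrow> Q G)"
    using assms(2) le_trans by blast
qed

text \<open>Column numbers are below \<open>n\<close>, so no two arcs share a cell of the
  matrix.\<close>

lemma graph_input_adj:
  assumes "pair_graph G" "pverts G = {..<n}" "u < n" "v < n"
  shows "graph_input n G ''adj'' (n * u + v) \<noteq> 0 \<longleftrightarrow> (u, v) \<in> parcs G"
proof -
  interpret pair_graph G by fact
  have "u' = u \<and> v' = v" if "(u', v') \<in> parcs G" "n * u + v = u' * n + v'" for u' v'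
  proof -
    have "v' < n" using that(1) assms(2) wellformed by fastforce
    have eq: "n * u + v = n * u' + v'" using that(2) by (simp add: mult.commute)
    from arg_cong[OF eq, of "\<lambda>z. z mod n"] have "v' = v" using assms(4) \<open>v' < n\<close> by simp
    then show ?thesis using eq assms(4) by simp
  qed
  then have "(\<exists>(u', v')\<in>parcs G. n * u + v = u' * n + v') \<longleftrightarrow> (u, v) \<in> parcs G"
    by (auto simp: mult.commute intro!: bexI[of _ "(u, v)"])
  then show ?thesis by (simp add: graph_input_def)
qed

theorem cpw_decidable:
  assumes "1 \<le> k"
  shows "\<exists>A C. decides_in_time A (\<lambda>G. cpw G \<le> enat (k - 1)) (\<lambda>n. C * max 1 n ^ (k + 9))"
proof -
  obtain h where h: "bij_betw h {M. nice k k M} {0..<card {M. nice k k M}}"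
    using ex_bij_betw_finite_nat[OF finite_nice] by blast
  define Q where "Q = card {M. nice k k M}"
  define code where "code M = Suc (h M)" for M
  \<comment> \<open>The numbering of the types, and with it the program, is fixed before the input
    graph: it depends on \<open>k\<close> only.\<close>
  interpret type_codes k Q code
  proof
    show "1 \<le> k" by fact
    show "1 \<le> code M \<and> code M \<le> Q" if "nice k k M" for M
      using bij_betwE[OF h] that by (force simp: code_def Q_def)
    show "M = M'" if "nice k k M" "nice k k M'" "code M = code M'" for M M'
      using bij_betw_imp_inj_on[OF h] that by (auto simp: code_def dest: inj_onD)
  qed
  have "decides_in_time (compile program) (\<lambda>G. cpw G \<le> enat (k - 1)) (\<lambda>n. factor program * max 1 n ^ (k + 9))"
    unfolding decides_in_time_def
  proof (intro allI impI)
    fix n and G :: "nat pair_pre_digraph" assume "pair_graph G \<and> pverts G = {..<n}"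
    then have G: "pair_graph G" and V: "pverts G = {..<n}" by auto
    interpret pair_graph G by fact
    let ?adj = "\<lambda>u v. (u, v) \<in> parcs G" and ?s = "graph_input n G"
    interpret type_program k Q code n ?adj
    proof
      show "?adj u v \<Longrightarrow> u < n" for u v using V wellformed by fastforce
      show "?adj u v \<Longrightarrow> ?adj v u" for u v by (simp add: arcs_symmetric)
      show "\<not> ?adj u u" for u using no_loops by fastforce
    qed
    have n: "?s ''n'' 0 = n" by (simp add: graph_input_def)
    obtain t where t: "exec (compile program) ?s t (run n program ?s)" "t \<le> factor program * max 1 n ^ depth program"
      using exec_compile[where c=program and s="?s" and n=n, OF program_props(1,3) n] by blast
    have "max 1 n ^ depth program \<le> max 1 n ^ (k + 9)"
      using program_props(2) by (intro power_increasing) auto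
    then have "t \<le> factor program * max 1 n ^ (k + 9)" using t(2) by (meson le_trans mult_le_mono2)
    moreover have "run n program ?s ''answer'' 0 \<noteq> 0 \<longleftrightarrow> cpw G \<le> enat (k - 1)"
    proof -
      have "stored ?s" using graph_input_adj[OF G V] by (simp add: stored_def)
      then have "run n program ?s ''answer'' 0 \<noteq> 0 \<longleftrightarrow> (\<exists>r<n. \<exists>f e. model ?adj {..<n} r k f e)"
        by (rule run_program) (simp_all add: graph_input_def)
      then show ?thesis unfolding cpw_model[OF G assms] V by auto
    qed
    ultimately show "\<exists>t s. exec (compile program) ?s t s \<and> t \<le> factor program * max 1 n ^ (k + 9) \<and>
        (s ''answer'' 0 \<noteq> 0 \<longleftrightarrow> cpw G \<le> enat (k - 1))"
      using t(1) by blast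
  qed
  then show ?thesis by blast
qed

theorem theorem1:
  shows "\<exists>(f :: nat \<Rightarrow> nat) (g :: nat \<Rightarrow> nat).
    (\<lambda>k. real (g k)) \<in> O(\<lambda>k. real k ^ 2) \<and>
    (\<forall>k\<ge>1. \<exists>A :: com.
       decides_in_time A (\<lambda>G. cpw G \<le> enat (k - 1)) (\<lambda>n. f k * (max 1 n) ^ g k) \<and>
       (\<exists>p :: nat poly. decides_in_time A (\<lambda>G. cpw G \<le> enat (k - 1)) (\<lambda>n. poly p n)))"
proof -
  have "\<forall>k. \<exists>C. 1 \<le> k \<longrightarrow> (\<exists>A. decides_in_time A (\<lambda>G. cpw G \<le> enat (k - 1)) (\<lambda>n. C * max 1 n ^ (k + 9)))"
    using cpw_decidable by blast
  then obtain f where f: "\<And>k. 1 \<le> k \<Longrightarrow>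
      \<exists>A. decides_in_time A (\<lambda>G. cpw G \<le> enat (k - 1)) (\<lambda>n. f k * max 1 n ^ (k + 9))"
    by metis
  have "(\<lambda>k. real (k + 9)) \<in> O(\<lambda>k. real k ^ 2)"
  \<comment> \<open>The exponent is linear in \<open>k\<close>, and \<open>k + 9 <= 10 * k^2\<close>
    as soon as \<open>k >= 1\<close>.\<close>
  proof (rule bigoI[where c = 10])
    show "eventually (\<lambda>k. norm (real (k + 9)) \<le> 10 * norm (real k ^ 2)) at_top"
      using eventually_ge_at_top[of 1]
    proof eventually_elim
      case (elim k)
      then have "k * 1 \<le> k * k" "1 * 1 \<le> k * k" by (intro mult_le_mono; simp)+
      then have "k + 9 \<le> 10 * k ^ 2" unfolding power2_eq_square by linarith
      then have "real (k + 9) \<le> real (10 * k ^ 2)" by (rule of_nat_mono)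
      then show ?case by simp
    qed
  qed
  moreover have "\<exists>A. decides_in_time A (\<lambda>G. cpw G \<le> enat (k - 1)) (\<lambda>n. f k * max 1 n ^ (k + 9)) \<and>
      (\<exists>p :: nat poly. decides_in_time A (\<lambda>G. cpw G \<le> enat (k - 1)) (\<lambda>n. poly p n))" if k: "1 \<le> k" for k
  proof -
    obtain A where A: "decides_in_time A (\<lambda>G. cpw G \<le> enat (k - 1)) (\<lambda>n. f k * max 1 n ^ (k + 9))"
      using f[OF k] by blast
    \<comment> \<open>\<open>max 1 n\<close> is not a polynomial in \<open>n\<close>; it is bounded
      by \<open>1 + n\<close>, the value of \<open>[:1, 1:]\<close>.\<close>
    have "f k * max 1 n ^ (k + 9) \<le> poly ([:f k:] * [:1, 1:] ^ (k + 9)) n" for n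
      by (auto intro!: mult_le_mono2 power_mono)
    from decides_in_time_mono[OF A this] show ?thesis using A by blast
  qed
  ultimately show ?thesis by (intro exI[of _ f] exI[of _ "\<lambda>k. k + 9"]) blast
qed

end
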